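(* Let $0<p,q<\infty$ and let $\omega$ be a radial weight. Then the following statements are equivalent: (i) $\omega\in\mathcal{D}$; (ii) $AL^q_p(\omega)=AL^q_p(\widetilde{\omega})$ with equivalence of quasinorms; (iii) $AT^q_p(\omega)=AT^q_p(\widetilde{\omega})$ with equivalence of quasinorms. In particular, if $\omega\in\mathcal{D}$ then $AL^q_p(\omega)=AT^q_p(\omega)=AL^q_p(\widetilde{\omega})=AT^q_p(\widetilde{\omega})$ with equivalence of quasinorms.
   Context: $\mathbb{D}$ is the open unit disc, $\mathbb{T}=\partial\mathbb{D}$, $\mathcal{H}(\mathbb{D})$ is the space of analytic functions in $\mathbb{D}$, and $dA=\frac{dx\,dy}{\pi}$. A weight is a function $\omega:\mathbb{D}\to[0,\infty)$ integrable over $\mathbb{D}$; it is radial if $\omega(z)=\omega(|z|)$ for all $z\in\mathbb{D}$. Throughout, it is assumed that $\widehat{\omega}(z)=\int_{|z|}^1\omega(s)\,ds>0$ for all $z\in\mathbb{D}$. The regularized weight is $\widetilde{\omega}(z)=\frac{\widehat{\omega}(z)}{1-|z|}$, $z\in\mathbb{D}$. A radial weight $\omega$ belongs to $\widehat{\mathcal{D}}$ if there exists $C=C(\omega)>0$ such that $\widehat{\omega}(r)\le C\,\widehat{\omega}\left(\frac{1+r}{2}\right)$ as $r\to1^-$ (i.e. for all $r<1$ sufficiently close to $1$), and to $\check{\mathcal{D}}$ if there exist $K=K(\omega)>1$ and $C=C(\omega)>1$ such that $\widehat{\omega}(r)\ge C\,\widehat{\omega}\left(1-\frac{1-r}{K}\right)$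 as $r\to1^-$. Here $\check{\mathcal D}$ is just a name of a class, and $\mathcal{D}=\widehat{\mathcal{D}}\cap\check{\mathcal{D}}$. For $\xi\in\overline{\mathbb{D}}$, $\Gamma(\xi)=\{z\in\mathbb{D}:|\arg z-\arg\xi|<|\xi|-|z|\}$ (difference of arguments modulo $2\pi$). For $0<p,q<\infty$ and a radial function $\nu:\mathbb{D}\to[0,\infty)$ (in particular $\nu=\omega$ or $\nu=\widetilde\omega$), $L^q_p(\nu)$ and $T^q_p(\nu)$ consist of the complex-valued measurable functions $f$ on $\mathbb{D}$ such that, respectively, $$\|f\|_{L^q_p(\nu)}=\left(\frac1{2\pi}\int_0^{2\pi}\left(\int_0^1|f(re^{i\theta})|^p\nu(r)r\,dr\right)^{q/p}d\theta\right)^{1/q}<\infty,$$ $$\|f\|_{T^q_p(\nu)}=\left(\int_{\mathbb{T}}\left(\int_{\Gamma(\xi)}|f(z)|^p\nu(z)\frac{dA(z)}{1-|z|}\right)^{q/p}|d\xi|\right)^{1/q}<\infty.$$ Set $AL^q_p(\nu)=L^q_p(\nu)\cap\mathcal{H}(\mathbb{D})$ and $AT^q_p(\nu)=T^q_p(\nu)\cap\mathcal{H}(\mathbb{D})$, with the inherited quasinorms. *)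

theory Defs
  imports "HOL-Analysis.Analysis"
begin

text \<open>
  Functions on the unit disc are total functions on \<^typ>\<open>complex\<close>; every notion
  below depends only on their values on \<open>ball 0 1\<close>. Measurability and integrals are in
  the sense of Lebesgue.
\<close>

definition radial_weight :: "(complex \<Rightarrow> real) \<Rightarrow> bool" where
  "radial_weight \<omega> \<longleftrightarrow>
     (\<forall>z\<in>ball 0 1. 0 \<le> \<omega> z) \<and>
     (\<forall>z\<in>ball 0 1. \<omega> z = \<omega> (of_real (cmod z))) \<and>
     set_integrable lebesgue (ball 0 1) \<omega>"

text \<open>
  The values are in \<^typ>\<open>ennreal\<close> because integrability over the disc only controls
  \<open>\<omega>(s) s\<close>: the tail integral is finite at every \<open>z \<noteq> 0\<close> of the disc,
  but may be infinite at \<open>z = 0\<close>.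
\<close>
definition tail :: "(complex \<Rightarrow> real) \<Rightarrow> complex \<Rightarrow> ennreal" where
  "tail \<omega> z = (\<integral>\<^sup>+ s\<in>{cmod z..<1}. ennreal (\<omega> (of_real s)) \<partial>lebesgue)"

definition regularized :: "(complex \<Rightarrow> real) \<Rightarrow> complex \<Rightarrow> ennreal" where
  "regularized \<omega> z = tail \<omega> z / ennreal (1 - cmod z)"

definition D_hat :: "(complex \<Rightarrow> real) set" where
  "D_hat = {\<omega>. radial_weight \<omega> \<and>
     (\<exists>C::real. C > 0 \<and>
       (\<forall>\<^sub>F r::real in at_left 1.
          tail \<omega> (of_real r) \<le> ennreal C * tail \<omega> (of_real ((1 + r) / 2))))}"

definition D_check :: "(complex \<Rightarrow> real) set" where
  "D_check = {\<omega>. radial_weight \<omega> \<and>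
     (\<exists>K C::real. K > 1 \<and> C > 1 \<and>
       (\<forall>\<^sub>F r::real in at_left 1.
          tail \<omega> (of_real r) \<ge> ennreal C * tail \<omega> (of_real (1 - (1 - r) / K))))}"

definition D_class :: "(complex \<Rightarrow> real) set" where
  "D_class = D_hat \<inter> D_check"

text \<open>Powers with a positive exponent \<open>a\<close>; in particular \<open>0\<close> is sent to \<open>0\<close>.\<close>
definition enn_powr :: "ennreal \<Rightarrow> real \<Rightarrow> ennreal" where
  "enn_powr x a = (if x = \<infinity> then \<infinity> else ennreal (enn2real x powr a))"

definition area_measure :: "complex measure" where
  "area_measure = scale_measure (ennreal (1 / pi)) lebesgue"

text \<open>
  The integer \<open>k\<close> makes the difference of arguments be taken modulo \<open>2\<pi>\<close>.
  The library convention \<open>Arg 0 = 0\<close> affects only the point \<open>z = 0\<close>, a null set, and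
  \<open>\<Gamma>(0)\<close>, which is empty anyway.
\<close>
definition Gamma_region :: "complex \<Rightarrow> complex set" where
  "Gamma_region \<xi> =
     {z \<in> ball 0 1. \<exists>k::int. \<bar>Arg z - Arg \<xi> + 2 * pi * of_int k\<bar> < cmod \<xi> - cmod z}"

definition L_norm :: "real \<Rightarrow> real \<Rightarrow> (complex \<Rightarrow> ennreal) \<Rightarrow> (complex \<Rightarrow> complex) \<Rightarrow> ennreal" where
  "L_norm q p \<nu> f =
     enn_powr
       (ennreal (1 / (2 * pi)) *
        (\<integral>\<^sup>+ \<theta>\<in>{0..2 * pi}.
           enn_powr
             (\<integral>\<^sup>+ r\<in>{0..<1}. ennreal (cmod (f (rcis r \<theta>)) powr p) * \<nu> (of_real r) * ennreal r \<partial>lebesgue)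
             (q / p) \<partial>lebesgue))
       (1 / q)"

text \<open>The unit circle with \<open>|d\<xi>|\<close> is parametrized by \<open>\<xi> = cis \<theta>\<close>.\<close>
definition T_norm :: "real \<Rightarrow> real \<Rightarrow> (complex \<Rightarrow> ennreal) \<Rightarrow> (complex \<Rightarrow> complex) \<Rightarrow> ennreal" where
  "T_norm q p \<nu> f =
     enn_powr
       (\<integral>\<^sup>+ \<theta>\<in>{0..2 * pi}.
          enn_powr
            (\<integral>\<^sup>+ z\<in>Gamma_region (cis \<theta>).
               ennreal (cmod (f z) powr p) * \<nu> z / ennreal (1 - cmod z) \<partial>area_measure)
            (q / p) \<partial>lebesgue)
       (1 / q)"

definition L_space :: "real \<Rightarrow> real \<Rightarrow> (complex \<Rightarrow> ennreal) \<Rightarrow> (complex \<Rightarrow> complex) set" where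
  "L_space q p \<nu> = {f \<in> borel_measurable (lebesgue_on (ball 0 1)). L_norm q p \<nu> f < \<infinity>}"

definition T_space :: "real \<Rightarrow> real \<Rightarrow> (complex \<Rightarrow> ennreal) \<Rightarrow> (complex \<Rightarrow> complex) set" where
  "T_space q p \<nu> = {f \<in> borel_measurable (lebesgue_on (ball 0 1)). T_norm q p \<nu> f < \<infinity>}"

definition AL_space :: "real \<Rightarrow> real \<Rightarrow> (complex \<Rightarrow> ennreal) \<Rightarrow> (complex \<Rightarrow> complex) set" where
  "AL_space q p \<nu> = L_space q p \<nu> \<inter> {f. f holomorphic_on ball 0 1}"

definition AT_space :: "real \<Rightarrow> real \<Rightarrow> (complex \<Rightarrow> ennreal) \<Rightarrow> (complex \<Rightarrow> complex) set" where
  "AT_space q p \<nu> = T_space q p \<nu> \<inter> {f. f holomorphic_on ball 0 1}"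

definition same_with_equiv_norms ::
  "'a set \<Rightarrow> ('a \<Rightarrow> ennreal) \<Rightarrow> 'a set \<Rightarrow> ('a \<Rightarrow> ennreal) \<Rightarrow> bool" where
  "same_with_equiv_norms X N Y M \<longleftrightarrow>
     X = Y \<and> (\<exists>C::real. C > 0 \<and> (\<forall>f\<in>X. N f \<le> ennreal C * M f \<and> M f \<le> ennreal C * N f))"

end

(*
  Sufficiency. Split [0,1) into dyadic shells. Let b >= 1 be an exponent with b * q/p >= 1. On the
  k-th shell, |f|^(p/b) is bounded by its Poisson integral over every circle of radius rho in the
  shell k + 2, that is by a geometric superposition of averages over arcs of length
  2^j (1 - |z|) of |f(rho e^(i t))|^(p/b). A vector-valued inequality for such averages, with
  constants independent of j, then bounds either quasinorm for one weight by either quasinorm for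
  another weight as soon as the mass of the first weight on each shell is bounded by the mass of
  the second weight two shells further out. For a weight in D, the masses of the weight and of its
  regularization on a shell are both comparable to the tail of the weight there.

  Necessity. On monomials both quasinorms are powers of moments, so the moments of the weight and
  of its regularization are comparable. Since r^x - r^y <= (y-x) (1-r) r^x, the moments phi of the
  regularization satisfy phi(x) - phi(y) <= (y-x)/x m(x) with m the moments of the weight; hence
  phi and m are doubling, the moment m(x) is comparable to the tail at 1 - 1/x, and both
  conditions defining D follow.
*)

theory Submission
  imports Defs "HOL-Complex_Analysis.Conformal_Mappings"
begin

section \<open>Powers of extended nonnegative reals\<close>

text \<open>For s = q/p < 1 averaging over arcs is unbounded on L^s: a unit mass spread over a short
  arc has averages of order one and arbitrarily small L^s norm. Subharmonicity, however, holds at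
  every positive power of |f|, so averages are taken of |f|^(p/b) and the power b is applied to the
  averages. The weight has no regularity and may vanish on most of a shell. Hence |f| is compared
  across shells, and the shell in between keeps the two circles apart at the scale of the shells,
  which bounds the Poisson kernel. The widths of the shells eventually shrink by a fixed ratio
  adapted to the constants of the class D: the doubling condition limits the loss of tail from one
  shell to the next, and the reverse condition gives each shell a fixed share of its tail. In the
  converse only exponents that are multiples of p are accessible, because the test functions are
  monomials; every estimate between moments leaves room for rounding to such a multiple.\<close>

lemma enn_powr_ennreal [simp]: "0 \<le> x \<Longrightarrow> enn_powr (ennreal x) a = ennreal (x powr a)"
  by (simp add: enn_powr_def)

lemma enn_powr_top [simp]: "enn_powr top a = top"
  by (simp add: enn_powr_def)

lemma enn_powr_0 [simp]: "enn_powr 0 a = 0"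
  by (simp add: enn_powr_def)

lemma enn_powr_one_left [simp]: "enn_powr 1 a = 1"
  by (simp add: enn_powr_def)

lemma enn_powr_one [simp]: "enn_powr x 1 = x"
  by (cases x) auto

lemma enn_powr_mono: "x \<le> y \<Longrightarrow> 0 \<le> a \<Longrightarrow> enn_powr x a \<le> enn_powr y a"
  by (cases x; cases y) (auto simp: powr_mono2 top_unique ennreal_le_iff)

lemma enn_powr_mult: "enn_powr (x * y) a = enn_powr x a * enn_powr y a"
proof (cases "x = 0 \<or> y = 0")
  case True then show ?thesis by auto
next
  case False
  then show ?thesis
    by (cases x; cases y)
      (auto simp: ennreal_mult[symmetric] powr_mult ennreal_mult_top ennreal_top_mult)
qed

lemma enn_powr_powr: "enn_powr (enn_powr x a) b = enn_powr x (a * b)"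
  by (cases x) (auto simp: powr_powr)

lemma enn_powr_add: "enn_powr x a * enn_powr x b = enn_powr x (a + b)"
  by (cases x) (auto simp: powr_add ennreal_mult)

lemma enn_powr_eq_0_iff [simp]: "enn_powr x a = 0 \<longleftrightarrow> x = 0"
  by (cases x) (auto simp: ennreal_eq_0_iff)

lemma enn_powr_eq_top_iff [simp]: "enn_powr x a = top \<longleftrightarrow> x = top"
  by (cases x) auto

lemma enn_powr_less_top_iff [simp]: "enn_powr x a < top \<longleftrightarrow> x < top"
  by (simp add: less_top[symmetric])

lemma measurable_enn_powr [measurable (raw)]:
  assumes [measurable]: "f \<in> borel_measurable M"
  shows "(\<lambda>x. enn_powr (f x) a) \<in> borel_measurable M"
  unfolding enn_powr_def by measurable

section \<open>Elementary inequalities for powers and geometric sums\<close>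

lemma enn_powr_add_le:
  assumes "0 < a" shows "enn_powr (x + y) a \<le> ennreal (2 powr a) * (enn_powr x a + enn_powr y a)"
proof -
  have *: "enn_powr (u + v) a \<le> ennreal (2 powr a) * (enn_powr u a + enn_powr v a)"
    if "u \<le> v" for u v
  proof -
    have "enn_powr (u + v) a \<le> enn_powr (2 * v) a"
      using that assms by (intro enn_powr_mono) (auto simp: mult_2 add_mono)
    also have "\<dots> = ennreal (2 powr a) * enn_powr v a"
      using enn_powr_ennreal[of 2 a] by (simp add: enn_powr_mult)
    also have "\<dots> \<le> ennreal (2 powr a) * (enn_powr u a + enn_powr v a)"
      by (intro mult_left_mono) auto
    finally show ?thesis .
  qed
  show ?thesis
    using *[of x y] *[of y x] by (cases "x \<le> y") (auto simp: add.commute)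
qed

text \<open>A weighted geometric mean is at most the maximum. This crude form of Young's inequality
  suffices, since no constant is tracked sharply.\<close>

lemma enn_powr_mult_le_add:
  assumes "0 \<le> a" "a \<le> 1" shows "enn_powr x a * enn_powr y (1 - a) \<le> x + y"
proof -
  have "enn_powr x a * enn_powr y (1 - a) \<le> enn_powr (max x y) a * enn_powr (max x y) (1 - a)"
    using assms by (intro mult_mono enn_powr_mono) auto
  also have "\<dots> = max x y"
    by (simp add: enn_powr_add)
  also have "\<dots> \<le> x + y"
    by (auto simp: max_def)
  finally show ?thesis .
qed

text \<open>The comparison of \<open>x\<close> with \<open>\<eta> * y\<close> decides which of the
  two terms alone majorizes the product. A small \<open>\<eta>\<close> later makes the term in
  \<open>y\<close> absorbable.\<close>

lemma enn_young:
  assumes "1 \<le> s" "0 < \<eta>"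
  shows "x * enn_powr y (s - 1) \<le> ennreal (\<eta> powr (1 - s)) * enn_powr x s + ennreal \<eta> * enn_powr y s"
proof (cases "x \<le> ennreal \<eta> * y")
  case True
  have "x * enn_powr y (s - 1) \<le> ennreal \<eta> * y * enn_powr y (s - 1)"
    using True by (intro mult_right_mono) auto
  also have "\<dots> = ennreal \<eta> * enn_powr y s"
    using enn_powr_add[of y 1 "s - 1"] by (simp add: mult.assoc)
  finally show ?thesis
    by (meson add_increasing zero_le)
next
  case False
  then have "ennreal \<eta> * y \<le> x" by simp
  then have "ennreal (1 / \<eta>) * (ennreal \<eta> * y) \<le> ennreal (1 / \<eta>) * x"
    by (intro mult_left_mono) auto
  then have y: "y \<le> ennreal (1 / \<eta>) * x"
    using assms by (simp add: mult.assoc[symmetric] ennreal_mult[symmetric])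
  have "x * enn_powr y (s - 1) \<le> x * enn_powr (ennreal (1 / \<eta>) * x) (s - 1)"
    using y assms by (intro mult_left_mono enn_powr_mono) auto
  also have "\<dots> = ennreal (\<eta> powr (1 - s)) * enn_powr x s"
    using assms enn_powr_add[of x 1 "s - 1"]
    by (simp add: enn_powr_mult mult.left_commute[of x] powr_divide powr_minus_divide[symmetric])
  finally show ?thesis
    by (meson add_increasing2 zero_le)
qed

text \<open>Mean value theorem for the power \<open>s\<close>, with the derivative at the
  intermediate point bounded by its value at the right end.\<close>

lemma powr_add_le_deriv:
  fixes x y s :: real
  assumes "1 \<le> s" "0 \<le> x" "0 \<le> y"
  shows "(x + y) powr s \<le> x powr s + s * y * (x + y) powr (s - 1)"
proof (cases "x = 0 \<or> y = 0")
  case True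
  moreover have "y powr s \<le> s * y * y powr (s - 1)"
  proof (cases "y = 0")
    case False
    then have "y powr s = y * y powr (s - 1)"
      using assms powr_add[of y 1 "s - 1"] by simp
    moreover have "y * y powr (s - 1) \<le> s * (y * y powr (s - 1))"
      using assms mult_right_mono[of 1 s "y * y powr (s - 1)"] by simp
    ultimately show ?thesis by (simp add: mult.assoc)
  qed auto
  ultimately show ?thesis
    by auto
next
  case False
  then have "0 < x" "0 < y" using assms by auto
  have "\<exists>z>x. z < x + y \<and> (x + y) powr s - x powr s = (x + y - x) * (s * z powr (s - 1))"
    using \<open>0 < x\<close> \<open>0 < y\<close> by (intro MVT2) (auto intro!: derivative_eq_intros)
  then obtain z where z: "x < z" "z < x + y"
    "(x + y) powr s - x powr s = y * (s * z powr (s - 1))" by auto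
  have "z powr (s - 1) \<le> (x + y) powr (s - 1)"
    using z \<open>0 < x\<close> assms by (intro powr_mono2) auto
  then have "y * (s * z powr (s - 1)) \<le> y * (s * (x + y) powr (s - 1))"
    using assms by (intro mult_left_mono) auto
  then show ?thesis using z(3) by (simp add: algebra_simps)
qed

lemma enn_powr_add_le_deriv:
  assumes "1 \<le> s"
  shows "enn_powr (x + y) s \<le> enn_powr x s + ennreal s * y * enn_powr (x + y) (s - 1)"
proof (cases "x = top \<or> y = top")
  case True
  then show ?thesis
    using assms by (auto simp: ennreal_mult_top ennreal_top_mult ennreal_eq_0_iff)
next
  case False
  then obtain u v where "x = ennreal u" "0 \<le> u" "y = ennreal v" "0 \<le> v"
    by (metis ennreal_cases)
  then show ?thesis
    using powr_add_le_deriv[of s u v] assms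
    by (simp add: ennreal_plus[symmetric] ennreal_mult[symmetric] del: ennreal_plus)
qed

text \<open>Telescoping of the increments of the power, a discrete chain rule. The term of index
  \<open>n\<close> meets only the partial sum through \<open>n\<close>; for averages with decreasing
  radii this sum contains only radii at least as large as the \<open>n\<close>-th.\<close>

lemma enn_powr_sum_le:
  assumes "1 \<le> s"
  shows "enn_powr (\<Sum>n<N. a n) s \<le> ennreal s * (\<Sum>n<N. a n * enn_powr (\<Sum>m<Suc n. a m) (s - 1))"
proof (induction N)
  case (Suc N)
  have "enn_powr (\<Sum>n<Suc N. a n) s
    \<le> enn_powr (\<Sum>n<N. a n) s + ennreal s * a N * enn_powr (\<Sum>m<Suc N. a m) (s - 1)"
    using enn_powr_add_le_deriv[OF assms, of "\<Sum>n<N. a n" "a N"] by simp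
  also have "\<dots> \<le> ennreal s * (\<Sum>n<N. a n * enn_powr (\<Sum>m<Suc n. a m) (s - 1))
      + ennreal s * a N * enn_powr (\<Sum>m<Suc N. a m) (s - 1)"
    using Suc by (intro add_right_mono)
  also have "\<dots> = ennreal s * (\<Sum>n<Suc N. a n * enn_powr (\<Sum>m<Suc n. a m) (s - 1))"
    by (simp add: distrib_left mult.assoc)
  finally show ?case .
qed simp

text \<open>The weight \<open>(l^2)^j\<close> is split into two factors \<open>l^j\<close>: one
  bounds all terms by a common quantity, the other makes the series summable. This works for
  exponents on both sides of 1, at the price of the square root of the ratio.\<close>

lemma enn_powr_suminf_le:
  fixes x :: "nat \<Rightarrow> ennreal"
  assumes "0 < l" "l < 1" "0 < a"
  shows "enn_powr (\<Sum>j. ennreal ((l\<^sup>2) ^ j) * x j) a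
    \<le> ennreal ((1 / (1 - l)) powr a) * (\<Sum>j. ennreal ((l powr a) ^ j) * enn_powr (x j) a)"
proof -
  define Z where "Z = (\<Sum>j. ennreal ((l powr a) ^ j) * enn_powr (x j) a)"
  have "ennreal (l ^ j) * x j \<le> enn_powr Z (1 / a)" for j
  proof -
    have "ennreal ((l powr a) ^ j) * enn_powr (x j) a \<le> Z"
      unfolding Z_def by (rule order_trans[OF _ sum_le_suminf[of _ "{j}"]]) auto
    moreover have "(l powr a) ^ j = (l ^ j) powr a"
      using assms by (simp add: powr_powr powr_realpow[symmetric] mult.commute)
    then have "ennreal ((l powr a) ^ j) * enn_powr (x j) a = enn_powr (ennreal (l ^ j) * x j) a"
      using assms by (simp add: enn_powr_mult)
    ultimately have "enn_powr (enn_powr (ennreal (l ^ j) * x j) a) (1 / a) \<le> enn_powr Z (1 / a)"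
      using assms by (intro enn_powr_mono) auto
    then show ?thesis using assms by (simp add: enn_powr_powr)
  qed
  note * = this
  have "(\<Sum>j. ennreal ((l\<^sup>2) ^ j) * x j) \<le> (\<Sum>j. ennreal (l ^ j) * enn_powr Z (1 / a))"
  proof (intro suminf_le)
    fix j
    have "ennreal ((l\<^sup>2) ^ j) * x j = ennreal (l ^ j) * (ennreal (l ^ j) * x j)"
      using assms by (simp add: mult.assoc[symmetric] ennreal_mult[symmetric] power2_eq_square power_mult_distrib)
    also have "\<dots> \<le> ennreal (l ^ j) * enn_powr Z (1 / a)"
      by (intro mult_left_mono *) auto
    finally show "ennreal ((l\<^sup>2) ^ j) * x j \<le> ennreal (l ^ j) * enn_powr Z (1 / a)" .
  qed auto
  also have "\<dots> = (\<Sum>j. ennreal (l ^ j)) * enn_powr Z (1 / a)"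
    by (rule ennreal_suminf_multc)
  also have "(\<Sum>j. ennreal (l ^ j)) = ennreal (1 / (1 - l))"
    using assms by (subst suminf_ennreal_eq[OF _ geometric_sums]) auto
  finally have "enn_powr (\<Sum>j. ennreal ((l\<^sup>2) ^ j) * x j) a
      \<le> enn_powr (ennreal (1 / (1 - l)) * enn_powr Z (1 / a)) a"
    using assms by (intro enn_powr_mono) auto
  also have "\<dots> = ennreal ((1 / (1 - l)) powr a) * Z"
    using assms by (simp add: enn_powr_mult enn_powr_powr)
  finally show ?thesis by (simp add: Z_def)
qed

section \<open>Absorption, suprema, and a substitute for Hoelder's inequality\<close>

text \<open>Finiteness of \<open>x\<close> is essential: for \<open>x = top\<close> the inequality
  in the hypothesis holds whatever \<open>y\<close> is. Every use therefore needs an a priori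
  bound.\<close>

lemma ennreal_absorb:
  fixes x y :: ennreal
  assumes "x \<le> y + ennreal (1/2) * x" "x < top"
  shows "x \<le> 2 * y"
proof (cases y)
  case (real b)
  obtain a where a: "x = ennreal a" "0 \<le> a" using assms by (cases x) auto
  have "a \<le> b + 1/2 * a"
    using assms(1)[unfolded real(2) a(1)] real a
    by (simp add: ennreal_mult[symmetric] ennreal_plus[symmetric] del: ennreal_plus ennreal_half)
  then have "x \<le> ennreal (2 * b)" unfolding a(1) by (intro ennreal_leI) simp
  then show ?thesis using real by (simp add: ennreal_mult)
qed (auto simp: ennreal_mult_top)

lemma enn_powr_SUP:
  assumes "0 < a"
  shows "enn_powr (SUP i\<in>I. f i) a = (SUP i\<in>I. enn_powr (f i) a)"
proof (rule antisym)
  have "f i \<le> enn_powr (SUP i\<in>I. enn_powr (f i) a) (1 / a)" if "i \<in> I" for i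
  proof -
    have "f i = enn_powr (enn_powr (f i) a) (1 / a)"
      using assms by (simp add: enn_powr_powr)
    also have "\<dots> \<le> enn_powr (SUP i\<in>I. enn_powr (f i) a) (1 / a)"
      using assms that by (intro enn_powr_mono SUP_upper) auto
    finally show ?thesis .
  qed
  then have "enn_powr (SUP i\<in>I. f i) a \<le> enn_powr (enn_powr (SUP i\<in>I. enn_powr (f i) a) (1 / a)) a"
    using assms by (intro enn_powr_mono SUP_least) auto
  then show "enn_powr (SUP i\<in>I. f i) a \<le> (SUP i\<in>I. enn_powr (f i) a)"
    using assms by (simp add: enn_powr_powr)
  show "(SUP i\<in>I. enn_powr (f i) a) \<le> enn_powr (SUP i\<in>I. f i) a"
    using assms by (intro SUP_least enn_powr_mono SUP_upper) auto
qed

text \<open>If \<open>z > c * h\<close>, then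
  \<open>z = z^b / z^(b-1) <= z^b / (c * h)^(b-1)\<close>. The bound is linear in
  \<open>z^b / h^(b-1)\<close> and in \<open>h\<close>, so it can be averaged before
  \<open>c\<close> is chosen; together with \<open>enn_optimize\<close> it plays the role of
  Hoelder's inequality. The case \<open>h = 0\<close> is covered by
  \<open>inverse 0 = top\<close>.\<close>

lemma enn_split:
  assumes "1 < b" "0 < c"
  shows "z \<le> ennreal (c powr (1 - b)) * (enn_powr z b * inverse (enn_powr h (b - 1))) + ennreal c * h"
proof (cases "z \<le> ennreal c * h")
  case True then show ?thesis by (simp add: add_increasing)
next
  case False
  then have lt: "ennreal c * h < z" by simp
  show ?thesis
  proof (cases "h = 0 \<or> z = top")
    case True
    moreover have "z \<noteq> 0" "h < top"
      using lt assms by (auto simp: less_top[symmetric] ennreal_mult_top)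
    ultimately have "enn_powr z b * inverse (enn_powr h (b - 1)) = top"
      by (cases h) (auto simp: ennreal_mult_top ennreal_top_mult)
    then show ?thesis using assms by (simp add: ennreal_mult_top)
  next
    case F: False
    then obtain x y where xy: "z = ennreal x" "0 \<le> x" "h = ennreal y" "0 \<le> y" "y \<noteq> 0"
      using lt assms by (cases z; cases h) (auto simp: ennreal_mult_top)
    have "c * y < x" using lt xy assms by (simp add: ennreal_mult[symmetric] ennreal_less_iff)
    then have "(c * y) powr (b - 1) \<le> x powr (b - 1)"
      using assms xy by (intro powr_mono2) auto
    moreover have "0 < x" using \<open>c * y < x\<close> assms xy by (smt (verit) mult_nonneg_nonneg)
    then have "x powr b = x * x powr (b - 1)" using powr_add[of x 1 "b - 1"] by simp
    ultimately have "x * (c * y) powr (b - 1) \<le> x powr b"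
      using \<open>0 < x\<close> by simp
    then have "x \<le> c powr (1 - b) * (x powr b * inverse (y powr (b - 1)))"
      using assms xy by (simp add: powr_mult powr_diff field_simps)
    then have "z \<le> ennreal (c powr (1 - b)) * (enn_powr z b * inverse (enn_powr h (b - 1)))"
      using xy assms by (simp add: inverse_ennreal ennreal_mult[symmetric])
    then show ?thesis by (simp add: add_increasing2)
  qed
qed

text \<open>Optimizing a sum of two powers of \<open>c\<close> recovers the product; balancing the
  two terms loses only the factor \<open>2 powr b\<close>.\<close>

lemma enn_optimize:
  assumes "1 < b" "0 < y" "y < top"
    and le: "\<And>c::real. 0 < c \<Longrightarrow> z \<le> ennreal (c powr (1 - b)) * x + ennreal c * y"
  shows "enn_powr z b \<le> ennreal (2 powr b) * (x * enn_powr y (b - 1))"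
proof -
  obtain v where v: "y = ennreal v" "0 < v"
    using assms(2,3) by (cases y) auto
  show ?thesis
  proof (cases x)
    case (real u)
    show ?thesis
    proof (cases "u = 0")
      case True
      \<comment> \<open>With \<open>x = 0\<close> the first term vanishes, and \<open>c\<close> may
        tend to 0.\<close>
      have "z \<le> 0 + ennreal e" if "0 < e" for e
      proof -
        have "ennreal (e / v) * ennreal v = ennreal e"
          using v that by (subst ennreal_mult[symmetric]) auto
        moreover have "z \<le> ennreal ((e / v) powr (1 - b)) * x + ennreal (e / v) * y"
          using that v(2) by (intro le) auto
        ultimately show ?thesis
          by (simp only: real(2) True v(1) ennreal_0 mult_zero_right)
      qed
      then have "z \<le> 0" by (rule ennreal_le_epsilon) auto
      then show ?thesis using assms by simp
    next
      case False
      \<comment> \<open>This \<open>c\<close> makes the two terms equal, because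
        \<open>c powr b = u / v\<close>.\<close>
      define c where "c = (u / v) powr (1 / b)"
      have "0 < c" using False real v by (simp add: c_def)
      have cb: "c powr b = u / v" using assms real v by (simp add: c_def powr_powr)
      have "c powr (1 - b) * u = c * v"
        using \<open>0 < c\<close> v False by (simp add: powr_diff cb)
      then have "z \<le> ennreal (2 * (c * v))"
        using le[OF \<open>0 < c\<close>, unfolded real(2) v(1)] v(2) real(1) \<open>0 < c\<close> by (simp add: ennreal_mult[symmetric] ennreal_plus[symmetric] del: ennreal_plus)
      then have "enn_powr z b \<le> enn_powr (ennreal (2 * (c * v))) b"
        using assms by (intro enn_powr_mono) auto
      also have "\<dots> = ennreal ((2 * (c * v)) powr b)"
        using \<open>0 < c\<close> v by (intro enn_powr_ennreal) auto
      also have "(2 * (c * v)) powr b = 2 powr b * (u * v powr (b - 1))"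
        using \<open>0 < c\<close> v by (simp add: powr_mult cb powr_diff)
      also have "ennreal \<dots> = ennreal (2 powr b) * (x * enn_powr y (b - 1))"
        using real v by (simp add: ennreal_mult)
      finally show ?thesis .
    qed
  next
    case top
    then show ?thesis using v by (simp add: ennreal_top_mult ennreal_mult_top)
  qed
qed

section \<open>Averages over balls in spaces of linear growth\<close>

text \<open>For \<open>s < 1\<close> the value solves \<open>(b - 1) * s = 2 * (1 - s)\<close>. With
  it the maximal function in the Hoelder step enters exactly through its square, the exponent for
  which it is bounded by duality.\<close>

definition avg_exponent :: "real \<Rightarrow> real" where
  "avg_exponent s = (if 1 \<le> s then 1 else (2 - s) / s)"

lemma avg_exponent_ge_1: "0 < s \<Longrightarrow> 1 \<le> avg_exponent s"
  by (simp add: avg_exponent_def field_simps)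

text \<open>Arc length on the circle is the instance in view. Distinct points may have distance
  zero, as angles congruent modulo \<open>2 * pi\<close> do.\<close>

locale ball_growth = finite_measure M for M :: "'a measure" +
  fixes d :: "'a \<Rightarrow> 'a \<Rightarrow> real" and \<kappa> :: real
  assumes measurable_d [measurable]: "case_prod d \<in> borel_measurable (M \<Otimes>\<^sub>M M)"
    and d_sym: "d x y = d y x"
    and d_triangle: "d x z \<le> d x y + d y z"
    and growth: "\<And>x t. x \<in> space M \<Longrightarrow> 0 < t \<Longrightarrow> emeasure M {y \<in> space M. d x y \<le> t} \<le> ennreal (\<kappa> * t)"
    and kappa_pos: "0 < \<kappa>"
begin

text \<open>The average is normalized by the radius, not by the measure of the ball.\<close>
definition avg :: "real \<Rightarrow> ('a \<Rightarrow> ennreal) \<Rightarrow> 'a \<Rightarrow> ennreal" where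
  "avg t g x = ennreal (1 / t) * (\<integral>\<^sup>+ y. (if d x y \<le> t then g y else 0) \<partial>M)"

lemma emeasure_space_less_top: "emeasure M (space M) < top"
  by (simp add: less_top[symmetric])

lemma measurable_d2 [measurable (raw)]:
  assumes "f \<in> measurable N M" "g \<in> measurable N M"
  shows "(\<lambda>x. d (f x) (g x)) \<in> borel_measurable N"
  using measurable_compose[OF measurable_Pair[OF assms] measurable_d] by simp

lemma measurable_avg [measurable (raw)]:
  assumes [measurable]: "(\<lambda>(x, y). g x y) \<in> borel_measurable (N \<Otimes>\<^sub>M M)" "f \<in> measurable N M"
    "t \<in> borel_measurable N"
  shows "(\<lambda>x. avg (t x) (g x) (f x)) \<in> borel_measurable N"
  unfolding avg_def by measurable

lemma avg_mono: "(\<And>y. y \<in> space M \<Longrightarrow> d x y \<le> t \<Longrightarrow> g y \<le> h y) \<Longrightarrow> avg t g x \<le> avg t h x"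
  unfolding avg_def by (intro mult_left_mono nn_integral_mono) auto

lemma avg_add:
  assumes [measurable]: "g \<in> borel_measurable M" "h \<in> borel_measurable M" "x \<in> space M"
  shows "avg t (\<lambda>y. g y + h y) x = avg t g x + avg t h x"
proof -
  have "(\<integral>\<^sup>+ y. (if d x y \<le> t then g y + h y else 0) \<partial>M)
    = (\<integral>\<^sup>+ y. (if d x y \<le> t then g y else 0) + (if d x y \<le> t then h y else 0) \<partial>M)"
    by (intro nn_integral_cong) auto
  also have "\<dots> = (\<integral>\<^sup>+ y. (if d x y \<le> t then g y else 0) \<partial>M)
      + (\<integral>\<^sup>+ y. (if d x y \<le> t then h y else 0) \<partial>M)"
    by (intro nn_integral_add) measurable
  finally show ?thesis by (simp add: avg_def distrib_left)
qed

lemma avg_cmult: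
  assumes [measurable]: "g \<in> borel_measurable M" "x \<in> space M"
  shows "avg t (\<lambda>y. c * g y) x = c * avg t g x"
proof -
  have "(\<integral>\<^sup>+ y. (if d x y \<le> t then c * g y else 0) \<partial>M)
    = (\<integral>\<^sup>+ y. c * (if d x y \<le> t then g y else 0) \<partial>M)"
    by (intro nn_integral_cong) auto
  also have "\<dots> = c * (\<integral>\<^sup>+ y. (if d x y \<le> t then g y else 0) \<partial>M)"
    by (intro nn_integral_cmult) measurable
  finally show ?thesis by (simp add: avg_def mult.left_commute)
qed

lemma avg_const_le:
  assumes "x \<in> space M" "0 < t"
  shows "avg t (\<lambda>_. c) x \<le> ennreal \<kappa> * c"
proof -
  have [measurable]: "{y \<in> space M. d x y \<le> t} \<in> sets M"
    using assms(1) by measurable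
  have "(\<integral>\<^sup>+ y. (if d x y \<le> t then c else 0) \<partial>M)
      = (\<integral>\<^sup>+ y. c * indicator {y \<in> space M. d x y \<le> t} y \<partial>M)"
    by (intro nn_integral_cong) auto
  also have "\<dots> = c * emeasure M {y \<in> space M. d x y \<le> t}"
    by (intro nn_integral_cmult_indicator) measurable
  also have "\<dots> \<le> c * ennreal (\<kappa> * t)"
    using growth assms by (intro mult_left_mono) auto
  finally have "avg t (\<lambda>_. c) x \<le> ennreal (1 / t) * (c * ennreal (\<kappa> * t))"
    unfolding avg_def by (intro mult_left_mono) auto
  also have "\<dots> = ennreal (1 / t) * ennreal (\<kappa> * t) * c"
    by (simp add: mult_ac)
  also have "ennreal (1 / t) * ennreal (\<kappa> * t) = ennreal \<kappa>"
    using assms kappa_pos by (simp add: ennreal_mult[symmetric])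
  finally show ?thesis by simp
qed

lemma avg_le_integral: "avg t g x \<le> ennreal (1 / t) * (\<integral>\<^sup>+ y. g y \<partial>M)"
  unfolding avg_def by (intro mult_left_mono nn_integral_mono) auto

lemma avg_double:
  assumes "0 < r" "d x y \<le> r"
  shows "avg r g y \<le> 2 * avg (2 * r) g x"
proof -
  have "(\<integral>\<^sup>+ z. (if d y z \<le> r then g z else 0) \<partial>M) \<le> (\<integral>\<^sup>+ z. (if d x z \<le> 2 * r then g z else 0) \<partial>M)"
  proof (intro nn_integral_mono)
    fix z show "(if d y z \<le> r then g z else 0) \<le> (if d x z \<le> 2 * r then g z else 0)"
      using d_triangle[of x z y] assms(2) by auto
  qed
  then have "avg r g y \<le> ennreal (1 / r) * (\<integral>\<^sup>+ z. (if d x z \<le> 2 * r then g z else 0) \<partial>M)"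
    unfolding avg_def by (rule mult_left_mono) auto
  also have "ennreal (1 / r) = 2 * ennreal (1 / (2 * r))"
    using assms(1) ennreal_mult[of 2 "1 / (2 * r)"] by simp
  finally show ?thesis by (simp add: avg_def mult.assoc)
qed

text \<open>Normalizing by the radius makes the kernel symmetric; dividing by the measure of the
  ball around \<open>x\<close> would in general destroy this.\<close>

lemma avg_self_adjoint:
  assumes [measurable]: "g \<in> borel_measurable M" "h \<in> borel_measurable M"
  shows "(\<integral>\<^sup>+ x. h x * avg t g x \<partial>M) = (\<integral>\<^sup>+ x. g x * avg t h x \<partial>M)"
proof -
  interpret P: pair_sigma_finite M M ..
  have expand: "(\<integral>\<^sup>+ x. v x * avg t u x \<partial>M)
      = ennreal (1 / t) * (\<integral>\<^sup>+ x. (\<integral>\<^sup>+ y. (if d x y \<le> t then v x * u y else 0) \<partial>M) \<partial>M)"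
    if [measurable]: "u \<in> borel_measurable M" "v \<in> borel_measurable M" for u v
  proof -
    have "v x * (\<integral>\<^sup>+ y. (if d x y \<le> t then u y else 0) \<partial>M)
      = (\<integral>\<^sup>+ y. (if d x y \<le> t then v x * u y else 0) \<partial>M)" if [measurable]: "x \<in> space M" for x
      by (subst nn_integral_cmult[symmetric]) (auto intro!: nn_integral_cong)
    then have "(\<integral>\<^sup>+ x. v x * avg t u x \<partial>M)
        = (\<integral>\<^sup>+ x. ennreal (1 / t) * (\<integral>\<^sup>+ y. (if d x y \<le> t then v x * u y else 0) \<partial>M) \<partial>M)"
      unfolding avg_def by (intro nn_integral_cong) (simp only: mult.left_commute[of "v _" "ennreal (1 / t)"])
    also have "\<dots> = ennreal (1 / t) * (\<integral>\<^sup>+ x. (\<integral>\<^sup>+ y. (if d x y \<le> t then v x * u y else 0) \<partial>M) \<partial>M)"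
      by (intro nn_integral_cmult) measurable
    finally show ?thesis .
  qed
  have "(\<integral>\<^sup>+ x. (\<integral>\<^sup>+ y. (if d x y \<le> t then h x * g y else 0) \<partial>M) \<partial>M)
      = (\<integral>\<^sup>+ y. (\<integral>\<^sup>+ x. (if d x y \<le> t then h x * g y else 0) \<partial>M) \<partial>M)"
    by (intro P.Fubini'[symmetric]) measurable
  also have "\<dots> = (\<integral>\<^sup>+ y. (\<integral>\<^sup>+ x. (if d y x \<le> t then g y * h x else 0) \<partial>M) \<partial>M)"
    by (intro nn_integral_cong) (metis d_sym mult.commute)
  finally show ?thesis
    by (simp add: expand)
qed

section \<open>Bounds for sums and maxima of averages\<close>

text \<open>
  If \<open>F c\<close> is the left-hand side with all radii scaled by \<open>c\<close>, then self-adjointness and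
  doubling of the radii give \<open>F c \<le> A \<integral>H\<^sup>s + F (2 c) / 2\<close>. As \<open>F\<close> is bounded, this closes up
  without any maximal theorem.
\<close>
lemma sum_avg_powr_bound:
  assumes "1 \<le> s"
  obtains C where "0 \<le> C" "\<And>t g N. decseq t \<Longrightarrow> (\<And>n. 0 < t n) \<Longrightarrow> (\<And>n. g n \<in> borel_measurable M) \<Longrightarrow>
    (\<integral>\<^sup>+ x. enn_powr (\<Sum>n<N. avg (t n) (g n) x) s \<partial>M) \<le> ennreal C * (\<integral>\<^sup>+ x. enn_powr (\<Sum>n<N. g n x) s \<partial>M)"
proof -
  \<comment> \<open>\<open>s\<close> comes from the chain rule for the power,
    \<open>\<kappa>\<close> from averaging a constant, \<open>2 powr (s - 1)\<close> from doubling
    the radii. The choice of \<open>\<eta>\<close> gives \<open>F (2 * c)\<close> the factor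
    \<open>K * \<eta> = 1/2\<close>.\<close>
  define K where "K = s * \<kappa> * 2 powr (s - 1)"
  have "K > 0" using assms kappa_pos by (simp add: K_def)
  define \<eta> where "\<eta> = 1 / (2 * K)"
  have "\<eta> > 0" using \<open>K > 0\<close> by (simp add: \<eta>_def)
  define A where "A = K * \<eta> powr (1 - s)"
  have "A > 0" using \<open>K > 0\<close> \<open>\<eta> > 0\<close> by (simp add: A_def)
  show thesis
  proof (rule that)
    show "0 \<le> 2 * A" using \<open>A > 0\<close> by simp
    fix t :: "nat \<Rightarrow> real" and g :: "nat \<Rightarrow> 'a \<Rightarrow> ennreal" and N :: nat
    assume dec: "decseq t" and pos: "\<And>n. 0 < t n" and g[measurable]: "\<And>n. g n \<in> borel_measurable M"
    define H where "H x = (\<Sum>n<N. g n x)" for x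
    define G where "G c k x = (\<Sum>n<k. avg (c * t n) (g n) x)" for c k x
    define F where "F c = (\<integral>\<^sup>+ x. enn_powr (G c N x) s \<partial>M)" for c
    have [measurable]: "H \<in> borel_measurable M" "\<And>c k. G c k \<in> borel_measurable M"
      unfolding H_def G_def by measurable
    show "(\<integral>\<^sup>+ x. enn_powr (\<Sum>n<N. avg (t n) (g n) x) s \<partial>M)
      \<le> ennreal (2 * A) * (\<integral>\<^sup>+ x. enn_powr (\<Sum>n<N. g n x) s \<partial>M)"
    proof (cases "(\<integral>\<^sup>+ x. enn_powr (H x) s \<partial>M) = top")
      case True
      then show ?thesis using \<open>A > 0\<close> by (simp add: H_def ennreal_mult_top)
    next
      case False
      define I where "I = (\<integral>\<^sup>+ x. enn_powr (H x) s \<partial>M)"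
      have step: "F c \<le> ennreal A * I + ennreal (1/2) * F (2 * c)" if "0 < c" for c
      proof -
        have "F c \<le> (\<integral>\<^sup>+ x. ennreal s * (\<Sum>n<N. avg (c * t n) (g n) x * enn_powr (G c (Suc n) x) (s - 1)) \<partial>M)"
          unfolding F_def G_def using assms by (intro nn_integral_mono enn_powr_sum_le)
        also have "\<dots> = ennreal s * (\<Sum>n<N. \<integral>\<^sup>+ x. enn_powr (G c (Suc n) x) (s - 1) * avg (c * t n) (g n) x \<partial>M)"
          by (subst nn_integral_cmult, measurable, subst nn_integral_sum, measurable, simp add: mult.commute)
        also have "\<dots> = ennreal s * (\<Sum>n<N. \<integral>\<^sup>+ x. g n x * avg (c * t n) (\<lambda>y. enn_powr (G c (Suc n) y) (s - 1)) x \<partial>M)"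
          by (subst avg_self_adjoint) (auto intro!: measurable_enn_powr)
        also have "\<dots> \<le> ennreal s * (\<Sum>n<N. \<integral>\<^sup>+ x. g n x * (ennreal (\<kappa> * 2 powr (s - 1)) * enn_powr (G (2 * c) N x) (s - 1)) \<partial>M)"
        proof (intro mult_left_mono sum_mono nn_integral_mono)
          fix n x assume n: "n \<in> {..<N}" and x: "x \<in> space M"
          \<comment> \<open>Averages of index \<open>m <= n\<close> have radius at least
            \<open>c * t n\<close>, so the balls around \<open>y\<close> lie in balls of twice the
            radius around \<open>x\<close>.\<close>
          have G2: "G c (Suc n) y \<le> 2 * G (2 * c) N x" if y: "d x y \<le> c * t n" for y
          proof -
            have "G c (Suc n) y \<le> (\<Sum>m<Suc n. 2 * avg (2 * (c * t m)) (g m) x)"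
              unfolding G_def
            proof (intro sum_mono avg_double)
              fix m assume "m \<in> {..<Suc n}"
              then have "t n \<le> t m" using dec by (auto simp: decseq_def)
              then show "d x y \<le> c * t m" using y \<open>0 < c\<close>
                by (meson mult_left_mono order_trans less_imp_le)
            qed (use \<open>0 < c\<close> pos in auto)
            also have "\<dots> \<le> (\<Sum>m<N. 2 * avg (2 * (c * t m)) (g m) x)"
              using n by (intro sum_mono2) auto
            finally show ?thesis by (simp add: G_def sum_distrib_left mult.assoc)
          qed
          have "avg (c * t n) (\<lambda>y. enn_powr (G c (Suc n) y) (s - 1)) x
              \<le> avg (c * t n) (\<lambda>y. enn_powr (2 * G (2 * c) N x) (s - 1)) x"
            using assms by (intro avg_mono enn_powr_mono G2) auto
          also have "\<dots> \<le> ennreal \<kappa> * enn_powr (2 * G (2 * c) N x) (s - 1)"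
            using x \<open>0 < c\<close> pos by (intro avg_const_le) auto
          also have "\<dots> = ennreal (\<kappa> * 2 powr (s - 1)) * enn_powr (G (2 * c) N x) (s - 1)"
            using enn_powr_ennreal[of 2 "s - 1"] kappa_pos by (simp add: enn_powr_mult ennreal_mult mult.assoc)
          finally show "avg (c * t n) (\<lambda>y. enn_powr (G c (Suc n) y) (s - 1)) x
            \<le> ennreal (\<kappa> * 2 powr (s - 1)) * enn_powr (G (2 * c) N x) (s - 1)" .
        qed auto
        also have "\<dots> = ennreal s * (\<integral>\<^sup>+ x. (\<Sum>n<N. g n x * (ennreal (\<kappa> * 2 powr (s - 1)) * enn_powr (G (2 * c) N x) (s - 1))) \<partial>M)"
          by (subst nn_integral_sum) measurable
        also have "\<dots> = ennreal s * (\<integral>\<^sup>+ x. ennreal (\<kappa> * 2 powr (s - 1)) * (H x * enn_powr (G (2 * c) N x) (s - 1)) \<partial>M)"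
          by (simp add: H_def sum_distrib_right[symmetric] mult.left_commute)
        also have "\<dots> = ennreal s * ennreal (\<kappa> * 2 powr (s - 1)) * (\<integral>\<^sup>+ x. H x * enn_powr (G (2 * c) N x) (s - 1) \<partial>M)"
          by (subst nn_integral_cmult) (measurable, simp add: mult.assoc)
        also have "ennreal s * ennreal (\<kappa> * 2 powr (s - 1)) = ennreal K"
          using assms kappa_pos by (simp add: K_def ennreal_mult[symmetric] mult.assoc)
        also have "(\<integral>\<^sup>+ x. H x * enn_powr (G (2 * c) N x) (s - 1) \<partial>M)
            \<le> (\<integral>\<^sup>+ x. ennreal (\<eta> powr (1 - s)) * enn_powr (H x) s + ennreal \<eta> * enn_powr (G (2 * c) N x) s \<partial>M)"
          using assms \<open>\<eta> > 0\<close> by (intro nn_integral_mono enn_young)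
        also have "\<dots> = ennreal (\<eta> powr (1 - s)) * I + ennreal \<eta> * F (2 * c)"
          unfolding I_def F_def
          by (subst nn_integral_add, measurable, (subst nn_integral_cmult, measurable)+)
        also have "ennreal K * \<dots> = ennreal A * I + ennreal (1/2) * F (2 * c)"
        proof -
          have "K * \<eta> = 1/2" using \<open>K > 0\<close> by (simp add: \<eta>_def)
          from this[THEN arg_cong[where f=ennreal]] show ?thesis
            using \<open>K > 0\<close> \<open>\<eta> > 0\<close>
            by (simp only: A_def less_imp_le powr_ge_zero distrib_left mult.assoc[symmetric] ennreal_mult[symmetric])
        qed
        finally show ?thesis by (simp add: mult_left_mono)
      qed
      \<comment> \<open>The range \<open>c >= 1\<close> is stable under doubling, so the estimate
        closes up at the level of the supremum once that is known to be finite.\<close>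
      define \<Phi> where "\<Phi> = (SUP c\<in>{1..}. F c)"
      have "\<Phi> < top"
      proof -
        have "(\<integral>\<^sup>+ x. H x \<partial>M) \<le> (\<integral>\<^sup>+ x. 1 + enn_powr (H x) s \<partial>M)"
        proof (intro nn_integral_mono)
          fix x show "H x \<le> 1 + enn_powr (H x) s"
          proof (cases "H x \<le> 1")
            case False
            then have "H x = enn_powr (H x) 1" by simp
            also have "\<dots> = H x * enn_powr (H x) 0" using enn_powr_add[of "H x" 1 0] by simp
            also have "\<dots> \<le> enn_powr 1 (1 - s) * enn_powr (H x) s + 0"
            proof -
              have "enn_powr (H x) 0 \<le> enn_powr (H x) (s - 1)"
                using False assms
                by (cases "H x") (auto simp: ennreal_le_1 ge_one_powr_ge_zero intro: order_trans)
              then have "H x * enn_powr (H x) 0 \<le> H x * enn_powr (H x) (s - 1)"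
                by (rule mult_left_mono) auto
              then show ?thesis using enn_powr_add[of "H x" 1 "s - 1"] by simp
            qed
            finally show ?thesis by (simp add: add_increasing)
          qed (simp add: add_increasing2)
        qed
        also have "\<dots> = emeasure M (space M) + I"
          unfolding I_def by (subst nn_integral_add) auto
        also have "\<dots> < top"
          using False emeasure_space_less_top by (simp add: I_def less_top)
        finally have Hfin: "(\<integral>\<^sup>+ x. H x \<partial>M) < top" .
        \<comment> \<open>Radii at least \<open>t N\<close> bound all averages by one multiple of
          the total integral, uniformly in \<open>c\<close>. The total integral is finite because
          \<open>H <= 1 + H^s\<close> on a space of finite measure.\<close>
        have "F c \<le> enn_powr (ennreal (1 / t N) * (\<integral>\<^sup>+ x. H x \<partial>M)) s * emeasure M (space M)" if "1 \<le> c" for c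
        proof -
          have "G c N x \<le> ennreal (1 / t N) * (\<integral>\<^sup>+ x. H x \<partial>M)" for x
          proof -
            have "G c N x \<le> (\<Sum>n<N. ennreal (1 / t N) * (\<integral>\<^sup>+ x. g n x \<partial>M))"
              unfolding G_def
            proof (intro sum_mono order_trans[OF avg_le_integral] mult_right_mono ennreal_leI)
              fix n assume "n \<in> {..<N}"
              then have "t N \<le> t n" using dec by (auto simp: decseq_def)
              then have "t N \<le> c * t n" using mult_right_mono[of 1 c "t n"] \<open>1 \<le> c\<close> pos[of n] by linarith
              then show "1 / (c * t n) \<le> 1 / t N"
                using pos[of N] pos[of n] \<open>1 \<le> c\<close> by (intro divide_left_mono mult_pos_pos) auto
            qed auto
            also have "\<dots> = ennreal (1 / t N) * (\<integral>\<^sup>+ x. H x \<partial>M)"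
              unfolding H_def by (subst nn_integral_sum) (measurable, simp add: sum_distrib_left)
            finally show ?thesis .
          qed
          then have "F c \<le> (\<integral>\<^sup>+ x. enn_powr (ennreal (1 / t N) * (\<integral>\<^sup>+ x. H x \<partial>M)) s \<partial>M)"
            unfolding F_def using assms by (intro nn_integral_mono enn_powr_mono) auto
          then show ?thesis by simp
        qed
        then have "\<Phi> \<le> enn_powr (ennreal (1 / t N) * (\<integral>\<^sup>+ x. H x \<partial>M)) s * emeasure M (space M)"
          unfolding \<Phi>_def by (intro SUP_least) auto
        also have "\<dots> < top"
          using Hfin emeasure_space_less_top by (simp add: ennreal_mult_less_top less_top)
        finally show ?thesis .
      qed
      moreover have "\<Phi> \<le> ennreal A * I + ennreal (1/2) * \<Phi>"
        unfolding \<Phi>_def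
      proof (rule SUP_least)
        fix c :: real assume c: "c \<in> {1..}"
        have "F c \<le> ennreal A * I + ennreal (1/2) * F (2 * c)" using c by (intro step) auto
        also have "\<dots> \<le> ennreal A * I + ennreal (1/2) * (SUP c\<in>{1..}. F c)"
          using c by (intro add_left_mono mult_left_mono SUP_upper) auto
        finally show "F c \<le> ennreal A * I + ennreal (1/2) * (SUP c\<in>{1..}. F c)" .
      qed
      ultimately have "\<Phi> \<le> 2 * (ennreal A * I)" by (intro ennreal_absorb)
      moreover have "F 1 \<le> \<Phi>" unfolding \<Phi>_def by (intro SUP_upper) auto
      ultimately have "F 1 \<le> 2 * (ennreal A * I)" by (rule order_trans[rotated])
      then show ?thesis
        using \<open>A > 0\<close> by (simp add: F_def G_def I_def H_def ennreal_mult mult.assoc)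
    qed
  qed
qed


text \<open>Dual to the case \<open>s = 2\<close> of the vector inequality. The maximum is
  linearized by a measurable choice \<open>k x\<close> of an attaining index. Moving the averages to
  the other factor turns the integral of \<open>Y^2\<close> into \<open>h\<close> tested against
  averages of the pieces \<open>g n\<close>, and these pieces add up to \<open>Y\<close>.\<close>

lemma max_avg_square_bound:
  obtains C where "0 < C" "\<And>t h N. decseq t \<Longrightarrow> (\<And>n. 0 < t n) \<Longrightarrow> h \<in> borel_measurable M \<Longrightarrow>
    \<exists>Y \<in> borel_measurable M. (\<forall>n<N. \<forall>x\<in>space M. avg (t n) h x \<le> Y x) \<and>
      (\<integral>\<^sup>+ x. enn_powr (Y x) 2 \<partial>M) \<le> ennreal C * (\<integral>\<^sup>+ x. enn_powr (h x) 2 \<partial>M)"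
proof -
  obtain K where K: "0 \<le> K" "\<And>t g N. decseq t \<Longrightarrow> (\<And>n. 0 < t n) \<Longrightarrow> (\<And>n. g n \<in> borel_measurable M) \<Longrightarrow>
    (\<integral>\<^sup>+ x. enn_powr (\<Sum>n<N. avg (t n) (g n) x) 2 \<partial>M) \<le> ennreal K * (\<integral>\<^sup>+ x. enn_powr (\<Sum>n<N. g n x) 2 \<partial>M)"
    by (rule sum_avg_powr_bound[of 2]) auto
  \<comment> \<open>\<open>K + 1\<close> keeps the denominator positive when \<open>K = 0\<close>
    and still gives \<open>\<eta> * K <= 1/2\<close>.\<close>
  define \<eta> where "\<eta> = 1 / (2 * (K + 1))"
  have "\<eta> > 0" using K(1) by (simp add: \<eta>_def)
  show thesis
  proof (rule that)
    show "0 < 2 * (1 / \<eta>)" using \<open>\<eta> > 0\<close> by simp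
    fix t :: "nat \<Rightarrow> real" and h :: "'a \<Rightarrow> ennreal" and N :: nat
    assume dec: "decseq t" and pos: "\<And>n. 0 < t n" and h[measurable]: "h \<in> borel_measurable M"
    define I where "I = (\<integral>\<^sup>+ x. enn_powr (h x) 2 \<partial>M)"
    consider "N = 0" | "I = top" | "0 < N" "I < top"
      using less_top[of I] neq0_conv[of N] by blast
    then show "\<exists>Y \<in> borel_measurable M. (\<forall>n<N. \<forall>x\<in>space M. avg (t n) h x \<le> Y x) \<and>
      (\<integral>\<^sup>+ x. enn_powr (Y x) 2 \<partial>M) \<le> ennreal (2 * (1 / \<eta>)) * (\<integral>\<^sup>+ x. enn_powr (h x) 2 \<partial>M)"
    proof cases
      case 1
      then show ?thesis by (intro bexI[of _ "\<lambda>_. 0"]) auto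
    next
      case 2
      then show ?thesis using \<open>\<eta> > 0\<close>
        by (intro bexI[of _ "\<lambda>_. top"]) (auto simp: I_def ennreal_mult_top)
    next
      case 3
      define Y where "Y x = Max ((\<lambda>n. avg (t n) h x) ` {..<N})" for x
      \<comment> \<open>Taking the least attaining index makes the choice measurable in
        \<open>x\<close>.\<close>
      define k where "k x = (LEAST n. n < N \<and> avg (t n) h x = Y x)" for x
      have [measurable]: "Y \<in> borel_measurable M"
        unfolding Y_def by (intro borel_measurable_Max) auto
      have [measurable]: "k \<in> measurable M (count_space UNIV)"
        unfolding k_def by measurable
      have k: "k x < N" "avg (t (k x)) h x = Y x" for x
      proof -
        have "Y x \<in> (\<lambda>n. avg (t n) h x) ` {..<N}"
          unfolding Y_def using \<open>0 < N\<close> by (intro Max_in) auto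
        then have "\<exists>n. n < N \<and> avg (t n) h x = Y x" by auto
        from LeastI_ex[OF this] show "k x < N" "avg (t (k x)) h x = Y x" by (auto simp: k_def)
      qed
      define g where "g n x = (if n = k x then Y x else 0)" for n x
      have [measurable]: "g n \<in> borel_measurable M" for n unfolding g_def by measurable
      have sum_g: "(\<Sum>n<N. g n x) = Y x" for x using k(1) by (simp add: g_def)
      define J where "J = (\<integral>\<^sup>+ x. enn_powr (Y x) 2 \<partial>M)"
      have "J = (\<integral>\<^sup>+ x. (\<Sum>n<N. g n x * avg (t n) h x) \<partial>M)"
        unfolding J_def
      proof (intro nn_integral_cong)
        fix x
        have "(\<Sum>n<N. g n x * avg (t n) h x) = (\<Sum>n<N. if n = k x then Y x * Y x else 0)"
          using k(2) by (intro sum.cong) (auto simp: g_def)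
        then show "enn_powr (Y x) 2 = (\<Sum>n<N. g n x * avg (t n) h x)"
          using k(1)[of x] enn_powr_add[of "Y x" 1 1] by simp
      qed
      also have "\<dots> = (\<Sum>n<N. \<integral>\<^sup>+ x. h x * avg (t n) (g n) x \<partial>M)"
        by (subst nn_integral_sum, measurable, subst avg_self_adjoint) auto
      also have "\<dots> = (\<integral>\<^sup>+ x. h x * (\<Sum>n<N. avg (t n) (g n) x) \<partial>M)"
        by (subst nn_integral_sum[symmetric]) (auto simp: sum_distrib_left)
      also have "\<dots> \<le> (\<integral>\<^sup>+ x. ennreal (1 / \<eta>) * enn_powr (h x) 2 + ennreal \<eta> * enn_powr (\<Sum>n<N. avg (t n) (g n) x) 2 \<partial>M)"
        using enn_young[of 2 \<eta>] \<open>\<eta> > 0\<close> by (intro nn_integral_mono) (auto simp: powr_minus_divide)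
      also have "\<dots> = ennreal (1 / \<eta>) * I + ennreal \<eta> * (\<integral>\<^sup>+ x. enn_powr (\<Sum>n<N. avg (t n) (g n) x) 2 \<partial>M)"
        unfolding I_def by (subst nn_integral_add, measurable, (subst nn_integral_cmult, measurable)+)
      also have "\<dots> \<le> ennreal (1 / \<eta>) * I + ennreal \<eta> * (ennreal K * J)"
        using K(2)[OF dec pos, of g N] by (intro add_left_mono mult_left_mono) (auto simp: J_def sum_g)
      also have "\<dots> \<le> ennreal (1 / \<eta>) * I + ennreal (1/2) * J"
      proof -
        have "\<eta> * K \<le> 1/2" using K(1) by (simp add: \<eta>_def field_simps)
        then have "ennreal (\<eta> * K) \<le> ennreal (1/2)" by (intro ennreal_leI)
        then show ?thesis
          using K(1) \<open>\<eta> > 0\<close> by (intro add_left_mono)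
            (simp add: mult.assoc[symmetric] ennreal_mult[symmetric] mult_right_mono del: ennreal_half)
      qed
      finally have "J \<le> ennreal (1 / \<eta>) * I + ennreal (1/2) * J" .
      moreover have "J < top"
      proof -
        have "(\<integral>\<^sup>+ x. h x \<partial>M) \<le> (\<integral>\<^sup>+ x. 1 + enn_powr (h x) 2 \<partial>M)"
          using enn_powr_mult_le_add[of "1/2" 1 "enn_powr (h x) 2" for x]
          by (intro nn_integral_mono) (auto simp: enn_powr_powr)
        also have "\<dots> = emeasure M (space M) + I"
          unfolding I_def by (subst nn_integral_add) auto
        also have "\<dots> < top"
          using 3 emeasure_space_less_top by (simp add: less_top)
        finally have hfin: "(\<integral>\<^sup>+ x. h x \<partial>M) < top" .
        have "Y x \<le> ennreal (1 / t N) * (\<integral>\<^sup>+ x. h x \<partial>M)" for x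
        proof -
          have "t N \<le> t (k x)" using dec k(1)[of x] by (auto simp: decseq_def)
          then have "ennreal (1 / t (k x)) \<le> ennreal (1 / t N)"
            using pos[of N] by (intro ennreal_leI divide_left_mono) (auto intro: order_less_le_trans)
          then show ?thesis
            using avg_le_integral[of "t (k x)" h x] k(2)[of x] mult_right_mono[of _ _ "\<integral>\<^sup>+ x. h x \<partial>M"]
            by (metis order_trans zero_le)
        qed
        then have "J \<le> (\<integral>\<^sup>+ x. enn_powr (ennreal (1 / t N) * (\<integral>\<^sup>+ x. h x \<partial>M)) 2 \<partial>M)"
          unfolding J_def by (intro nn_integral_mono enn_powr_mono) auto
        also have "\<dots> < top"
          using hfin emeasure_space_less_top by (simp add: ennreal_mult_less_top less_top)
        finally show ?thesis .
      qed
      ultimately have "J \<le> 2 * (ennreal (1 / \<eta>) * I)" by (rule ennreal_absorb)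
      then have "J \<le> ennreal (2 * (1 / \<eta>)) * I"
        using \<open>\<eta> > 0\<close> by (subst ennreal_mult) (auto simp: mult.assoc)
      then show ?thesis
        unfolding J_def I_def by (intro bexI[of _ Y]) (auto simp: Y_def)
    qed
  qed
qed

lemma avg_integral:
  assumes "sigma_finite_measure R"
    and [measurable]: "(\<lambda>(r, y). k r y) \<in> borel_measurable (R \<Otimes>\<^sub>M M)" "x \<in> space M"
  shows "avg t (\<lambda>y. \<integral>\<^sup>+ r. k r y \<partial>R) x = (\<integral>\<^sup>+ r. avg t (k r) x \<partial>R)"
proof -
  interpret R: sigma_finite_measure R by fact
  interpret P: pair_sigma_finite R M ..
  have [measurable]: "(\<lambda>(y, r). k r y) \<in> borel_measurable (M \<Otimes>\<^sub>M R)"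
    by (simp add: measurable_split_conv) measurable
  have "(\<integral>\<^sup>+ y. (if d x y \<le> t then \<integral>\<^sup>+ r. k r y \<partial>R else 0) \<partial>M)
    = (\<integral>\<^sup>+ y. (\<integral>\<^sup>+ r. (if d x y \<le> t then k r y else 0) \<partial>R) \<partial>M)"
    by (intro nn_integral_cong) auto
  also have "\<dots> = (\<integral>\<^sup>+ r. (\<integral>\<^sup>+ y. (if d x y \<le> t then k r y else 0) \<partial>M) \<partial>R)"
    by (intro P.Fubini') measurable
  finally show ?thesis
    unfolding avg_def by (subst nn_integral_cmult) auto
qed

text \<open>
  For \<open>s < 1\<close> write \<open>V = H powr (1 - s)\<close>, so that \<open>V powr (1 / (b - 1)) = H powr (s / 2)\<close>
  for the exponent \<open>b = (2 - s) / s\<close>. Hoelder's inequality then bounds \<open>(avg t g)\<^sup>b\<close> by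
  \<open>avg t (g\<^sup>b / V)\<close>, which has integral at most \<open>\<kappa> \<integral>H\<^sup>s\<close> after summation, times a power of the
  maximal function of \<open>H powr (s / 2)\<close>, which is bounded on \<open>L\<^sup>2\<close>.
\<close>
lemma vector_avg_powr_bound:
  fixes R :: "'b measure"
  assumes "0 < s" and R: "sigma_finite_measure R"
  obtains C where "0 \<le> C" "\<And>t w g N. decseq t \<Longrightarrow> (\<And>n. 0 < t n) \<Longrightarrow>
    (\<And>n. w n \<in> borel_measurable R) \<Longrightarrow> (\<lambda>(r, y). g r y) \<in> borel_measurable (R \<Otimes>\<^sub>M M) \<Longrightarrow>
    (\<integral>\<^sup>+ x. enn_powr (\<Sum>n<N. \<integral>\<^sup>+ r. enn_powr (avg (t n) (g r) x) (avg_exponent s) * w n r \<partial>R) s \<partial>M)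
      \<le> ennreal C * (\<integral>\<^sup>+ x. enn_powr (\<Sum>n<N. \<integral>\<^sup>+ r. enn_powr (g r x) (avg_exponent s) * w n r \<partial>R) s \<partial>M)"
proof (cases "1 \<le> s")
  case True
  then obtain C where C: "0 \<le> C" "\<And>t g N. decseq t \<Longrightarrow> (\<And>n. 0 < t n) \<Longrightarrow> (\<And>n. g n \<in> borel_measurable M) \<Longrightarrow>
    (\<integral>\<^sup>+ x. enn_powr (\<Sum>n<N. avg (t n) (g n) x) s \<partial>M) \<le> ennreal C * (\<integral>\<^sup>+ x. enn_powr (\<Sum>n<N. g n x) s \<partial>M)"
    using sum_avg_powr_bound[OF True] by blast
  interpret R: sigma_finite_measure R by fact
  show thesis
  proof (rule that[OF C(1)])
    fix t :: "nat \<Rightarrow> real" and w :: "nat \<Rightarrow> 'b \<Rightarrow> ennreal" and g :: "'b \<Rightarrow> 'a \<Rightarrow> ennreal" and N :: nat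
    assume dec: "decseq t" and pos: "\<And>n. 0 < t n" and [measurable]: "\<And>n. w n \<in> borel_measurable R"
      and g[measurable]: "(\<lambda>(r, y). g r y) \<in> borel_measurable (R \<Otimes>\<^sub>M M)"
    have [measurable]: "(\<lambda>(y, r). g r y) \<in> borel_measurable (M \<Otimes>\<^sub>M R)"
      by (simp add: measurable_split_conv) measurable
    \<comment> \<open>Here the exponent is 1, so averaging commutes with the integral over
      \<open>r\<close> and the scalar inequality applies to the integrated functions.\<close>
    have "(\<integral>\<^sup>+ r. avg (t n) (g r) x * w n r \<partial>R) = avg (t n) (\<lambda>y. \<integral>\<^sup>+ r. g r y * w n r \<partial>R) x"
      if [measurable]: "x \<in> space M" for n x
    proof (subst avg_integral[OF R])
      show "(\<integral>\<^sup>+ r. avg (t n) (g r) x * w n r \<partial>R) = (\<integral>\<^sup>+ r. avg (t n) (\<lambda>y. g r y * w n r) x \<partial>R)"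
        by (intro nn_integral_cong) (subst (2) mult.commute, subst avg_cmult, auto simp: mult.commute that)
    qed measurable
    then have "(\<integral>\<^sup>+ x. enn_powr (\<Sum>n<N. \<integral>\<^sup>+ r. avg (t n) (g r) x * w n r \<partial>R) s \<partial>M)
        = (\<integral>\<^sup>+ x. enn_powr (\<Sum>n<N. avg (t n) (\<lambda>y. \<integral>\<^sup>+ r. g r y * w n r \<partial>R) x) s \<partial>M)"
      by (intro nn_integral_cong) simp
    also have "\<dots> \<le> ennreal C * (\<integral>\<^sup>+ x. enn_powr (\<Sum>n<N. \<integral>\<^sup>+ r. g r x * w n r \<partial>R) s \<partial>M)"
      by (intro C(2) dec pos) measurable
    finally show "(\<integral>\<^sup>+ x. enn_powr (\<Sum>n<N. \<integral>\<^sup>+ r. enn_powr (avg (t n) (g r) x) (avg_exponent s) * w n r \<partial>R) s \<partial>M)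
      \<le> ennreal C * (\<integral>\<^sup>+ x. enn_powr (\<Sum>n<N. \<integral>\<^sup>+ r. enn_powr (g r x) (avg_exponent s) * w n r \<partial>R) s \<partial>M)"
      using True by (simp add: avg_exponent_def)
  qed
next
  case False
  interpret R: sigma_finite_measure R by fact
  interpret P: pair_sigma_finite R M ..
  obtain K where K: "0 < K" "\<And>t h N. decseq t \<Longrightarrow> (\<And>n. 0 < t n) \<Longrightarrow> h \<in> borel_measurable M \<Longrightarrow>
    \<exists>Y \<in> borel_measurable M. (\<forall>n<N. \<forall>x\<in>space M. avg (t n) h x \<le> Y x) \<and>
      (\<integral>\<^sup>+ x. enn_powr (Y x) 2 \<partial>M) \<le> ennreal K * (\<integral>\<^sup>+ x. enn_powr (h x) 2 \<partial>M)"
    using max_avg_square_bound by blast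
  define b where "b = avg_exponent s"
  have b: "b = (2 - s) / s" "1 < b" using False \<open>0 < s\<close> by (auto simp: b_def avg_exponent_def field_simps)
  have bs: "(b - 1) * s = 2 * (1 - s)" "s / 2 * (b - 1) = 1 - s"
    using \<open>0 < s\<close> by (simp_all add: b field_simps)
  define L where "L = (2 powr b) powr s"
  have "L > 0" by (simp add: L_def)
  show thesis
  proof (rule that)
    show "0 \<le> L * (\<kappa> + 4 * K)" using \<open>L > 0\<close> K(1) kappa_pos by simp
    fix t :: "nat \<Rightarrow> real" and w :: "nat \<Rightarrow> 'b \<Rightarrow> ennreal" and g :: "'b \<Rightarrow> 'a \<Rightarrow> ennreal" and N :: nat
    assume dec: "decseq t" and pos: "\<And>n. 0 < t n" and w[measurable]: "\<And>n. w n \<in> borel_measurable R"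
      and g[measurable]: "(\<lambda>(r, y). g r y) \<in> borel_measurable (R \<Otimes>\<^sub>M M)"
    have g'[measurable]: "(\<lambda>(y, r). g r y) \<in> borel_measurable (M \<Otimes>\<^sub>M R)"
      by (simp add: measurable_split_conv) measurable
    define H where "H x = (\<Sum>n<N. \<integral>\<^sup>+ r. enn_powr (g r x) b * w n r \<partial>R)" for x
    have [measurable]: "H \<in> borel_measurable M" unfolding H_def by measurable
    define I where "I = (\<integral>\<^sup>+ x. enn_powr (H x) s \<partial>M)"
    define W where "W x = (\<Sum>n<N. \<integral>\<^sup>+ r. enn_powr (avg (t n) (g r) x) b * w n r \<partial>R)" for x
    have "(\<integral>\<^sup>+ x. enn_powr (W x) s \<partial>M) \<le> ennreal (L * (\<kappa> + 4 * K)) * I"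
    proof (cases "I = top")
      case True
      then show ?thesis using \<open>L > 0\<close> K(1) kappa_pos
        by (subst True) (simp add: ennreal_mult_top add_pos_pos)
    next
      case False
      define h where "h x = enn_powr (H x) (s / 2)" for x
      have [measurable]: "h \<in> borel_measurable M" unfolding h_def by measurable
      have h2: "(\<integral>\<^sup>+ x. enn_powr (h x) 2 \<partial>M) = I" by (simp add: h_def I_def enn_powr_powr)
      obtain Y where Y[measurable]: "Y \<in> borel_measurable M" "\<And>n x. n < N \<Longrightarrow> x \<in> space M \<Longrightarrow> avg (t n) h x \<le> Y x"
        "(\<integral>\<^sup>+ x. enn_powr (Y x) 2 \<partial>M) \<le> ennreal K * I"
        using K(2)[OF dec pos, of h N] unfolding h2 by auto
      have Yfin: "AE x in M. Y x < top"
      proof -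
        have "(\<integral>\<^sup>+ x. enn_powr (Y x) 2 \<partial>M) \<noteq> \<infinity>"
          using Y(3) False by (metis ennreal_mult_eq_top_iff ennreal_neq_top infinity_ennreal_def neq_top_trans)
        then have "AE x in M. enn_powr (Y x) 2 \<noteq> \<infinity>"
          by (intro nn_integral_PInf_AE) measurable
        then show ?thesis by eventually_elim (simp add: less_top)
      qed
      \<comment> \<open>This is \<open>g^b / h^(b-1)\<close> for \<open>h = H powr (s / 2)\<close>,
        the first summand in \<open>enn_split\<close>.\<close>
      define u where "u r y = enn_powr (g r y) b * inverse (enn_powr (H y) (1 - s))" for r y
      have u[measurable]: "(\<lambda>(r, y). u r y) \<in> borel_measurable (R \<Otimes>\<^sub>M M)" unfolding u_def by measurable
      have u'[measurable]: "(\<lambda>(y, r). u r y) \<in> borel_measurable (M \<Otimes>\<^sub>M R)" unfolding u_def by measurable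
      define X where "X x = (\<Sum>n<N. \<integral>\<^sup>+ r. avg (t n) (u r) x * w n r \<partial>R)" for x
      have [measurable]: "X \<in> borel_measurable M" unfolding X_def by measurable
      have X_int: "(\<integral>\<^sup>+ x. X x \<partial>M) \<le> ennreal \<kappa> * I"
      proof -
        have Xn: "(\<integral>\<^sup>+ r. avg (t n) (u r) x * w n r \<partial>R) = avg (t n) (\<lambda>y. \<integral>\<^sup>+ r. u r y * w n r \<partial>R) x"
          if [measurable]: "x \<in> space M" for n x
        proof (subst avg_integral[OF R])
          show "(\<integral>\<^sup>+ r. avg (t n) (u r) x * w n r \<partial>R) = (\<integral>\<^sup>+ r. avg (t n) (\<lambda>y. u r y * w n r) x \<partial>R)"
            by (intro nn_integral_cong) (subst (2) mult.commute, subst avg_cmult, auto simp: mult.commute that)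
        qed measurable
        \<comment> \<open>Self-adjointness against the constant 1 removes the averages.\<close>
        have "(\<integral>\<^sup>+ x. X x \<partial>M) = (\<integral>\<^sup>+ x. (\<Sum>n<N. 1 * avg (t n) (\<lambda>y. \<integral>\<^sup>+ r. u r y * w n r \<partial>R) x) \<partial>M)"
          unfolding X_def by (intro nn_integral_cong) (simp add: Xn)
        also have "\<dots> = (\<Sum>n<N. \<integral>\<^sup>+ x. (\<integral>\<^sup>+ r. u r x * w n r \<partial>R) * avg (t n) (\<lambda>_. 1) x \<partial>M)"
          by (subst nn_integral_sum, measurable, subst avg_self_adjoint) auto
        also have "\<dots> \<le> (\<Sum>n<N. \<integral>\<^sup>+ x. (\<integral>\<^sup>+ r. u r x * w n r \<partial>R) * ennreal \<kappa> \<partial>M)"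
          using avg_const_le[of _ "t _" 1] pos by (intro sum_mono nn_integral_mono mult_left_mono) auto
        also have "\<dots> = (\<integral>\<^sup>+ x. (\<Sum>n<N. \<integral>\<^sup>+ r. u r x * w n r \<partial>R) * ennreal \<kappa> \<partial>M)"
          by (subst nn_integral_sum[symmetric]) (auto simp: sum_distrib_right)
        also have "\<dots> = ennreal \<kappa> * (\<integral>\<^sup>+ x. (\<Sum>n<N. \<integral>\<^sup>+ r. u r x * w n r \<partial>R) \<partial>M)"
          by (subst nn_integral_multc) (auto simp: mult.commute)
        also have "\<dots> \<le> ennreal \<kappa> * I"
          unfolding I_def
        proof (intro mult_left_mono nn_integral_mono)
          fix x assume [measurable]: "x \<in> space M"
          have "(\<Sum>n<N. \<integral>\<^sup>+ r. u r x * w n r \<partial>R)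
              = (\<Sum>n<N. \<integral>\<^sup>+ r. (enn_powr (g r x) b * w n r) * inverse (enn_powr (H x) (1 - s)) \<partial>R)"
            unfolding u_def by (simp add: mult_ac)
          also have "\<dots> = H x * inverse (enn_powr (H x) (1 - s))"
            unfolding H_def by (subst nn_integral_multc) (auto simp: sum_distrib_right)
          \<comment> \<open>Only an inequality: for \<open>H x = top\<close> the inverse is 0 and
            the left side vanishes.\<close>
          also have "\<dots> \<le> enn_powr (H x) s"
            by (cases "H x"; cases "H x = 0")
              (auto simp: inverse_ennreal ennreal_mult[symmetric] powr_diff)
          finally show "(\<Sum>n<N. \<integral>\<^sup>+ r. u r x * w n r \<partial>R) \<le> enn_powr (H x) s" .
        qed auto
        finally show ?thesis .
      qed
      \<comment> \<open>\<open>\<epsilon>\<close> keeps the majorant of the averages of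
        \<open>h\<close> positive, as \<open>enn_optimize\<close> demands. It is removed at the end,
        the total measure being finite.\<close>
      have main: "(\<integral>\<^sup>+ x. enn_powr (W x) s \<partial>M)
          \<le> ennreal L * (ennreal \<kappa> * I + (ennreal (4 * K) * I + ennreal (4 * \<epsilon>\<^sup>2 * measure M (space M))))"
        if "0 < \<epsilon>" for \<epsilon> :: real
      proof -
        have W: "AE x in M. enn_powr (W x) s \<le> ennreal L * (X x + enn_powr (Y x + ennreal \<epsilon>) 2)"
          using Yfin AE_space
        proof eventually_elim
          fix x assume Yx: "Y x < top" and x[measurable]: "x \<in> space M"
          define Z where "Z = Y x + ennreal \<epsilon>"
          have Z: "0 < Z" "Z < top" using Yx \<open>0 < \<epsilon>\<close> by (auto simp: Z_def add_pos_pos intro: add_nonneg_pos)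
          have pw: "enn_powr (avg (t n) (g r) x) b \<le> ennreal (2 powr b) * (avg (t n) (u r) x * enn_powr Z (b - 1))"
            if n: "n < N" and r[measurable]: "r \<in> space R" for n r
          proof (rule enn_optimize[OF b(2) Z])
            fix c :: real assume "0 < c"
            have [measurable]: "g r \<in> borel_measurable M" "u r \<in> borel_measurable M" by measurable
            have "avg (t n) (g r) x \<le> avg (t n) (\<lambda>y. ennreal (c powr (1 - b)) * u r y + ennreal c * h y) x"
            proof (intro avg_mono)
              fix y
              show "g r y \<le> ennreal (c powr (1 - b)) * u r y + ennreal c * h y"
                using enn_split[OF b(2) \<open>0 < c\<close>, of "g r y" "h y"]
                by (simp only: u_def h_def enn_powr_powr bs(2))
            qed
            also have "\<dots> = ennreal (c powr (1 - b)) * avg (t n) (u r) x + ennreal c * avg (t n) h x"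
              by (subst avg_add, measurable, (subst avg_cmult, measurable)+)
            also have "\<dots> \<le> ennreal (c powr (1 - b)) * avg (t n) (u r) x + ennreal c * Z"
              using Y(2)[OF n x] by (intro add_left_mono mult_left_mono) (auto simp: Z_def add_increasing2)
            finally show "avg (t n) (g r) x \<le> ennreal (c powr (1 - b)) * avg (t n) (u r) x + ennreal c * Z" .
          qed
          have "W x \<le> (\<Sum>n<N. \<integral>\<^sup>+ r. ennreal (2 powr b) * enn_powr Z (b - 1) * (avg (t n) (u r) x * w n r) \<partial>R)"
            unfolding W_def
          proof (intro sum_mono nn_integral_mono)
            fix n r assume "n \<in> {..<N}" "r \<in> space R"
            then have "enn_powr (avg (t n) (g r) x) b * w n r
                \<le> ennreal (2 powr b) * (avg (t n) (u r) x * enn_powr Z (b - 1)) * w n r"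
              by (intro mult_right_mono pw) auto
            then show "enn_powr (avg (t n) (g r) x) b * w n r
                \<le> ennreal (2 powr b) * enn_powr Z (b - 1) * (avg (t n) (u r) x * w n r)"
              by (simp only: mult_ac)
          qed
          also have "\<dots> = ennreal (2 powr b) * enn_powr Z (b - 1) * X x"
            unfolding X_def by (subst nn_integral_cmult) (auto simp: sum_distrib_left)
          finally have "enn_powr (W x) s \<le> enn_powr (ennreal (2 powr b) * enn_powr Z (b - 1) * X x) s"
            using \<open>0 < s\<close> by (intro enn_powr_mono) auto
          also have "\<dots> = ennreal L * (enn_powr (X x) s * enn_powr (enn_powr Z 2) (1 - s))"
            using bs by (simp add: enn_powr_mult enn_powr_powr L_def mult_ac)
          also have "\<dots> \<le> ennreal L * (X x + enn_powr Z 2)"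
            using \<open>0 < s\<close> \<open>\<not> 1 \<le> s\<close> by (intro mult_left_mono enn_powr_mult_le_add) auto
          finally show "enn_powr (W x) s \<le> ennreal L * (X x + enn_powr (Y x + ennreal \<epsilon>) 2)"
            by (simp add: Z_def)
        qed
        have "(\<integral>\<^sup>+ x. enn_powr (W x) s \<partial>M) \<le> (\<integral>\<^sup>+ x. ennreal L * (X x + enn_powr (Y x + ennreal \<epsilon>) 2) \<partial>M)"
          by (intro nn_integral_mono_AE W)
        also have "\<dots> = ennreal L * ((\<integral>\<^sup>+ x. X x \<partial>M) + (\<integral>\<^sup>+ x. enn_powr (Y x + ennreal \<epsilon>) 2 \<partial>M))"
          by (subst nn_integral_cmult, measurable, subst nn_integral_add) auto
        also have "\<dots> \<le> ennreal L * (ennreal \<kappa> * I + (ennreal (4 * K) * I + ennreal (4 * \<epsilon>\<^sup>2 * measure M (space M))))"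
        proof (intro mult_left_mono add_mono X_int)
          have "(\<integral>\<^sup>+ x. enn_powr (Y x + ennreal \<epsilon>) 2 \<partial>M) \<le> (\<integral>\<^sup>+ x. ennreal 4 * (enn_powr (Y x) 2 + ennreal (\<epsilon>\<^sup>2)) \<partial>M)"
            using enn_powr_add_le[of 2 "Y x" "ennreal \<epsilon>" for x] \<open>0 < \<epsilon>\<close> by (intro nn_integral_mono) auto
          also have "\<dots> = ennreal 4 * ((\<integral>\<^sup>+ x. enn_powr (Y x) 2 \<partial>M) + ennreal (\<epsilon>\<^sup>2) * emeasure M (space M))"
            by (subst nn_integral_cmult, measurable, subst nn_integral_add) auto
          also have "\<dots> \<le> ennreal 4 * (ennreal K * I + ennreal (\<epsilon>\<^sup>2) * ennreal (measure M (space M)))"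
            using Y(3) by (intro mult_left_mono add_mono) (auto simp: emeasure_eq_measure)
          also have "\<dots> = ennreal (4 * K) * I + ennreal (4 * \<epsilon>\<^sup>2 * measure M (space M))"
            using K(1) by (simp add: distrib_left ennreal_mult mult.assoc)
          finally show "(\<integral>\<^sup>+ x. enn_powr (Y x + ennreal \<epsilon>) 2 \<partial>M)
            \<le> ennreal (4 * K) * I + ennreal (4 * \<epsilon>\<^sup>2 * measure M (space M))" .
        qed auto
        finally show ?thesis .
      qed
      show ?thesis
      proof (rule ennreal_le_epsilon)
        fix e :: real assume "0 < e"
        define m where "m = measure M (space M) + 1"
        have m: "m > 0" "measure M (space M) \<le> m" by (auto simp: m_def add_nonneg_pos)
        define \<epsilon> where "\<epsilon> = sqrt (e / (L * 4 * m))"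
        have \<epsilon>: "\<epsilon> > 0" "\<epsilon>\<^sup>2 = e / (L * 4 * m)" using \<open>0 < e\<close> \<open>L > 0\<close> m by (auto simp: \<epsilon>_def)
        have "L * (4 * \<epsilon>\<^sup>2 * measure M (space M)) \<le> L * (4 * \<epsilon>\<^sup>2 * m)"
          using m \<open>L > 0\<close> by (intro mult_left_mono) auto
        also have "\<dots> = e" using \<open>L > 0\<close> m by (simp add: \<epsilon>(2))
        finally have le: "ennreal L * ennreal (4 * \<epsilon>\<^sup>2 * measure M (space M)) \<le> ennreal e"
          using \<open>L > 0\<close> by (subst ennreal_mult[symmetric]) (auto intro: ennreal_leI)
        have "(\<integral>\<^sup>+ x. enn_powr (W x) s \<partial>M)
          \<le> ennreal L * (ennreal \<kappa> * I + (ennreal (4 * K) * I + ennreal (4 * \<epsilon>\<^sup>2 * measure M (space M))))"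
          by (rule main[OF \<epsilon>(1)])
        also have "\<dots> = ennreal L * (ennreal \<kappa> * I + ennreal (4 * K) * I) + ennreal L * ennreal (4 * \<epsilon>\<^sup>2 * measure M (space M))"
          by (simp only: distrib_left add.assoc)
        also have "\<dots> \<le> ennreal L * (ennreal \<kappa> * I + ennreal (4 * K) * I) + ennreal e"
          by (intro add_left_mono le)
        also have "ennreal L * (ennreal \<kappa> * I + ennreal (4 * K) * I) = ennreal (L * (\<kappa> + 4 * K)) * I"
          using \<open>L > 0\<close> K(1) kappa_pos
          by (simp add: ennreal_mult ennreal_plus distrib_left distrib_right mult.assoc)
        finally show "(\<integral>\<^sup>+ x. enn_powr (W x) s \<partial>M) \<le> ennreal (L * (\<kappa> + 4 * K)) * I + ennreal e" .
      qed
    qed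
    then show "(\<integral>\<^sup>+ x. enn_powr (\<Sum>n<N. \<integral>\<^sup>+ r. enn_powr (avg (t n) (g r) x) (avg_exponent s) * w n r \<partial>R) s \<partial>M)
      \<le> ennreal (L * (\<kappa> + 4 * K)) * (\<integral>\<^sup>+ x. enn_powr (\<Sum>n<N. \<integral>\<^sup>+ r. enn_powr (g r x) (avg_exponent s) * w n r \<partial>R) s \<partial>M)"
      by (simp add: W_def I_def H_def b_def)
  qed
qed

end

section \<open>The circle with the chordal distance\<close>

context ball_growth
begin

text \<open>Jensen's inequality up to constants, obtained from \<open>enn_split\<close> with
  \<open>h = 1\<close>. The power of \<open>\<kappa>\<close> appears because the average of 1 may be
  as large as \<open>\<kappa>\<close>.\<close>

lemma avg_powr_le:
  assumes "1 \<le> b" and [measurable]: "g \<in> borel_measurable M" "x \<in> space M" and "0 < t"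
  shows "enn_powr (avg t g x) b \<le> ennreal (2 powr b * \<kappa> powr (b - 1)) * avg t (\<lambda>y. enn_powr (g y) b) x"
proof (cases "b = 1")
  case True
  have "1 * avg t g x \<le> 2 * avg t g x"
    by (intro mult_right_mono) auto
  then show ?thesis using True kappa_pos by simp
next
  case False
  have "enn_powr (avg t g x) b \<le> ennreal (2 powr b) * (avg t (\<lambda>y. enn_powr (g y) b) x * enn_powr (ennreal \<kappa>) (b - 1))"
  proof (rule enn_optimize)
    fix c :: real assume "0 < c"
    have "avg t g x \<le> avg t (\<lambda>y. ennreal (c powr (1 - b)) * enn_powr (g y) b + ennreal c * 1) x"
      using enn_split[of b c _ 1] \<open>0 < c\<close> False assms(1) by (intro avg_mono) auto
    also have "\<dots> = ennreal (c powr (1 - b)) * avg t (\<lambda>y. enn_powr (g y) b) x + ennreal c * avg t (\<lambda>_. 1) x"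
      by (subst avg_add, measurable, (subst avg_cmult, measurable)+)
    also have "\<dots> \<le> ennreal (c powr (1 - b)) * avg t (\<lambda>y. enn_powr (g y) b) x + ennreal c * ennreal \<kappa>"
      using avg_const_le[of x t 1] assms by (intro add_left_mono mult_left_mono) auto
    finally show "avg t g x \<le> ennreal (c powr (1 - b)) * avg t (\<lambda>y. enn_powr (g y) b) x + ennreal c * ennreal \<kappa>" .
  qed (use False assms kappa_pos in auto)
  then show ?thesis
    using kappa_pos by (simp add: ennreal_mult mult_ac)
qed

text \<open>Tonelli on the pairs \<open>(u, y)\<close> with \<open>d x u <= t\<close> and
  \<open>d u y <= r\<close>: the lower bound on balls of radius \<open>r\<close> inserts a small
  average at the cost of doubling the outer radius. Such small averages are what a tent quasinorm
  controls.\<close>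

lemma avg_le_avg_avg:
  assumes [measurable]: "g \<in> borel_measurable M" "x \<in> space M" and "0 < r" "r \<le> t" "0 < a"
    and lower: "\<And>u. u \<in> space M \<Longrightarrow> ennreal (a * r) \<le> emeasure M {y \<in> space M. d u y \<le> r}"
  shows "avg t g x \<le> ennreal (2 / a) * avg (2 * t) (avg r g) x"
proof -
  interpret P: pair_sigma_finite M M ..
  have [measurable]: "{y \<in> space M. d u y \<le> r} \<in> sets M" if [measurable]: "u \<in> space M" for u
    by measurable
  have "ennreal (a * r) * (\<integral>\<^sup>+ u. (if d x u \<le> t then g u else 0) \<partial>M)
      = (\<integral>\<^sup>+ u. ennreal (a * r) * (if d x u \<le> t then g u else 0) \<partial>M)"
    by (intro nn_integral_cmult[symmetric]) measurable
  also have "\<dots> \<le> (\<integral>\<^sup>+ u. emeasure M {y \<in> space M. d u y \<le> r} * (if d x u \<le> t then g u else 0) \<partial>M)"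
    by (intro nn_integral_mono mult_right_mono lower) auto
  also have "\<dots> = (\<integral>\<^sup>+ u. (\<integral>\<^sup>+ y. (if d x u \<le> t then g u else 0) * indicator {y \<in> space M. d u y \<le> r} y \<partial>M) \<partial>M)"
    by (intro nn_integral_cong, subst nn_integral_cmult_indicator) (auto simp: mult.commute)
  also have "\<dots> = (\<integral>\<^sup>+ u. (\<integral>\<^sup>+ y. (if d x u \<le> t \<and> d u y \<le> r then g u else 0) \<partial>M) \<partial>M)"
    by (intro nn_integral_cong) (auto split: split_indicator)
  also have "\<dots> = (\<integral>\<^sup>+ y. (\<integral>\<^sup>+ u. (if d x u \<le> t \<and> d u y \<le> r then g u else 0) \<partial>M) \<partial>M)"
    by (intro P.Fubini'[symmetric]) measurable
  also have "\<dots> \<le> (\<integral>\<^sup>+ y. (if d x y \<le> 2 * t then \<integral>\<^sup>+ u. (if d y u \<le> r then g u else 0) \<partial>M else 0) \<partial>M)"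
  proof (intro nn_integral_mono)
    fix y assume "y \<in> space M"
    have "(\<integral>\<^sup>+ u. (if d x u \<le> t \<and> d u y \<le> r then g u else 0) \<partial>M)
        \<le> (\<integral>\<^sup>+ u. (if d x y \<le> 2 * t then (if d y u \<le> r then g u else 0) else 0) \<partial>M)"
    proof (intro nn_integral_mono)
      fix u
      show "(if d x u \<le> t \<and> d u y \<le> r then g u else 0)
        \<le> (if d x y \<le> 2 * t then (if d y u \<le> r then g u else 0) else 0)"
        using d_triangle[of x y u] d_sym[of u y] \<open>r \<le> t\<close> by auto
    qed
    then show "(\<integral>\<^sup>+ u. (if d x u \<le> t \<and> d u y \<le> r then g u else 0) \<partial>M)
        \<le> (if d x y \<le> 2 * t then \<integral>\<^sup>+ u. (if d y u \<le> r then g u else 0) \<partial>M else 0)"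
      by auto
  qed
  finally have *: "ennreal (a * r) * (\<integral>\<^sup>+ u. (if d x u \<le> t then g u else 0) \<partial>M)
    \<le> (\<integral>\<^sup>+ y. (if d x y \<le> 2 * t then \<integral>\<^sup>+ u. (if d y u \<le> r then g u else 0) \<partial>M else 0) \<partial>M)" (is "_ \<le> ?J") .
  have "avg (2 * t) (avg r g) x = ennreal (1 / (2 * t)) * (\<integral>\<^sup>+ y. ennreal (1 / r) *
      (if d x y \<le> 2 * t then \<integral>\<^sup>+ u. (if d y u \<le> r then g u else 0) \<partial>M else 0) \<partial>M)"
    unfolding avg_def[of "2 * t"] by (intro arg_cong[where f="(*) _"] nn_integral_cong) (simp add: avg_def)
  also have "\<dots> = ennreal (1 / (2 * t)) * (ennreal (1 / r) * ?J)"
    by (subst nn_integral_cmult) auto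
  finally have J: "avg (2 * t) (avg r g) x = ennreal (1 / (2 * t) * (1 / r)) * ?J"
    using assms ennreal_mult[of "1 / (2 * t)" "1 / r"] by (simp only: mult.assoc[symmetric]) simp
  have "avg t g x = ennreal (2 / a * (1 / (2 * t) * (1 / r))) * (ennreal (a * r) * (\<integral>\<^sup>+ u. (if d x u \<le> t then g u else 0) \<partial>M))"
    unfolding avg_def mult.assoc[symmetric] using assms
    by (subst ennreal_mult[symmetric]) (auto simp: field_simps)
  also have "\<dots> \<le> ennreal (2 / a * (1 / (2 * t) * (1 / r))) * ?J"
    by (intro mult_left_mono *) auto
  also have "\<dots> = ennreal (2 / a) * avg (2 * t) (avg r g) x"
    unfolding J using assms
    by (subst ennreal_mult[of "2 / a" "1 / (2 * t) * (1 / r)"]) (simp_all add: mult.assoc)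
  finally show ?thesis .
qed

end

section \<open>Chordal distance and arc length\<close>

text \<open>Angles stay real numbers; the periodicity of \<open>cis\<close> identifies them modulo
  \<open>2 * pi\<close>.\<close>

definition chord :: "real \<Rightarrow> real \<Rightarrow> real" where
  "chord x y = cmod (cis x - cis y)"

lemma borel_measurable_cis [measurable]: "cis \<in> borel_measurable borel"
  by (intro borel_measurable_continuous_onI continuous_intros)

lemma chord_eq: "chord x y = 2 * \<bar>sin ((x - y) / 2)\<bar>"
proof -
  have "cis x - cis y = cis y * (exp (\<i> * of_real (x - y)) - 1)"
    by (simp add: cis_conv_exp exp_diff right_diff_distrib)
  then show ?thesis
    using dist_exp_i_1[of "x - y"] by (simp add: chord_def norm_mult)
qed

lemma chord_le: "chord x y \<le> \<bar>x - y\<bar>"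
  using abs_sin_x_le_abs_x[of "(x - y) / 2"] by (simp add: chord_eq)

text \<open>A weak form of Jordan's inequality. The mean value theorem gives
  \<open>sin (u/2) >= (u/2) * cos (u/2)\<close>; multiplying by \<open>2 * cos (u/2)\<close> gives
  \<open>sin u >= u * (1 + cos u) / 2 >= u / 2\<close>.\<close>

lemma abs_le_two_abs_sin:
  fixes u :: real
  assumes "\<bar>u\<bar> \<le> pi / 2"
  shows "\<bar>u\<bar> \<le> 2 * \<bar>sin u\<bar>"
proof -
  have *: "u \<le> 2 * sin u" if u: "0 < u" "u \<le> pi / 2" for u :: real
  proof -
    have "\<exists>z>0. z < u / 2 \<and> sin (u / 2) - sin 0 = (u / 2 - 0) * cos z"
      using u by (intro MVT2) (auto intro!: derivative_eq_intros)
    then obtain z where z: "0 < z" "z < u / 2" "sin (u / 2) = u / 2 * cos z" by auto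
    have "cos (u / 2) \<le> cos z"
      using z u by (intro cos_monotone_0_pi_le) auto
    then have "u / 2 * cos (u / 2) \<le> sin (u / 2)" using u by (simp add: z(3))
    moreover have "0 \<le> cos (u / 2)" using u by (intro cos_ge_zero) auto
    ultimately have "u / 2 * cos (u / 2) * cos (u / 2) \<le> sin (u / 2) * cos (u / 2)"
      by (intro mult_right_mono)
    moreover have "sin u = 2 * (sin (u / 2) * cos (u / 2))"
      using sin_double[of "u / 2"] by simp
    moreover have "cos u = 2 * (cos (u / 2) * cos (u / 2)) - 1"
      using cos_double_cos[of "u / 2"] by (simp add: power2_eq_square)
    moreover have "0 \<le> cos u" using u by (intro cos_ge_zero) auto
    then have "0 \<le> u * cos u" using u by simp
    moreover have "u * (2 * (cos (u / 2) * cos (u / 2)) - 1 + 1) = 2 * (u / 2 * cos (u / 2) * cos (u / 2)) * 2"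
      by (simp add: algebra_simps)
    ultimately show ?thesis
      by (simp only: distrib_left)
  qed
  show ?thesis
    using *[of u] *[of "- u"] assms by (cases "u = 0"; cases "u > 0") auto
qed

lemma abs_le_two_chord: "\<bar>x - y\<bar> \<le> pi \<Longrightarrow> \<bar>x - y\<bar> \<le> 2 * chord x y"
  using abs_le_two_abs_sin[of "(x - y) / 2"] by (simp add: chord_eq)

lemma chord_periodic: "chord (x - 2 * pi * of_int k) y = chord x y"
proof -
  have "cis (x - 2 * pi * of_int k) = cis x"
    using cis_multiple_2pi[of "of_int k"] by (simp add: cis_divide[symmetric])
  then show ?thesis by (simp add: chord_def)
qed

text \<open>A density on the line, so that every angle is a point of the space and measurability is
  that of the real line.\<close>

definition "arc_measure = density lborel (indicator {0..2 * pi})"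

lemma space_arc_measure [simp]: "space arc_measure = UNIV"
  and sets_arc_measure [measurable_cong, simp]: "sets arc_measure = sets borel"
  by (simp_all add: arc_measure_def)

lemma emeasure_arc_measure: "A \<in> sets borel \<Longrightarrow> emeasure arc_measure A = emeasure lborel ({0..2 * pi} \<inter> A)"
  unfolding arc_measure_def by (subst emeasure_density) (auto simp: indicator_inter_arith[symmetric])

lemma nn_integral_arc_measure:
  "f \<in> borel_measurable borel \<Longrightarrow> (\<integral>\<^sup>+ x. f x \<partial>arc_measure) = (\<integral>\<^sup>+ x. f x * indicator {0..2 * pi} x \<partial>lborel)"
  unfolding arc_measure_def by (subst nn_integral_density) (auto simp: mult.commute)

lemma exists_period_shift:
  obtains k :: int where "x - 2 * pi * of_int k \<in> {0..2 * pi}"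
proof (rule that)
  have "of_int \<lfloor>x / (2 * pi)\<rfloor> \<le> x / (2 * pi)" "x / (2 * pi) < of_int \<lfloor>x / (2 * pi)\<rfloor> + 1"
    by linarith+
  then have "of_int \<lfloor>x / (2 * pi)\<rfloor> * (2 * pi) \<le> x" "x < (of_int \<lfloor>x / (2 * pi)\<rfloor> + 1) * (2 * pi)"
    by (simp_all only: pos_le_divide_eq pos_divide_less_eq pi_gt_zero mult_pos_pos zero_less_numeral)
  then show "x - 2 * pi * of_int \<lfloor>x / (2 * pi)\<rfloor> \<in> {0..2 * pi}"
    by (simp add: algebra_simps)
qed

text \<open>An arc of length at most \<open>pi\<close> is at most twice its chord, so the ball lies
  in three intervals of length \<open>4 * t\<close>, around \<open>x\<close> and its two translates
  by a period; hence the constant 12.\<close>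

lemma chord_growth:
  assumes "0 < t"
  shows "emeasure arc_measure {y. chord x y \<le> t} \<le> ennreal (12 * t)"
proof -
  have *: "emeasure arc_measure {y. chord x y \<le> t} \<le> ennreal (12 * t)" if x: "x \<in> {0..2 * pi}" for x
  proof -
    have near: "\<bar>x - y + c\<bar> \<le> 2 * t"
      if "chord x y \<le> t" "\<bar>x - y + c\<bar> \<le> pi" "cis (y - c) = cis y" for y c
      using that abs_le_two_chord[of x "y - c"] by (simp add: chord_def algebra_simps)
    have per: "cis (y - 2 * pi) = cis y" "cis (y + 2 * pi) = cis y" for y
      by (auto simp: complex_eq_iff sin_diff cos_diff sin_add cos_add)
    let ?A = "{x - 2 * t..x + 2 * t} \<union> ({x - 2 * pi - 2 * t..x - 2 * pi + 2 * t} \<union> {x + 2 * pi - 2 * t..x + 2 * pi + 2 * t})"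
    have sub: "{0..2 * pi} \<inter> {y. chord x y \<le> t} \<subseteq> ?A"
    proof
      fix y assume "y \<in> {0..2 * pi} \<inter> {y. chord x y \<le> t}"
      then have y: "0 \<le> y" "y \<le> 2 * pi" "chord x y \<le> t" by auto
      consider "\<bar>x - y\<bar> \<le> pi" | "\<bar>x - y + 2 * pi\<bar> \<le> pi" | "\<bar>x - y - 2 * pi\<bar> \<le> pi"
        using y x by (auto simp: abs_le_iff) linarith
      then show "y \<in> ?A"
      proof cases
        case 1 then show ?thesis using near[of y 0] y by (auto simp: abs_le_iff)
      next
        case 2 then show ?thesis using near[of y "2 * pi"] y per by (auto simp: abs_le_iff)
      next
        case 3 then show ?thesis using near[of y "- 2 * pi"] y per by (auto simp: abs_le_iff)
      qed
    qed
    have [measurable]: "{y. chord x y \<le> t} \<in> sets borel"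
      unfolding chord_def by measurable
    have "emeasure arc_measure {y. chord x y \<le> t} = emeasure lborel ({0..2 * pi} \<inter> {y. chord x y \<le> t})"
      by (intro emeasure_arc_measure) measurable
    also have "\<dots> \<le> emeasure lborel ?A"
      by (intro emeasure_mono sub) auto
    also have "\<dots> \<le> emeasure lborel {x - 2 * t..x + 2 * t} + (emeasure lborel {x - 2 * pi - 2 * t..x - 2 * pi + 2 * t}
        + emeasure lborel {x + 2 * pi - 2 * t..x + 2 * pi + 2 * t})"
      by (intro order_trans[OF emeasure_subadditive] add_left_mono emeasure_subadditive) auto
    also have "\<dots> = ennreal (12 * t)"
      using assms by (simp add: ennreal_plus[symmetric] del: ennreal_plus)
    finally show ?thesis .
  qed
  obtain k :: int where "x - 2 * pi * of_int k \<in> {0..2 * pi}" by (rule exists_period_shift)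
  from *[OF this] show ?thesis by (simp add: chord_periodic)
qed

lemma chord_growth_lower:
  assumes "0 < t" "t \<le> 2"
  shows "ennreal t \<le> emeasure arc_measure {y. chord x y \<le> t}"
proof -
  have *: "ennreal t \<le> emeasure arc_measure {y. chord x y \<le> t}" if x: "x \<in> {0..2 * pi}" for x
  proof -
    \<comment> \<open>The arc of length \<open>t\<close> starts or ends at \<open>x\<close>, on the
      side on which it stays within \<open>[0, 2 * pi]\<close>; this uses
      \<open>t <= 2 < pi\<close>.\<close>
    define l where "l = (if x \<le> pi then x else x - t)"
    have l: "{l..l + t} \<subseteq> {0..2 * pi} \<inter> {y. chord x y \<le> t}"
    proof
      fix y assume y: "y \<in> {l..l + t}"
      then have "\<bar>x - y\<bar> \<le> t" "0 \<le> y" "y \<le> 2 * pi"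
        using assms x pi_gt3 by (auto simp: l_def split: if_splits)
      then show "y \<in> {0..2 * pi} \<inter> {y. chord x y \<le> t}"
        using chord_le[of x y] by auto
    qed
    have [measurable]: "{y. chord x y \<le> t} \<in> sets borel"
      unfolding chord_def by measurable
    have "emeasure lborel {l..l + t} \<le> emeasure lborel ({0..2 * pi} \<inter> {y. chord x y \<le> t})"
      by (intro emeasure_mono l) measurable
    then show ?thesis using assms by (simp add: emeasure_arc_measure)
  qed
  obtain k :: int where "x - 2 * pi * of_int k \<in> {0..2 * pi}" by (rule exists_period_shift)
  from *[OF this] show ?thesis by (simp add: chord_periodic)
qed

interpretation circle: ball_growth arc_measure chord 12
proof (intro ball_growth.intro ball_growth_axioms.intro)
  show "finite_measure arc_measure"
    by (rule finite_measureI) (simp add: emeasure_arc_measure)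
  show "case_prod chord \<in> borel_measurable (arc_measure \<Otimes>\<^sub>M arc_measure)"
    unfolding chord_def split_def by measurable
  show "chord x y = chord y x" for x y by (simp add: chord_def norm_minus_commute)
  show "chord x z \<le> chord x y + chord y z" for x y z
    unfolding chord_def using norm_triangle_ineq[of "cis x - cis y" "cis y - cis z"] by simp
  show "emeasure arc_measure {y \<in> space arc_measure. chord x y \<le> t} \<le> ennreal (12 * t)"
    if "0 < t" for x t
    using that by (simp add: chord_growth)
qed simp

section \<open>Subharmonicity of powers of holomorphic functions\<close>

text \<open>On the sphere \<open>of_real (\<rho>^2) - cnj c * w\<close> is \<open>w\<close> times
  the conjugate of \<open>w - c\<close>: the Blaschke factor with zero \<open>c\<close> has modulus
  1 there.\<close>

lemma norm_reflection_sphere: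
  assumes "cmod w = \<rho>"
  shows "cmod (of_real (\<rho>\<^sup>2) - cnj c * w) = \<rho> * cmod (w - c)"
proof -
  have "of_real (\<rho>\<^sup>2) - cnj c * w = w * cnj (w - c)"
    using assms complex_norm_square[of w] by (simp add: algebra_simps)
  then show ?thesis using assms by (simp add: norm_mult del: complex_cnj_diff)
qed

text \<open>The difference of the two squares factors as
  \<open>(\<rho>^2 - |c|^2) * (\<rho>^2 - |z|^2)\<close>: inside the disc the Blaschke factor has
  modulus at most 1.\<close>

lemma norm_reflection_ball:
  assumes "cmod z \<le> \<rho>" "cmod c \<le> \<rho>"
  shows "\<rho> * cmod (z - c) \<le> cmod (of_real (\<rho>\<^sup>2) - cnj c * z)"
proof -
  have "(cmod (of_real (\<rho>\<^sup>2) - cnj c * z))\<^sup>2 - (\<rho> * cmod (z - c))\<^sup>2 = (\<rho>\<^sup>2 - (cmod c)\<^sup>2) * (\<rho>\<^sup>2 - (cmod z)\<^sup>2)"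
  proof -
    have "Re (of_real (\<rho>\<^sup>2) - cnj c * z) = \<rho>\<^sup>2 - (Re c * Re z + Im c * Im z)"
      "Im (of_real (\<rho>\<^sup>2) - cnj c * z) = Im c * Re z - Re c * Im z"
      by (simp_all del: of_real_power)
    then show ?thesis
      unfolding power_mult_distrib cmod_power2 minus_complex.sel by algebra
  qed
  moreover have "0 \<le> \<dots>"
    using assms by (intro mult_nonneg_nonneg) (auto intro: power_mono)
  ultimately show ?thesis
    using power2_le_imp_le[of "\<rho> * cmod (z - c)" "cmod (of_real (\<rho>\<^sup>2) - cnj c * z)"]
    by (simp only: norm_ge_zero)
qed

lemma reflection_nonzero:
  assumes "cmod c < \<rho>" "cmod z \<le> \<rho>"
  shows "of_real (\<rho>\<^sup>2) - cnj c * z \<noteq> 0"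
proof
  assume *: "of_real (\<rho>\<^sup>2) - cnj c * z = 0"
  have "0 < \<rho>" using assms by (smt (verit) norm_ge_zero)
  have "cmod c * cmod z \<le> cmod c * \<rho>" using assms by (intro mult_left_mono) auto
  also have "\<dots> < \<rho> * \<rho>" using assms \<open>0 < \<rho>\<close> by (intro mult_strict_right_mono) auto
  finally have "cmod (cnj c * z) < \<rho>\<^sup>2" by (simp add: norm_mult power2_eq_square)
  moreover have "cnj c * z = of_real (\<rho>\<^sup>2)" using * by simp
  then have "cmod (cnj c * z) = \<rho>\<^sup>2" by (metis abs_of_nonneg norm_of_real zero_le_power2)
  ultimately show False by simp
qed

text \<open>Without zeros, \<open>f\<close> has a holomorphic logarithm and |f|^a is the modulus of
  a holomorphic function \<open>h\<close>. Cauchy's formula, applied to \<open>h\<close> times a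
  factor with value 1 at \<open>z\<close>, yields the Poisson integral on taking moduli.\<close>

lemma poisson_submean_zero_free:
  assumes f: "f holomorphic_on ball 0 R" and \<rho>: "\<rho> < R" and z: "cmod z < \<rho>" and "0 < a"
    and nz: "\<And>w. w \<in> cball 0 \<rho> \<Longrightarrow> f w \<noteq> 0"
  shows "ennreal (cmod (f z) powr a) \<le> ennreal (1 / (2 * pi)) *
    (\<integral>\<^sup>+ \<theta>\<in>{0..2 * pi}. ennreal (cmod (f (rcis \<rho> \<theta>)) powr a * ((\<rho>\<^sup>2 - (cmod z)\<^sup>2) / (cmod (rcis \<rho> \<theta> - z))\<^sup>2)) \<partial>lborel)"
proof -
  have "0 < \<rho>" using z by (smt (verit) norm_ge_zero)
  have "open {w \<in> ball 0 R. f w \<noteq> 0}"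
    using continuous_open_preimage[OF holomorphic_on_imp_continuous_on[OF f] open_ball, of "- {0}"]
    by (auto simp: vimage_def Int_def)
  moreover have "cball 0 \<rho> \<subseteq> {w \<in> ball 0 R. f w \<noteq> 0}"
    using nz \<rho> by auto
  ultimately obtain e where e: "e > 0" "(\<Union>x\<in>cball 0 \<rho>. ball x e) \<subseteq> {w \<in> ball 0 R. f w \<noteq> 0}"
    by (rule compact_subset_open_imp_ball_epsilon_subset[OF compact_cball])
  \<comment> \<open>By compactness the zero-free neighbourhood of the closed disc contains a larger
    disc, on which the logarithm is defined.\<close>
  have sub: "ball 0 (\<rho> + e) \<subseteq> {w \<in> ball 0 R. f w \<noteq> 0}"
  proof
    fix w :: complex assume w: "w \<in> ball 0 (\<rho> + e)"
    show "w \<in> {w \<in> ball 0 R. f w \<noteq> 0}"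
    proof (cases "cmod w \<le> \<rho>")
      case True
      then have "w \<in> (\<Union>x\<in>cball 0 \<rho>. ball x e)" using e(1) by (intro UN_I[of w]) auto
      then show ?thesis using e(2) by blast
    next
      case False
      define x where "x = of_real (\<rho> / cmod w) * w"
      have "cmod x = \<rho>" using False \<open>0 < \<rho>\<close> by (auto simp: x_def norm_mult norm_divide)
      have "w \<noteq> 0" using False \<open>0 < \<rho>\<close> by auto
      have "x - w = of_real (\<rho> / cmod w - 1) * w" by (simp add: x_def algebra_simps)
      then have "cmod (x - w) = \<bar>\<rho> / cmod w - 1\<bar> * cmod w" by (simp only: norm_mult norm_of_real)
      also have "\<dots> = cmod w - \<rho>" using False \<open>0 < \<rho>\<close> \<open>w \<noteq> 0\<close> by (simp add: abs_if field_simps)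
      finally have "w \<in> ball x e" using w by (simp add: dist_norm)
      then have "w \<in> (\<Union>x\<in>cball 0 \<rho>. ball x e)" using \<open>cmod x = \<rho>\<close> by (intro UN_I[of x]) auto
      then show ?thesis using e(2) by blast
    qed
  qed
  have "f holomorphic_on ball 0 (\<rho> + e)"
    using sub by (intro holomorphic_on_subset[OF f]) auto
  then obtain l where l: "l holomorphic_on ball 0 (\<rho> + e)" "\<And>w. w \<in> ball 0 (\<rho> + e) \<Longrightarrow> f w = exp (l w)"
    by (rule contractible_imp_holomorphic_log) (use sub in \<open>auto intro: convex_imp_contractible\<close>)
  define h where "h w = exp (of_real a * l w)" for w
  have norm_h: "cmod (h w) = cmod (f w) powr a" if "w \<in> ball 0 (\<rho> + e)" for w
    using l(2)[OF that] by (simp add: h_def powr_def)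
  have hol_h: "h holomorphic_on ball 0 (\<rho> + e)"
    unfolding h_def by (intro holomorphic_intros l)
  define c where "c = \<rho>\<^sup>2 - (cmod z)\<^sup>2"
  have "c > 0" using z by (simp add: c_def power_strict_mono)
  \<comment> \<open>The added factor is 1 at \<open>w = z\<close>; on the sphere it changes the
    modulus of the Cauchy kernel into the Poisson kernel.\<close>
  define k where "k w = h w * (of_real c / (of_real (\<rho>\<^sup>2) - cnj z * w))" for w
  have k_hol: "k holomorphic_on cball 0 \<rho>"
    unfolding k_def using z e(1)
    by (intro holomorphic_intros holomorphic_on_subset[OF hol_h]) (use reflection_nonzero[OF z] in auto)
  have "k z = h z"
  proof -
    have "of_real (\<rho>\<^sup>2) - cnj z * z = of_real c"
      using complex_norm_square[of z] by (simp add: c_def mult.commute)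
    then show ?thesis using \<open>c > 0\<close> by (simp add: k_def)
  qed
  have "((\<lambda>u. k u / (u - z)) has_contour_integral (2 * of_real pi * \<i> * k z)) (circlepath 0 \<rho>)"
    using z by (intro Cauchy_integral_circlepath holomorphic_on_imp_continuous_on k_hol
        holomorphic_on_subset[OF k_hol]) auto
  then have int: "((\<lambda>t. k (of_real \<rho> * cis t) / (of_real \<rho> * cis t - z) * of_real \<rho> * \<i> * cis t) has_integral (2 * of_real pi * \<i> * h z)) {0..2 * pi}"
    unfolding circlepath_def \<open>k z = h z\<close> by (subst (asm) has_contour_integral_part_circlepath_iff) auto
  define G where "G t = cmod (f (rcis \<rho> t)) powr a * (c / (cmod (rcis \<rho> t - z))\<^sup>2)" for t
  have norm_rcis: "cmod (rcis \<rho> t) = \<rho>" for t using \<open>0 < \<rho>\<close> by simp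
  have ne: "rcis \<rho> t - z \<noteq> 0" for t using norm_rcis[of t] z by auto
  have G_eq: "cmod (k (of_real \<rho> * cis t) / (of_real \<rho> * cis t - z) * of_real \<rho> * \<i> * cis t) = G t" for t
    using norm_reflection_sphere[OF norm_rcis[of t], of z] norm_h[of "rcis \<rho> t"] e(1) \<open>0 < \<rho>\<close> \<open>c > 0\<close>
    by (simp add: k_def G_def rcis_def norm_mult norm_divide power2_eq_square)
  have contG: "continuous_on {0..2 * pi} G"
  proof -
    have contF: "continuous_on {0..2 * pi} (\<lambda>t. cmod (f (rcis \<rho> t)) powr a)"
    proof -
      have "continuous_on {0..2 * pi} (\<lambda>t. f (rcis \<rho> t))"
        using \<rho> \<open>0 < \<rho>\<close> by (intro continuous_on_compose2[OF holomorphic_on_imp_continuous_on[OF f]])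
          (auto simp: rcis_def norm_mult intro!: continuous_intros)
      then show ?thesis using nz[of "rcis \<rho> _"] norm_rcis
        by (intro continuous_intros) auto
    qed
    moreover have "continuous_on {0..2 * pi} (rcis \<rho>)"
      unfolding rcis_def by (intro continuous_intros)
    ultimately show ?thesis unfolding G_def
      by (intro continuous_on_mult continuous_on_divide continuous_on_const continuous_on_power
          continuous_on_norm continuous_on_diff) (use ne in auto)
  qed
  then have intG: "(G has_integral integral {0..2 * pi} G) {0..2 * pi}"
    by (simp add: integrable_continuous_real integrable_integral)
  have "2 * pi * cmod (h z) = cmod (2 * of_real pi * \<i> * h z)" by (simp add: norm_mult)
  also have "\<dots> \<le> integral {0..2 * pi} G"
    using has_integral_norm_bound_integral_component[OF int intG, of 1]
    by (simp only: G_eq inner_real_def mult_1_right order_refl)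
  finally have "cmod (f z) powr a \<le> 1 / (2 * pi) * integral {0..2 * pi} G"
    using norm_h[of z] z e(1) pi_gt_zero by (simp add: field_simps)
  then have "ennreal (cmod (f z) powr a) \<le> ennreal (1 / (2 * pi) * integral {0..2 * pi} G)"
    by (rule ennreal_leI)
  also have "\<dots> = ennreal (1 / (2 * pi)) * ennreal (integral {0..2 * pi} G)"
    by (rule ennreal_mult') simp
  also have "ennreal (integral {0..2 * pi} G) = (\<integral>\<^sup>+ t\<in>{0..2 * pi}. ennreal (G t) \<partial>lborel)"
    using \<open>c > 0\<close> by (intro nn_integral_has_integral_lebesgue'[symmetric] intG) (auto simp: G_def)
  finally show ?thesis by (simp add: G_def c_def)
qed

text \<open>Dividing out Blaschke factors decreases neither side, so zeros inside the circle do no harm.\<close>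
lemma poisson_submean:
  assumes "f holomorphic_on ball 0 R" "\<rho> < R" "cmod z < \<rho>" "0 < a"
    and "\<And>w. cmod w = \<rho> \<Longrightarrow> f w \<noteq> 0"
  shows "ennreal (cmod (f z) powr a) \<le> ennreal (1 / (2 * pi)) *
    (\<integral>\<^sup>+ \<theta>\<in>{0..2 * pi}. ennreal (cmod (f (rcis \<rho> \<theta>)) powr a * ((\<rho>\<^sup>2 - (cmod z)\<^sup>2) / (cmod (rcis \<rho> \<theta> - z))\<^sup>2)) \<partial>lborel)"
  using assms(1,5)
proof (induction "card {w \<in> cball 0 \<rho>. f w = 0}" arbitrary: f rule: less_induct)
  case less
  note f = less.prems(1) and nz = less.prems(2)
  have "0 < \<rho>" using assms by (smt (verit) norm_ge_zero)
  show ?case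
  proof (cases "\<exists>c \<in> cball 0 \<rho>. f c = 0")
    case False
    then show ?thesis using f assms by (intro poisson_submean_zero_free) auto
  next
    case True
    then obtain c where c: "cmod c \<le> \<rho>" "f c = 0" by auto
    then have "cmod c < \<rho>" using nz[of c] by (cases "cmod c = \<rho>") auto
    have nonconst: "\<not> f constant_on ball 0 R"
    proof
      assume "f constant_on ball 0 R"
      moreover have "c \<in> ball 0 R" "of_real \<rho> \<in> ball (0::complex) R" using c \<open>0 < \<rho>\<close> assms by auto
      ultimately have "f (of_real \<rho>) = 0" using c(2) unfolding constant_on_def by metis
      then show False using nz[of "of_real \<rho>"] \<open>0 < \<rho>\<close> by simp
    qed
    have fin: "finite {w \<in> cball 0 \<rho>. f w = 0}"
      using assms nonconst by (intro holomorphic_compact_finite_zeros[OF f]) auto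
    obtain g r n where g: "0 < r" "ball c r \<subseteq> ball 0 R" "g holomorphic_on ball c r"
      "\<And>w. w \<in> ball c r \<Longrightarrow> f w = (w - c) ^ n * g w" "\<And>w. w \<in> ball c r \<Longrightarrow> g w \<noteq> 0" "0 < (n::nat)"
      by (rule holomorphic_factor_zero_nonconstant[OF f _ _ _ c(2) nonconst]) (use c assms in auto)
    define F where "F w = (if w = c then g c else f w / (w - c) ^ n)" for w
    have hol1: "F holomorphic_on ball c r"
      using g(4) by (intro holomorphic_transform[OF g(3)]) (auto simp: F_def)
    have "(\<lambda>w. f w / (w - c) ^ n) holomorphic_on ball 0 R - {c}"
      by (intro holomorphic_intros holomorphic_on_subset[OF f]) auto
    then have hol2: "F holomorphic_on ball 0 R - {c}"
      by (rule holomorphic_transform) (auto simp: F_def)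
    have "F holomorphic_on (ball 0 R - {c}) \<union> ball c r"
      by (intro holomorphic_on_Un hol1 hol2) auto
    moreover have "(ball 0 R - {c}) \<union> ball c r = ball 0 R" using g(1,2) by auto
    ultimately have F: "F holomorphic_on ball 0 R" by simp
    have f_F: "f w = (w - c) ^ n * F w" for w using c(2) g(6) by (auto simp: F_def)
    \<comment> \<open>The zero at \<open>c\<close>, with its full multiplicity \<open>n\<close>, is
      traded for reflected factors: \<open>E\<close> has the modulus of \<open>f\<close> on the
      sphere, is at least as large inside, and no longer vanishes at \<open>c\<close>.\<close>
    define E where "E w = F w * ((of_real (\<rho>\<^sup>2) - cnj c * w) / of_real \<rho>) ^ n" for w
    have E: "E holomorphic_on ball 0 R"
      unfolding E_def using \<open>0 < \<rho>\<close> by (intro holomorphic_intros F) auto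
    have E_sphere: "cmod (E w) = cmod (f w)" if "cmod w = \<rho>" for w
      unfolding E_def f_F using norm_reflection_sphere[OF that, of c] \<open>0 < \<rho>\<close>
      by (simp only: norm_mult norm_power norm_divide norm_of_real) simp
    have E_nz: "E w \<noteq> 0" if "cmod w = \<rho>" for w
      using E_sphere[OF that] nz[OF that] by auto
    have E_zeros: "{w \<in> cball 0 \<rho>. E w = 0} \<subset> {w \<in> cball 0 \<rho>. f w = 0}"
    proof
      show "{w \<in> cball 0 \<rho>. E w = 0} \<subseteq> {w \<in> cball 0 \<rho>. f w = 0}"
        using reflection_nonzero[OF \<open>cmod c < \<rho>\<close>] \<open>0 < \<rho>\<close> by (auto simp: E_def f_F)
      have "E c \<noteq> 0"
        using reflection_nonzero[OF \<open>cmod c < \<rho>\<close>, of c] c g(1,5) \<open>0 < \<rho>\<close> by (auto simp: E_def F_def)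
      then show "{w \<in> cball 0 \<rho>. E w = 0} \<noteq> {w \<in> cball 0 \<rho>. f w = 0}" using c by auto
    qed
    have "cmod (f z) \<le> cmod (E z)"
    proof -
      have "cmod (z - c) \<le> cmod ((of_real (\<rho>\<^sup>2) - cnj c * z) / of_real \<rho>)"
        using norm_reflection_ball[of z \<rho> c] assms c \<open>0 < \<rho>\<close> by (simp add: norm_divide field_simps)
      then have "cmod (z - c) ^ n \<le> cmod ((of_real (\<rho>\<^sup>2) - cnj c * z) / of_real \<rho>) ^ n"
        by (intro power_mono) auto
      then have "cmod (z - c) ^ n * cmod (F z) \<le> cmod ((of_real (\<rho>\<^sup>2) - cnj c * z) / of_real \<rho>) ^ n * cmod (F z)"
        by (intro mult_right_mono) auto
      then show ?thesis unfolding E_def f_F by (simp only: norm_mult norm_power mult.commute)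
    qed
    then have "ennreal (cmod (f z) powr a) \<le> ennreal (cmod (E z) powr a)"
      using assms by (intro ennreal_leI powr_mono2) auto
    also have "\<dots> \<le> ennreal (1 / (2 * pi)) *
      (\<integral>\<^sup>+ \<theta>\<in>{0..2 * pi}. ennreal (cmod (E (rcis \<rho> \<theta>)) powr a * ((\<rho>\<^sup>2 - (cmod z)\<^sup>2) / (cmod (rcis \<rho> \<theta> - z))\<^sup>2)) \<partial>lborel)"
      by (intro less.hyps psubset_card_mono fin E_zeros E E_nz)
    also have "\<dots> = ennreal (1 / (2 * pi)) *
      (\<integral>\<^sup>+ \<theta>\<in>{0..2 * pi}. ennreal (cmod (f (rcis \<rho> \<theta>)) powr a * ((\<rho>\<^sup>2 - (cmod z)\<^sup>2) / (cmod (rcis \<rho> \<theta> - z))\<^sup>2)) \<partial>lborel)"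
      using E_sphere \<open>0 < \<rho>\<close> by simp
    finally show ?thesis .
  qed
qed

text \<open>The zeros are countable, so they meet only countably many circles. Almost every radius
  is enough, since the Poisson estimate is averaged over \<open>\<rho>\<close> against a
  density.\<close>

lemma AE_no_zeros_on_sphere:
  assumes f: "f holomorphic_on ball 0 1" and nz: "\<exists>w \<in> ball 0 1. f w \<noteq> 0"
  shows "AE \<rho> in lborel. \<rho> < 1 \<longrightarrow> (\<forall>w. cmod w = \<rho> \<longrightarrow> f w \<noteq> 0)"
proof (cases "f constant_on ball 0 1")
  case True
  then show ?thesis using nz by (intro AE_I2) (auto simp: constant_on_def)
next
  case False
  have "countable {w \<in> ball 0 1. f w = 0}"
  proof (rule holomorphic_countable_zeros[OF f _ _ _ False])
    have "(\<Union>n. cball (0::complex) (1 - 1 / real (Suc n))) = ball 0 1"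
    proof (intro equalityI subsetI)
      fix w :: complex assume "w \<in> ball 0 1"
      then obtain n where "inverse (real (Suc n)) < 1 - cmod w"
        using reals_Archimedean[of "1 - cmod w"] by auto
      then show "w \<in> (\<Union>n. cball 0 (1 - 1 / real (Suc n)))"
        by (intro UN_I[of n]) (auto simp: inverse_eq_divide)
    qed (auto intro: le_less_trans)
    then show "fsigma (ball (0::complex) 1)"
      using fsigma.intros[of "\<lambda>n. cball (0::complex) (1 - 1 / real (Suc n))"] by simp
  qed auto
  then have "countable (cmod ` {w \<in> ball 0 1. f w = 0})" by simp
  then have "cmod ` {w \<in> ball 0 1. f w = 0} \<in> null_sets lborel"
    by (rule countable_imp_null_set_lborel)
  then have "AE \<rho> in lborel. \<rho> \<notin> cmod ` {w \<in> ball 0 1. f w = 0}"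
    by (rule AE_not_in)
  then show ?thesis by eventually_elim auto
qed

section \<open>Polar coordinates and the quasinorms\<close>

lemma lborel_complex_eq: "(lborel :: complex measure) = distr (lborel \<Otimes>\<^sub>M lborel) borel (\<lambda>(x, y). Complex x y)"
proof (rule lborel_eqI)
  fix l u :: complex assume le: "\<And>b. b \<in> Basis \<Longrightarrow> l \<bullet> b \<le> u \<bullet> b"
  have [measurable]: "(\<lambda>(x, y). Complex x y) \<in> borel_measurable (lborel \<Otimes>\<^sub>M lborel)"
    unfolding Complex_eq split_def by measurable
  have "emeasure (distr (lborel \<Otimes>\<^sub>M lborel) borel (\<lambda>(x, y). Complex x y)) (box l u)
      = emeasure (lborel \<Otimes>\<^sub>M lborel) ({Re l<..<Re u} \<times> {Im l<..<Im u})"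
    by (subst emeasure_distr)
      (auto intro!: arg_cong[where f="emeasure _"] simp: space_pair_measure box_def Basis_complex_def)
  also have "\<dots> = emeasure lborel {Re l<..<Re u} * emeasure lborel {Im l<..<Im u}"
    by (rule lborel.emeasure_pair_measure_Times) auto
  also have "\<dots> = (\<Prod>b\<in>Basis. (u - l) \<bullet> b)"
    using le[of 1] le[of \<i>] by (simp add: Basis_complex_def ennreal_mult)
  finally show "emeasure (distr (lborel \<Otimes>\<^sub>M lborel) borel (\<lambda>(x, y). Complex x y)) (box l u) = (\<Prod>b\<in>Basis. (u - l) \<bullet> b)" .
qed simp

lemma nn_integral_lborel_complex:
  assumes [measurable]: "F \<in> borel_measurable borel"
  shows "(\<integral>\<^sup>+ z. F z \<partial>lborel) = (\<integral>\<^sup>+ x. \<integral>\<^sup>+ y. F (Complex x y) \<partial>lborel \<partial>lborel)"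
proof -
  have [measurable]: "(\<lambda>(x, y). Complex x y) \<in> borel_measurable (lborel \<Otimes>\<^sub>M lborel)"
    unfolding Complex_eq split_def by measurable
  have "(\<integral>\<^sup>+ z. F z \<partial>lborel) = (\<integral>\<^sup>+ p. F (case_prod Complex p) \<partial>(lborel \<Otimes>\<^sub>M lborel))"
    by (subst lborel_complex_eq, subst nn_integral_distr) auto
  also have "\<dots> = (\<integral>\<^sup>+ x. \<integral>\<^sup>+ y. F (Complex x y) \<partial>lborel \<partial>lborel)"
    by (subst lborel.nn_integral_fst[symmetric]) auto
  finally show ?thesis .
qed

lemma nn_integral_incseq_Union:
  fixes h :: "'a \<Rightarrow> ennreal"
  assumes "incseq A" and [measurable]: "\<And>n. A n \<in> sets M" "h \<in> borel_measurable M"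
  shows "(\<integral>\<^sup>+ x. h x * indicator (\<Union>n. A n) x \<partial>M) = (SUP n. \<integral>\<^sup>+ x. h x * indicator (A n) x \<partial>M)"
proof -
  have sup: "h x * indicator (\<Union>n. A n) x = (SUP n. h x * indicator (A n) x)" for x
  proof (intro antisym SUP_least)
    show "h x * indicator (\<Union>n. A n) x \<le> (SUP n. h x * indicator (A n) x)"
    proof (cases "x \<in> (\<Union>n. A n)")
      case True
      then obtain n where "x \<in> A n" by auto
      then have "h x * indicator (\<Union>n. A n) x = h x * indicator (A n) x"
        using True by simp
      also have "\<dots> \<le> (SUP n. h x * indicator (A n) x)" by (rule SUP_upper) simp
      finally show ?thesis .
    qed simp
  next
    fix n show "h x * indicator (A n) x \<le> h x * indicator (\<Union>n. A n) x"
      by (intro mult_left_mono) (auto simp: indicator_def)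
  qed
  have "incseq (\<lambda>n x. h x * indicator (A n) x)"
  proof (intro incseq_SucI le_funI mult_left_mono)
    fix n x show "(indicator (A n) x :: ennreal) \<le> indicator (A (Suc n)) x"
      using incseq_SucD[OF assms(1), of n] by (auto simp: indicator_def)
  qed simp
  then show ?thesis
    unfolding sup by (rule nn_integral_monotone_convergence_SUP) measurable
qed

text \<open>Prepares the parametrization of a vertical line by the angle, \<open>u\<close> being the
  slope \<open>y / x\<close>. The line is exhausted by symmetric intervals, on whose preimages the
  tangent is smooth up to the endpoints.\<close>

lemma nn_integral_tan_substitution:
  fixes g :: "real \<Rightarrow> ennreal"
  assumes [measurable]: "g \<in> borel_measurable borel"
  shows "(\<integral>\<^sup>+ u. g u \<partial>lborel) = (\<integral>\<^sup>+ t. g (tan t) * ennreal (inverse ((cos t)\<^sup>2)) * indicator {- (pi / 2)<..<pi / 2} t \<partial>lborel)"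
proof -
  let ?h = "\<lambda>t. g (tan t) * ennreal (inverse ((cos t)\<^sup>2))"
  have [measurable]: "(tan :: real \<Rightarrow> real) \<in> borel_measurable borel"
    unfolding tan_def by measurable
  have *: "(\<integral>\<^sup>+ u. g u * indicator {- real n..real n} u \<partial>lborel) = (\<integral>\<^sup>+ t. ?h t * indicator {- arctan (real n)..arctan (real n)} t \<partial>lborel)" for n
  \<comment> \<open>For \<open>n = 0\<close> the interval is a single point, which the substitution
    rule excludes and which contributes nothing.\<close>
  proof (cases "n = 0")
    case True
    have "AE u in lborel. u \<noteq> (0::real)" by (rule AE_lborel_singleton)
    then have ae: "AE u in lborel. g u * indicator {- real n..real n} u = 0"
      "AE t in lborel. ?h t * indicator {- arctan (real n)..arctan (real n)} t = 0"
      using True by (auto simp: indicator_def elim!: eventually_mono)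
    show ?thesis
      using ae[THEN nn_integral_cong_AE] by (simp only: nn_integral_const mult_zero_left)
  next
    case False
    have "(\<integral>\<^sup>+ u. g u * indicator {tan (- arctan (real n))..tan (arctan (real n))} u \<partial>lborel)
      = (\<integral>\<^sup>+ t. ?h t * indicator {- arctan (real n)..arctan (real n)} t \<partial>lborel)"
    proof (intro nn_integral_substitution_aux)
      have cos: "cos t \<noteq> 0" if "t \<in> {- arctan (real n)..arctan (real n)}" for t
        using that arctan_ubound[of "real n"] by (intro less_imp_neq[symmetric] cos_gt_zero_pi) auto
      show "(tan has_real_derivative inverse ((cos t)\<^sup>2)) (at t)" if "t \<in> {- arctan (real n)..arctan (real n)}" for t
        using cos[OF that] by (rule DERIV_tan)
      show "continuous_on {- arctan (real n)..arctan (real n)} (\<lambda>t. inverse ((cos t)\<^sup>2))"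
        using cos by (intro continuous_intros) auto
      show "- arctan (real n) < arctan (real n)" using False by simp
    qed auto
    then show ?thesis by (simp add: tan_arctan)
  qed
  have U1: "(\<Union>n. {- real n..real n}) = UNIV"
  proof (intro equalityI subsetI)
    fix u :: real
    obtain n where "\<bar>u\<bar> \<le> real n" using real_arch_simple by blast
    then show "u \<in> (\<Union>n. {- real n..real n})" by (intro UN_I[of n]) auto
  qed auto
  have U2: "(\<Union>n. {- arctan (real n)..arctan (real n)}) = {- (pi / 2)<..<pi / 2}"
  proof (intro equalityI subsetI)
    fix t assume "t \<in> (\<Union>n. {- arctan (real n)..arctan (real n)})"
    then obtain n where "t \<in> {- arctan (real n)..arctan (real n)}" by blast
    then show "t \<in> {- (pi / 2)<..<pi / 2}" using arctan_ubound[of "real n"] by auto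
  next
    fix t assume t: "t \<in> {- (pi / 2)<..<pi / 2}"
    obtain n where "\<bar>tan t\<bar> \<le> real n" using real_arch_simple by blast
    then have "- real n \<le> tan t" "tan t \<le> real n" by auto
    then have "arctan (- real n) \<le> arctan (tan t)" "arctan (tan t) \<le> arctan (real n)"
      by (auto intro: arctan_monotone' simp del: arctan_le_iff)
    then have "t \<in> {- arctan (real n)..arctan (real n)}"
      using t by (simp add: arctan_tan arctan_minus)
    then show "t \<in> (\<Union>n. {- arctan (real n)..arctan (real n)})" by blast
  qed
  have "(\<integral>\<^sup>+ u. g u \<partial>lborel) = (\<integral>\<^sup>+ u. g u * indicator (\<Union>n. {- real n..real n}) u \<partial>lborel)"
    by (simp add: U1)
  also have "\<dots> = (SUP n. \<integral>\<^sup>+ u. g u * indicator {- real n..real n} u \<partial>lborel)"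
    by (intro nn_integral_incseq_Union incseq_SucI) auto
  also have "\<dots> = (\<integral>\<^sup>+ t. ?h t * indicator (\<Union>n. {- arctan (real n)..arctan (real n)}) t \<partial>lborel)"
    unfolding * by (intro nn_integral_incseq_Union[symmetric] incseq_SucI) (auto simp: arctan_le_iff)
  finally show ?thesis by (simp only: U2)
qed

lemma nn_integral_scale_real:
  assumes [measurable]: "f \<in> borel_measurable borel" and "c \<noteq> (0::real)"
  shows "(\<integral>\<^sup>+ x. f x \<partial>lborel) = ennreal \<bar>c\<bar> * (\<integral>\<^sup>+ x. f (c * x) \<partial>lborel)"
  using nn_integral_real_affine[of f c 0] assms by simp

text \<open>For fixed \<open>x\<close> the substitution \<open>y = x * tan t\<close> introduces the
  angle; after exchanging the integrals, \<open>x = r * cos t\<close> introduces a radius that runs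
  over the whole line.\<close>

lemma nn_integral_polar:
  assumes F[measurable]: "F \<in> borel_measurable borel"
  shows "(\<integral>\<^sup>+ z. F z \<partial>lborel) = (\<integral>\<^sup>+ t. \<integral>\<^sup>+ r. F (rcis r t) * ennreal r \<partial>lborel \<partial>arc_measure)"
proof -
  have [measurable]: "(tan :: real \<Rightarrow> real) \<in> borel_measurable borel"
    unfolding tan_def by measurable
  have rcis_meas [measurable]: "(\<lambda>x. rcis (f x) (g x)) \<in> borel_measurable N"
    if [measurable]: "f \<in> borel_measurable N" "g \<in> borel_measurable N" for f g :: "'b \<Rightarrow> real" and N :: "'b measure"
    unfolding rcis_def by measurable
  have Cm[measurable]: "(\<lambda>x. Complex (f x) (g x)) \<in> borel_measurable N"
    if [measurable]: "f \<in> borel_measurable N" "g \<in> borel_measurable N" for f g :: "'b \<Rightarrow> real" and N :: "'b measure"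
    unfolding Complex_eq by measurable
  define K where "K t = (\<integral>\<^sup>+ r. F (rcis r t) * ennreal r \<partial>lborel)" for t
  have [measurable]: "K \<in> borel_measurable borel" unfolding K_def by measurable
  let ?I = "{- (pi / 2)<..<pi / 2}"
  have "(\<integral>\<^sup>+ z. F z \<partial>lborel) = (\<integral>\<^sup>+ x. \<integral>\<^sup>+ y. F (Complex x y) \<partial>lborel \<partial>lborel)"
    by (rule nn_integral_lborel_complex) fact
  also have "\<dots> = (\<integral>\<^sup>+ x. ennreal \<bar>x\<bar> * (\<integral>\<^sup>+ u. F (Complex x (x * u)) \<partial>lborel) \<partial>lborel)"
  proof (intro nn_integral_cong_AE)
    have "AE x in lborel. x \<noteq> (0::real)" by (rule AE_lborel_singleton)
    then show "AE x in lborel. (\<integral>\<^sup>+ y. F (Complex x y) \<partial>lborel) = ennreal \<bar>x\<bar> * (\<integral>\<^sup>+ u. F (Complex x (x * u)) \<partial>lborel)"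
      by eventually_elim (intro nn_integral_scale_real[where f="\<lambda>y. F (Complex _ y)"], auto)
  qed
  also have "\<dots> = (\<integral>\<^sup>+ x. \<integral>\<^sup>+ t. ennreal \<bar>x\<bar> * (F (Complex x (x * tan t)) * ennreal (inverse ((cos t)\<^sup>2)) * indicator ?I t) \<partial>lborel \<partial>lborel)"
    by (intro nn_integral_cong, subst nn_integral_tan_substitution) (auto simp: nn_integral_cmult)
  also have "\<dots> = (\<integral>\<^sup>+ t. \<integral>\<^sup>+ x. ennreal \<bar>x\<bar> * (F (Complex x (x * tan t)) * ennreal (inverse ((cos t)\<^sup>2)) * indicator ?I t) \<partial>lborel \<partial>lborel)"
    by (intro lborel_pair.Fubini') measurable
  also have "\<dots> = (\<integral>\<^sup>+ t. (K t + K (t + pi)) * indicator ?I t \<partial>lborel)"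
  proof (intro nn_integral_cong)
    fix t :: real
    show "(\<integral>\<^sup>+ x. ennreal \<bar>x\<bar> * (F (Complex x (x * tan t)) * ennreal (inverse ((cos t)\<^sup>2)) * indicator ?I t) \<partial>lborel)
      = (K t + K (t + pi)) * indicator ?I t"
    proof (cases "t \<in> ?I")
      case True
      then have c: "cos t > 0" by (intro cos_gt_zero_pi) auto
      have "(\<integral>\<^sup>+ x. ennreal \<bar>x\<bar> * (F (Complex x (x * tan t)) * ennreal (inverse ((cos t)\<^sup>2)) * indicator ?I t) \<partial>lborel)
        = ennreal \<bar>cos t\<bar> * (\<integral>\<^sup>+ r. ennreal \<bar>cos t * r\<bar> * (F (Complex (cos t * r) (cos t * r * tan t)) * ennreal (inverse ((cos t)\<^sup>2)) * indicator ?I t) \<partial>lborel)"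
        using c by (intro nn_integral_scale_real[where f="\<lambda>x. ennreal \<bar>x\<bar> * (F (Complex x (x * tan t)) * ennreal (inverse ((cos t)\<^sup>2)) * indicator ?I t)"]) auto
      also have "\<dots> = (\<integral>\<^sup>+ r. F (rcis r t) * ennreal \<bar>r\<bar> \<partial>lborel)"
      proof (subst nn_integral_cmult[symmetric], measurable, intro nn_integral_cong)
        fix r :: real
        have "Complex (cos t * r) (cos t * r * tan t) = rcis r t"
          using c by (simp add: complex_eq_iff tan_def)
        moreover have "ennreal \<bar>cos t\<bar> * (ennreal \<bar>cos t * r\<bar> * ennreal (inverse ((cos t)\<^sup>2))) = ennreal \<bar>r\<bar>"
          using c by (simp add: ennreal_mult[symmetric] abs_mult power2_eq_square field_simps)
        moreover have "ennreal \<bar>cos t\<bar> * (x * (y * w * indicator ?I t)) = y * (ennreal \<bar>cos t\<bar> * (x * w))" for x y w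
          using True by (simp add: mult_ac)
        ultimately show "ennreal \<bar>cos t\<bar> * (ennreal \<bar>cos t * r\<bar> * (F (Complex (cos t * r) (cos t * r * tan t)) * ennreal (inverse ((cos t)\<^sup>2)) * indicator ?I t))
          = F (rcis r t) * ennreal \<bar>r\<bar>"
          by (simp only:)
      qed
      \<comment> \<open>Negative radii describe the opposite ray, of angle
        \<open>t + pi\<close>.\<close>
      also have "\<dots> = (\<integral>\<^sup>+ r. F (rcis r t) * ennreal r + F (rcis r t) * ennreal (- r) \<partial>lborel)"
        by (intro nn_integral_cong) (auto simp: abs_if ennreal_neg distrib_left[symmetric])
      also have "\<dots> = K t + (\<integral>\<^sup>+ r. F (rcis r t) * ennreal (- r) \<partial>lborel)"
        unfolding K_def by (intro nn_integral_add) measurable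
      also have "(\<integral>\<^sup>+ r. F (rcis r t) * ennreal (- r) \<partial>lborel) = (\<integral>\<^sup>+ r. F (rcis (- r) t) * ennreal r \<partial>lborel)"
        by (subst nn_integral_scale_real[of _ "-1"]) auto
      also have "\<dots> = K (t + pi)"
        unfolding K_def rcis_def by (simp add: cis.ctr complex_eq_iff cong: nn_integral_cong)
          (intro nn_integral_cong arg_cong2[where f="(*)"] arg_cong[where f=F] refl, simp add: complex_eq_iff)
      finally show ?thesis using True by simp
    qed auto
  qed
  also have "\<dots> = (\<integral>\<^sup>+ t. K t * indicator ?I t \<partial>lborel) + (\<integral>\<^sup>+ t. K (t + pi) * indicator ?I t \<partial>lborel)"
    by (simp add: distrib_right nn_integral_add)
  also have "(\<integral>\<^sup>+ t. K (t + pi) * indicator ?I t \<partial>lborel) = (\<integral>\<^sup>+ t. K t * indicator {pi / 2<..<3 * pi / 2} t \<partial>lborel)"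
    by (subst nn_integral_real_affine[of "\<lambda>t. K t * indicator {pi / 2<..<3 * pi / 2} t" 1 pi])
      (auto intro!: nn_integral_cong simp: add.commute split: split_indicator)
  also have "(\<integral>\<^sup>+ t. K t * indicator ?I t \<partial>lborel)
      = (\<integral>\<^sup>+ t. K t * indicator {- (pi / 2)<..<0} t + K t * indicator {0..<pi / 2} t \<partial>lborel)"
    using pi_gt_zero by (intro nn_integral_cong) (auto split: split_indicator)
  also have "\<dots> = (\<integral>\<^sup>+ t. K t * indicator {- (pi / 2)<..<0} t \<partial>lborel) + (\<integral>\<^sup>+ t. K t * indicator {0..<pi / 2} t \<partial>lborel)"
    by (intro nn_integral_add) measurable
  \<comment> \<open>The quarter of negative angles is moved by one period; the pieces then fill
    \<open>[0, 2 * pi]\<close> up to three points.\<close>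
  also have "(\<integral>\<^sup>+ t. K t * indicator {- (pi / 2)<..<0} t \<partial>lborel) = (\<integral>\<^sup>+ t. K t * indicator {3 * pi / 2<..<2 * pi} t \<partial>lborel)"
  proof -
    have "K (2 * pi + t) = K t" for t
      unfolding K_def rcis_def by (simp add: cis_mult[symmetric])
    then show ?thesis
      by (subst (2) nn_integral_real_affine[of _ 1 "2 * pi"])
        (auto intro!: nn_integral_cong split: split_indicator)
  qed
  also have "(\<integral>\<^sup>+ t. K t * indicator {3 * pi / 2<..<2 * pi} t \<partial>lborel) + (\<integral>\<^sup>+ t. K t * indicator {0..<pi / 2} t \<partial>lborel)
      + (\<integral>\<^sup>+ t. K t * indicator {pi / 2<..<3 * pi / 2} t \<partial>lborel)
    = (\<integral>\<^sup>+ t. K t * indicator {3 * pi / 2<..<2 * pi} t + K t * indicator {0..<pi / 2} t + K t * indicator {pi / 2<..<3 * pi / 2} t \<partial>lborel)"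
    by (simp add: nn_integral_add)
  also have "\<dots> = (\<integral>\<^sup>+ t. K t * indicator {0..2 * pi} t \<partial>lborel)"
  proof (intro nn_integral_cong_AE)
    have "AE t in lborel. t \<noteq> pi / 2" "AE t in lborel. t \<noteq> 3 * pi / 2" "AE t in lborel. t \<noteq> 2 * pi"
      by (rule AE_lborel_singleton)+
    then show "AE t in lborel. K t * indicator {3 * pi / 2<..<2 * pi} t + K t * indicator {0..<pi / 2} t
        + K t * indicator {pi / 2<..<3 * pi / 2} t = K t * indicator {0..2 * pi} t"
      by eventually_elim (auto split: split_indicator)
  qed
  finally show ?thesis
    by (simp add: nn_integral_arc_measure K_def)
qed


lemma measurable_rcis [measurable (raw)]:
  assumes [measurable]: "f \<in> borel_measurable N" "g \<in> borel_measurable N"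
  shows "(\<lambda>x. rcis (f x) (g x)) \<in> borel_measurable N"
  unfolding rcis_def by measurable

lemma measurable_chord [measurable (raw)]:
  assumes [measurable]: "f \<in> borel_measurable N" "g \<in> borel_measurable N"
  shows "(\<lambda>x. chord (f x) (g x)) \<in> borel_measurable N"
  unfolding chord_def by measurable

section \<open>Approach regions in terms of the chordal distance\<close>

text \<open>A chord is no longer than its arc. The origin is set apart because its direction
  \<open>sgn z\<close> is 0.\<close>

lemma Gamma_region_upper:
  assumes "z \<in> Gamma_region (cis \<theta>)" "z \<noteq> 0"
  shows "cmod z < 1 \<and> cmod (sgn z - cis \<theta>) \<le> 1 - cmod z"
proof -
  obtain k :: int where k: "\<bar>Arg z - Arg (cis \<theta>) + 2 * pi * of_int k\<bar> < 1 - cmod z" and z: "cmod z < 1"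
    using assms(1) by (auto simp: Gamma_region_def)
  have "cis (Arg (cis \<theta>)) = cis \<theta>" by (simp add: cis_Arg sgn_eq)
  then have "cmod (sgn z - cis \<theta>) = chord (Arg z) (Arg (cis \<theta>))"
    using cis_Arg[OF assms(2)] by (simp add: chord_def)
  also have "\<dots> = chord (Arg z - 2 * pi * of_int (- k)) (Arg (cis \<theta>))" by (simp only: chord_periodic)
  also have "\<dots> \<le> \<bar>Arg z - 2 * pi * of_int (- k) - Arg (cis \<theta>)\<bar>" by (rule chord_le)
  also have "\<dots> \<le> 1 - cmod z" using k by (simp add: algebra_simps)
  finally show ?thesis using z by simp
qed

text \<open>The arc is at most twice the chord, so a quarter of \<open>1 - cmod z\<close> for the
  chord gives half of it for the arc, which leaves the strict inequality of the definition.\<close>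

lemma Gamma_region_lower:
  assumes "z \<noteq> 0" "cmod z < 1" "cmod (sgn z - cis \<theta>) \<le> (1 - cmod z) / 4"
  shows "z \<in> Gamma_region (cis \<theta>)"
proof -
  obtain k :: int where "Arg z - Arg (cis \<theta>) + pi - 2 * pi * of_int k \<in> {0..2 * pi}"
    by (rule exists_period_shift)
  then have k: "\<bar>(Arg z - 2 * pi * of_int k) - Arg (cis \<theta>)\<bar> \<le> pi" by auto
  have "cis (Arg (cis \<theta>)) = cis \<theta>" by (simp add: cis_Arg sgn_eq)
  then have "cmod (sgn z - cis \<theta>) = chord (Arg z - 2 * pi * of_int k) (Arg (cis \<theta>))"
    using cis_Arg[OF assms(1)] by (simp only: chord_periodic) (simp add: chord_def)
  then have "\<bar>(Arg z - 2 * pi * of_int k) - Arg (cis \<theta>)\<bar> \<le> (1 - cmod z) / 2"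
    using abs_le_two_chord[OF k] assms(3) by simp
  then have "\<bar>Arg z - Arg (cis \<theta>) + 2 * pi * of_int (- k)\<bar> < cmod (cis \<theta>) - cmod z"
    using assms(2) by (simp add: algebra_simps)
  then show ?thesis using assms(2) unfolding Gamma_region_def by (intro CollectI conjI exI[of _ "- k"]) auto
qed

section \<open>Borel representatives, and the quasinorms as iterated integrals\<close>

text \<open>A weight is only Lebesgue measurable on the plane, and its regularization may be
  infinite at the origin. A Borel function of the radius, equal to it almost everywhere in
  \<open>(0,1)\<close>, makes joint measurability and Tonelli's theorem available.\<close>

definition radial_rep :: "(complex \<Rightarrow> ennreal) \<Rightarrow> (real \<Rightarrow> ennreal) \<Rightarrow> bool" where
  "radial_rep \<nu> N \<longleftrightarrow> N \<in> borel_measurable borel \<and> (\<forall>z\<in>ball 0 1. \<nu> z = \<nu> (of_real (cmod z))) \<and>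
    (AE r in lborel. 0 < r \<and> r < 1 \<longrightarrow> \<nu> (of_real r) = N r)"

definition polar_weight :: "(real \<Rightarrow> ennreal) \<Rightarrow> real \<Rightarrow> ennreal" where
  "polar_weight N r = N r * ennreal r * indicator {0..<1} r"

text \<open>Extended by zero outside the disc, where \<open>f\<close> is arbitrary, so that for
  holomorphic \<open>f\<close> it is jointly Borel in radius and angle.\<close>

definition disc_powr :: "real \<Rightarrow> (complex \<Rightarrow> complex) \<Rightarrow> real \<Rightarrow> real \<Rightarrow> ennreal" where
  "disc_powr p f r t = ennreal (cmod (if rcis r t \<in> ball 0 1 then f (rcis r t) else 0) powr p)"

lemma disc_powr_eq: "\<bar>r\<bar> < 1 \<Longrightarrow> disc_powr p f r t = ennreal (cmod (f (rcis r t)) powr p)"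
  by (simp add: disc_powr_def)

lemma enn_powr_disc_powr: "enn_powr (disc_powr p f r t) a = disc_powr (p * a) f r t"
  by (simp add: disc_powr_def powr_powr)

lemma measurable_polar_weight [measurable]:
  assumes [measurable]: "N \<in> borel_measurable borel"
  shows "polar_weight N \<in> borel_measurable borel"
  unfolding polar_weight_def by measurable

lemma measurable_ball_restrict:
  assumes "f holomorphic_on ball 0 1"
  shows "(\<lambda>z. if z \<in> ball 0 1 then f z else 0) \<in> borel_measurable borel"
  by (intro borel_measurable_continuous_on_if holomorphic_on_imp_continuous_on assms) auto

lemma measurable_disc_powr:
  assumes f: "f holomorphic_on ball 0 1" and [measurable]: "g \<in> borel_measurable N" "h \<in> borel_measurable N"
  shows "(\<lambda>x. disc_powr p f (g x) (h x)) \<in> borel_measurable N"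
proof -
  note [measurable] = measurable_ball_restrict[OF f]
  have "(\<lambda>x. ennreal (cmod ((\<lambda>z. if z \<in> ball 0 1 then f z else 0) (rcis (g x) (h x))) powr p)) \<in> borel_measurable N"
    by measurable
  then show ?thesis by (simp add: disc_powr_def)
qed

lemma L_norm_rep:
  assumes rep: "radial_rep \<nu> N" and f: "f holomorphic_on ball 0 1"
  shows "L_norm q p \<nu> f = enn_powr (ennreal (1 / (2 * pi)) *
    (\<integral>\<^sup>+ t. enn_powr (\<integral>\<^sup>+ r. disc_powr p f r t * polar_weight N r \<partial>lborel) (q / p) \<partial>arc_measure)) (1 / q)"
proof -
  note [measurable (raw)] = measurable_disc_powr[OF f]
  have [measurable]: "N \<in> borel_measurable borel" using rep unfolding radial_rep_def by blast
  have inner: "(\<integral>\<^sup>+ r\<in>{0..<1}. ennreal (cmod (f (rcis r t)) powr p) * \<nu> (of_real r) * ennreal r \<partial>lebesgue)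
      = (\<integral>\<^sup>+ r. disc_powr p f r t * polar_weight N r \<partial>lborel)" for t
  proof -
    have "AE r in lborel. 0 < r \<and> r < 1 \<longrightarrow> \<nu> (of_real r) = N r" using rep unfolding radial_rep_def by blast
    then have "AE r in lborel. ennreal (cmod (f (rcis r t)) powr p) * \<nu> (of_real r) * ennreal r * indicator {0..<1} r
      = disc_powr p f r t * polar_weight N r"
    proof eventually_elim
      case (elim r)
      then show ?case
        by (cases "r = 0") (auto simp: polar_weight_def disc_powr_eq mult.assoc split: split_indicator)
    qed
    then show ?thesis unfolding nn_integral_completion by (rule nn_integral_cong_AE)
  qed
  have "(\<integral>\<^sup>+ \<theta>\<in>{0..2 * pi}. enn_powr (\<integral>\<^sup>+ r. disc_powr p f r \<theta> * polar_weight N r \<partial>lborel) (q / p) \<partial>lebesgue)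
    = (\<integral>\<^sup>+ t. enn_powr (\<integral>\<^sup>+ r. disc_powr p f r t * polar_weight N r \<partial>lborel) (q / p) \<partial>arc_measure)"
    unfolding nn_integral_completion by (intro nn_integral_arc_measure[symmetric]) measurable
  then show ?thesis unfolding L_norm_def inner by simp
qed

text \<open>By polar coordinates a null set of radii sweeps out a null set of the plane.\<close>

lemma radial_rep_AE:
  assumes "radial_rep \<nu> N"
  shows "AE z in lborel. cmod z < 1 \<longrightarrow> z \<noteq> 0 \<and> \<nu> z = N (cmod z)"
proof -
  have "AE r in lborel. 0 < r \<and> r < 1 \<longrightarrow> \<nu> (of_real r) = N r" using assms unfolding radial_rep_def by blast
  then obtain Z where Z: "{r \<in> space lborel. \<not> (0 < r \<and> r < 1 \<longrightarrow> \<nu> (of_real r) = N r)} \<subseteq> Z"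
    "emeasure lborel Z = 0" "Z \<in> sets lborel" by (rule AE_E)
  then have [measurable]: "Z \<in> sets borel" by simp
  have "(\<integral>\<^sup>+ z. indicator Z (cmod (z::complex)) \<partial>lborel) = 0"
  proof -
    have "(\<integral>\<^sup>+ z. indicator Z (cmod (z::complex)) \<partial>lborel) = (\<integral>\<^sup>+ t. \<integral>\<^sup>+ r. indicator Z (cmod (rcis r t)) * ennreal r \<partial>lborel \<partial>arc_measure)"
      by (intro nn_integral_polar) measurable
    also have "\<dots> = (\<integral>\<^sup>+ t. 0 \<partial>arc_measure)"
    proof (intro nn_integral_cong)
      fix t :: real
      have "AE r in lborel. r \<notin> Z" using Z by (intro AE_not_in) (auto simp: null_sets_def)
      then have "AE r in lborel. indicator Z (cmod (rcis r t)) * ennreal r = 0"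
        by eventually_elim (auto simp: ennreal_neg abs_if split: split_indicator)
      then show "(\<integral>\<^sup>+ r. indicator Z (cmod (rcis r t)) * ennreal r \<partial>lborel) = 0"
        by (subst nn_integral_0_iff_AE) auto
    qed
    finally show ?thesis by simp
  qed
  then have "AE z in lborel. indicator Z (cmod (z::complex)) = (0::ennreal)"
    by (subst (asm) nn_integral_0_iff_AE) auto
  moreover have "AE z in lborel. z \<noteq> (0::complex)" by (rule AE_lborel_singleton)
  ultimately show ?thesis
  proof eventually_elim
    case (elim z)
    show ?case
    proof
      assume "cmod z < 1"
      then have "\<nu> z = \<nu> (of_real (cmod z))"
        using assms \<open>cmod z < 1\<close> unfolding radial_rep_def by (meson mem_ball_0)
      moreover have "cmod z \<notin> Z" using elim(1) by (auto simp: indicator_def split: if_splits)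
      then have "\<nu> (of_real (cmod z)) = N (cmod z)"
        using subsetD[OF Z(1), of "cmod z"] elim(2) \<open>cmod z < 1\<close> by auto
      ultimately show "z \<noteq> 0 \<and> \<nu> z = N (cmod z)" using elim(2) by simp
    qed
  qed
qed

lemma nn_integral_area_measure: "(\<integral>\<^sup>+ z. G z \<partial>area_measure) = ennreal (1 / pi) * (\<integral>\<^sup>+ z. G z \<partial>lborel)"
  if "G \<in> borel_measurable borel"
  unfolding area_measure_def
  by (subst nn_integral_scale_measure) (use that in \<open>auto simp: nn_integral_completion intro: measurable_completion\<close>)

lemma AE_area_measure: "AE z in lborel. P z \<Longrightarrow> AE z in area_measure. P z"
proof -
  assume "AE z in lborel. P z"
  then obtain Z where "{z \<in> space lborel. \<not> P z} \<subseteq> Z" "emeasure lborel Z = 0" "Z \<in> sets lborel"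
    by (rule AE_E)
  then show "AE z in area_measure. P z"
    by (intro AE_I[of _ _ Z]) (auto simp: area_measure_def space_scale_measure)
qed

definition sector_integrand :: "real \<Rightarrow> (real \<Rightarrow> ennreal) \<Rightarrow> real \<Rightarrow> (complex \<Rightarrow> complex) \<Rightarrow> real \<Rightarrow> complex \<Rightarrow> ennreal" where
  "sector_integrand c N p f \<theta> z = (if cmod (z / of_real (cmod z) - cis \<theta>) \<le> c * (1 - cmod z) \<and> cmod z < 1
    then ennreal (cmod (if z \<in> ball 0 1 then f z else 0) powr p) * N (cmod z) / ennreal (1 - cmod z) else 0)"

text \<open>In polar coordinates \<open>1 / (1 - |z|)\<close> is, up to \<open>c\<close>, the
  normalization of an average over the chordal ball of radius \<open>c * (1 - r)\<close>. A tent
  integral is therefore a radial integral of arc averages.\<close>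

lemma nn_integral_sector_integrand:
  assumes [measurable]: "N \<in> borel_measurable borel" and f: "f holomorphic_on ball 0 1" and "0 < c"
  shows "(\<integral>\<^sup>+ z. sector_integrand c N p f \<theta> z \<partial>area_measure)
    = ennreal (c / pi) * (\<integral>\<^sup>+ r. circle.avg (c * (1 - r)) (disc_powr p f r) \<theta> * polar_weight N r \<partial>lborel)"
proof -
  interpret P: pair_sigma_finite lborel arc_measure ..
  note [measurable (raw)] = measurable_disc_powr[OF f]
  note [measurable] = measurable_ball_restrict[OF f]
  have [measurable]: "sector_integrand c N p f \<theta> \<in> borel_measurable borel"
    unfolding sector_integrand_def by measurable
  have *: "sector_integrand c N p f \<theta> (rcis r t) * ennreal r
    = (if chord \<theta> t \<le> c * (1 - r) then disc_powr p f r t else 0) * (polar_weight N r / ennreal (1 - r))" for r t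
  proof (cases "0 < r \<and> r < 1")
    case True
    then have "rcis r t / of_real (cmod (rcis r t)) = cis t" by (simp add: rcis_def norm_mult)
    moreover have "cmod (cis t - cis \<theta>) = chord \<theta> t" by (simp add: chord_def norm_minus_commute)
    ultimately show ?thesis using True
      by (simp add: sector_integrand_def disc_powr_eq polar_weight_def ennreal_times_divide[symmetric] mult_ac divide_ennreal_def)
  next
    case False
    then have "ennreal r = 0 \<or> 1 \<le> r" by (auto simp: ennreal_neg)
    then show ?thesis by (auto simp: polar_weight_def sector_integrand_def indicator_def)
  qed
  have "(\<integral>\<^sup>+ z. sector_integrand c N p f \<theta> z \<partial>area_measure)
    = ennreal (1 / pi) * (\<integral>\<^sup>+ t. \<integral>\<^sup>+ r. (if chord \<theta> t \<le> c * (1 - r) then disc_powr p f r t else 0) * (polar_weight N r / ennreal (1 - r)) \<partial>lborel \<partial>arc_measure)"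
    by (subst nn_integral_area_measure, measurable, subst nn_integral_polar, measurable, simp add: *)
  also have "(\<integral>\<^sup>+ t. \<integral>\<^sup>+ r. (if chord \<theta> t \<le> c * (1 - r) then disc_powr p f r t else 0) * (polar_weight N r / ennreal (1 - r)) \<partial>lborel \<partial>arc_measure)
    = (\<integral>\<^sup>+ r. \<integral>\<^sup>+ t. (if chord \<theta> t \<le> c * (1 - r) then disc_powr p f r t else 0) * (polar_weight N r / ennreal (1 - r)) \<partial>arc_measure \<partial>lborel)"
    by (intro P.Fubini') measurable
  also have "\<dots> = (\<integral>\<^sup>+ r. ennreal c * (circle.avg (c * (1 - r)) (disc_powr p f r) \<theta> * polar_weight N r) \<partial>lborel)"
  proof (intro nn_integral_cong)
    fix r :: real
    show "(\<integral>\<^sup>+ t. (if chord \<theta> t \<le> c * (1 - r) then disc_powr p f r t else 0) * (polar_weight N r / ennreal (1 - r)) \<partial>arc_measure)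
      = ennreal c * (circle.avg (c * (1 - r)) (disc_powr p f r) \<theta> * polar_weight N r)"
    proof (cases "0 \<le> r \<and> r < 1")
      case True
      then have "inverse (ennreal (1 - r)) = ennreal c * ennreal (1 / (c * (1 - r)))"
        using \<open>0 < c\<close> by (simp add: inverse_ennreal ennreal_mult[symmetric] divide_inverse)
      then show ?thesis
        by (subst nn_integral_multc) (measurable, simp add: circle.avg_def divide_ennreal_def mult_ac)
    next
      case False
      then have "polar_weight N r = 0" by (auto simp: polar_weight_def)
      then show ?thesis by simp
    qed
  qed
  also have "\<dots> = ennreal c * (\<integral>\<^sup>+ r. circle.avg (c * (1 - r)) (disc_powr p f r) \<theta> * polar_weight N r \<partial>lborel)"
    by (intro nn_integral_cmult) measurable
  finally show ?thesis using \<open>0 < c\<close> by (simp add: mult.assoc[symmetric] ennreal_mult[symmetric])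
qed

lemma
  assumes rep: "radial_rep \<nu> N" and f: "f holomorphic_on ball 0 1" and pq: "0 < p" "0 < q"
  shows T_norm_le: "T_norm q p \<nu> f \<le> enn_powr (\<integral>\<^sup>+ t. enn_powr (ennreal (1 / pi) *
      (\<integral>\<^sup>+ r. circle.avg (1 - r) (disc_powr p f r) t * polar_weight N r \<partial>lborel)) (q / p) \<partial>arc_measure) (1 / q)"
    and T_norm_ge: "enn_powr (\<integral>\<^sup>+ t. enn_powr (ennreal (1 / (4 * pi)) *
      (\<integral>\<^sup>+ r. circle.avg ((1 - r) / 4) (disc_powr p f r) t * polar_weight N r \<partial>lborel)) (q / p) \<partial>arc_measure) (1 / q)
      \<le> T_norm q p \<nu> f"
proof -
  note [measurable (raw)] = measurable_disc_powr[OF f]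
  have N[measurable]: "N \<in> borel_measurable borel" using rep unfolding radial_rep_def by blast
  let ?I = "\<lambda>\<theta>. \<integral>\<^sup>+ z\<in>Gamma_region (cis \<theta>). ennreal (cmod (f z) powr p) * \<nu> z / ennreal (1 - cmod z) \<partial>area_measure"
  have ae: "AE z in area_measure. cmod z < 1 \<longrightarrow> z \<noteq> 0 \<and> \<nu> z = N (cmod z)"
    by (intro AE_area_measure radial_rep_AE rep)
  have sgn: "sgn z = z / of_real (cmod z)" for z :: complex by (simp add: sgn_eq)
  have upper: "?I \<theta> \<le> ennreal (1 / pi) * (\<integral>\<^sup>+ r. circle.avg (1 - r) (disc_powr p f r) \<theta> * polar_weight N r \<partial>lborel)" for \<theta>
  proof -
    have "?I \<theta> \<le> (\<integral>\<^sup>+ z. sector_integrand 1 N p f \<theta> z \<partial>area_measure)"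
    proof (intro nn_integral_mono_AE, use ae in eventually_elim)
      case (elim z)
      show ?case
      proof (cases "z \<in> Gamma_region (cis \<theta>)")
        case True
        then have "cmod z < 1" by (auto simp: Gamma_region_def)
        with elim have "z \<noteq> 0" "\<nu> z = N (cmod z)" by auto
        with Gamma_region_upper[OF True] show ?thesis
          by (simp add: sector_integrand_def sgn True)
      qed simp
    qed
    then show ?thesis using nn_integral_sector_integrand[OF N f, of 1] by simp
  qed
  have lower: "ennreal (1 / (4 * pi)) * (\<integral>\<^sup>+ r. circle.avg ((1 - r) / 4) (disc_powr p f r) \<theta> * polar_weight N r \<partial>lborel) \<le> ?I \<theta>" for \<theta>
  proof -
    have "(\<integral>\<^sup>+ z. sector_integrand (1/4) N p f \<theta> z \<partial>area_measure) \<le> ?I \<theta>"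
    proof (intro nn_integral_mono_AE, use ae in eventually_elim)
      case (elim z)
      show ?case
      proof (cases "cmod (sgn z - cis \<theta>) \<le> 1/4 * (1 - cmod z) \<and> cmod z < 1")
        case True
        with elim have "z \<noteq> 0" "\<nu> z = N (cmod z)" by auto
        then have "z \<in> Gamma_region (cis \<theta>)" using True by (intro Gamma_region_lower) auto
        then show ?thesis using True \<open>\<nu> z = N (cmod z)\<close>
          by (simp add: sector_integrand_def sgn)
      next
        case False
        then have "sector_integrand (1/4) N p f \<theta> z = 0"
          unfolding sector_integrand_def sgn by (rule if_not_P)
        then show ?thesis by simp
      qed
    qed
    then show ?thesis using nn_integral_sector_integrand[OF N f, of "1/4"] by simp
  qed
  show "T_norm q p \<nu> f \<le> enn_powr (\<integral>\<^sup>+ t. enn_powr (ennreal (1 / pi) *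
      (\<integral>\<^sup>+ r. circle.avg (1 - r) (disc_powr p f r) t * polar_weight N r \<partial>lborel)) (q / p) \<partial>arc_measure) (1 / q)"
    unfolding T_norm_def nn_integral_completion
    by (subst nn_integral_arc_measure, measurable)
      (intro enn_powr_mono nn_integral_mono mult_right_mono upper, use pq in auto)
  show "enn_powr (\<integral>\<^sup>+ t. enn_powr (ennreal (1 / (4 * pi)) *
      (\<integral>\<^sup>+ r. circle.avg ((1 - r) / 4) (disc_powr p f r) t * polar_weight N r \<partial>lborel)) (q / p) \<partial>arc_measure) (1 / q)
      \<le> T_norm q p \<nu> f"
    unfolding T_norm_def nn_integral_completion
    by (subst nn_integral_arc_measure, measurable)
      (intro enn_powr_mono nn_integral_mono mult_right_mono lower, use pq in auto)
qed

section \<open>Transfer between weights comparable on dyadic shells\<close>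

text \<open>The constant of the finite inequality does not depend on \<open>N\<close>, so monotone
  convergence applies.\<close>

lemma (in ball_growth) vector_avg_powr_bound_suminf:
  fixes R :: "'b measure"
  assumes "0 < s" and R: "sigma_finite_measure R"
  obtains C where "0 \<le> C" "\<And>t w g. decseq t \<Longrightarrow> (\<And>n. 0 < t n) \<Longrightarrow>
    (\<And>n. w n \<in> borel_measurable R) \<Longrightarrow> (\<lambda>(r, y). g r y) \<in> borel_measurable (R \<Otimes>\<^sub>M M) \<Longrightarrow>
    (\<integral>\<^sup>+ x. enn_powr (\<Sum>n. \<integral>\<^sup>+ r. enn_powr (avg (t n) (g r) x) (avg_exponent s) * w n r \<partial>R) s \<partial>M)
      \<le> ennreal C * (\<integral>\<^sup>+ x. enn_powr (\<Sum>n. \<integral>\<^sup>+ r. enn_powr (g r x) (avg_exponent s) * w n r \<partial>R) s \<partial>M)"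
proof -
  interpret R: sigma_finite_measure R by fact
  obtain C where C: "0 \<le> C" "\<And>t w g N. decseq t \<Longrightarrow> (\<And>n. 0 < t n) \<Longrightarrow>
    (\<And>n. w n \<in> borel_measurable R) \<Longrightarrow> (\<lambda>(r, y). g r y) \<in> borel_measurable (R \<Otimes>\<^sub>M M) \<Longrightarrow>
    (\<integral>\<^sup>+ x. enn_powr (\<Sum>n<N. \<integral>\<^sup>+ r. enn_powr (avg (t n) (g r) x) (avg_exponent s) * w n r \<partial>R) s \<partial>M)
      \<le> ennreal C * (\<integral>\<^sup>+ x. enn_powr (\<Sum>n<N. \<integral>\<^sup>+ r. enn_powr (g r x) (avg_exponent s) * w n r \<partial>R) s \<partial>M)"
    using vector_avg_powr_bound[OF assms] by blast
  show thesis
  proof (rule that[OF C(1)])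
    fix t :: "nat \<Rightarrow> real" and w :: "nat \<Rightarrow> 'b \<Rightarrow> ennreal" and g :: "'b \<Rightarrow> 'a \<Rightarrow> ennreal"
    assume dec: "decseq t" and pos: "\<And>n. 0 < t n" and w[measurable]: "\<And>n. w n \<in> borel_measurable R"
      and g[measurable]: "(\<lambda>(r, y). g r y) \<in> borel_measurable (R \<Otimes>\<^sub>M M)"
    have [measurable]: "(\<lambda>(y, r). g r y) \<in> borel_measurable (M \<Otimes>\<^sub>M R)"
      by (simp add: measurable_split_conv) measurable
    define W where "W n x = (\<integral>\<^sup>+ r. enn_powr (avg (t n) (g r) x) (avg_exponent s) * w n r \<partial>R)" for n x
    define H where "H n x = (\<integral>\<^sup>+ r. enn_powr (g r x) (avg_exponent s) * w n r \<partial>R)" for n x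
    have [measurable]: "W n \<in> borel_measurable M" for n unfolding W_def by measurable
    have "(\<integral>\<^sup>+ x. enn_powr (\<Sum>n. W n x) s \<partial>M) = (\<integral>\<^sup>+ x. (SUP N. enn_powr (\<Sum>n<N. W n x) s) \<partial>M)"
      using \<open>0 < s\<close> by (simp add: suminf_eq_SUP enn_powr_SUP)
    also have "\<dots> = (SUP N. \<integral>\<^sup>+ x. enn_powr (\<Sum>n<N. W n x) s \<partial>M)"
      using \<open>0 < s\<close> by (intro nn_integral_monotone_convergence_SUP)
        (auto intro!: incseq_SucI le_funI enn_powr_mono)
    also have "\<dots> \<le> ennreal C * (\<integral>\<^sup>+ x. enn_powr (\<Sum>n. H n x) s \<partial>M)"
    proof (rule SUP_least)
      fix N
      have "(\<integral>\<^sup>+ x. enn_powr (\<Sum>n<N. W n x) s \<partial>M) \<le> ennreal C * (\<integral>\<^sup>+ x. enn_powr (\<Sum>n<N. H n x) s \<partial>M)"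
        unfolding W_def H_def by (intro C(2) dec pos) measurable
      also have "\<dots> \<le> ennreal C * (\<integral>\<^sup>+ x. enn_powr (\<Sum>n. H n x) s \<partial>M)"
        using \<open>0 < s\<close> by (intro mult_left_mono nn_integral_mono enn_powr_mono sum_le_suminf) auto
      finally show "(\<integral>\<^sup>+ x. enn_powr (\<Sum>n<N. W n x) s \<partial>M) \<le> ennreal C * (\<integral>\<^sup>+ x. enn_powr (\<Sum>n. H n x) s \<partial>M)" .
    qed
    finally show "(\<integral>\<^sup>+ x. enn_powr (\<Sum>n. \<integral>\<^sup>+ r. enn_powr (avg (t n) (g r) x) (avg_exponent s) * w n r \<partial>R) s \<partial>M)
      \<le> ennreal C * (\<integral>\<^sup>+ x. enn_powr (\<Sum>n. \<integral>\<^sup>+ r. enn_powr (g r x) (avg_exponent s) * w n r \<partial>R) s \<partial>M)"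
      by (simp add: W_def H_def)
  qed
qed

section \<open>The Poisson kernel as a superposition of arc averages\<close>

text \<open>The distance \<open>D\<close> of the two points dominates a multiple of
  \<open>t\<close>, through the gap between the radii, and also
  \<open>chord \<theta> \<psi> - 3 * t\<close>. With \<open>j\<close> the first scale that reaches
  \<open>\<psi>\<close> this gives \<open>2^j * t <= A * D\<close>, so the kernel, at most
  \<open>2 * t / D^2\<close>, is bounded by the single term of index \<open>j\<close>. The centre
  \<open>\<theta>\<close> may differ from \<open>\<phi>\<close> by \<open>t\<close>, which is what
  tents require.\<close>

lemma poisson_kernel_bound:
  assumes "1 \<le> \<Lambda>" "0 < t" "t \<le> 1" and r: "1 - t \<le> r" and gap: "t / (2 * \<Lambda>) \<le> \<rho> - r" and "\<rho> < 1"
    and chord: "chord \<theta> \<phi> \<le> t"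
  shows "ennreal ((\<rho>\<^sup>2 - r\<^sup>2) / (cmod (rcis \<rho> \<psi> - rcis r \<phi>))\<^sup>2)
    \<le> ennreal (2 * (2 * (6 * \<Lambda> + 1))\<^sup>2) * (\<Sum>j. ennreal ((1/2) ^ j) * (ennreal (1 / (2 ^ j * t)) * (if chord \<theta> \<psi> \<le> 2 ^ j * t then 1 else 0)))"
proof -
  define D where "D = cmod (rcis \<rho> \<psi> - rcis r \<phi>)"
  \<comment> \<open>\<open>chord <= 3 * t + D\<close> and \<open>t <= 2 * \<Lambda> * D\<close> give
    \<open>6 * \<Lambda> + 1\<close>; the factor 2 pays for the dyadic choice of
    \<open>j\<close>.\<close>
  define A where "A = 2 * (6 * \<Lambda> + 1)"
  have "A > 0" using assms by (simp add: A_def)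
  have r0: "0 \<le> r" "r < \<rho>" "0 < \<rho>"
    using assms divide_pos_pos[of t "2 * \<Lambda>"] by linarith+
  have D1: "\<rho> - r \<le> D"
    using norm_triangle_ineq2[of "rcis \<rho> \<psi>" "rcis r \<phi>"] r0 by (simp add: D_def)
  have tD: "t \<le> 2 * \<Lambda> * D"
  proof -
    have "t / (2 * \<Lambda>) \<le> D" using D1 gap by linarith
    then show ?thesis using assms by (simp add: field_simps)
  qed
  \<comment> \<open>The route runs through the two points inside the disc; each of
    \<open>1 - r\<close>, \<open>1 - \<rho>\<close> and \<open>chord \<theta> \<phi>\<close> costs
    at most \<open>t\<close>.\<close>
  have "chord \<theta> \<psi> \<le> 3 * t + D"
  proof -
    have "cis \<theta> - cis \<psi> = (cis \<theta> - cis \<phi>) + ((cis \<phi> - rcis r \<phi>) + ((rcis r \<phi> - rcis \<rho> \<psi>) + (rcis \<rho> \<psi> - cis \<psi>)))"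
      by simp
    then have "chord \<theta> \<psi> \<le> cmod (cis \<theta> - cis \<phi>) + (cmod (cis \<phi> - rcis r \<phi>) + (cmod (rcis r \<phi> - rcis \<rho> \<psi>) + cmod (rcis \<rho> \<psi> - cis \<psi>)))"
      unfolding chord_def by (simp only:) (intro norm_triangle_mono order_refl)
    moreover have "cis \<phi> - rcis r \<phi> = of_real (1 - r) * cis \<phi>" "rcis \<rho> \<psi> - cis \<psi> = of_real (\<rho> - 1) * cis \<psi>"
      by (simp_all add: rcis_def algebra_simps)
    then have "cmod (cis \<phi> - rcis r \<phi>) = 1 - r" "cmod (rcis \<rho> \<psi> - cis \<psi>) = 1 - \<rho>"
      using r0 \<open>\<rho> < 1\<close> by (simp_all add: norm_mult del: of_real_diff)
    ultimately show ?thesis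
      using r0 r chord by (simp add: D_def chord_def norm_minus_commute[of "rcis r \<phi>"])
  qed
  then have cD: "2 * chord \<theta> \<psi> \<le> A * D" using tD by (simp add: A_def algebra_simps)
  have "2 * \<Lambda> * D \<le> A * D"
    using \<open>1 \<le> \<Lambda>\<close> D1 r0 by (intro mult_right_mono) (auto simp: A_def)
  then have "t \<le> A * D" using tD by simp
  obtain n where "chord \<theta> \<psi> / t < 2 ^ n" using real_arch_pow[of 2] by auto
  then have ex: "\<exists>n. chord \<theta> \<psi> \<le> 2 ^ n * t" using assms by (intro exI[of _ n]) (simp add: field_simps)
  define j where "j = (LEAST n. chord \<theta> \<psi> \<le> 2 ^ n * t)"
  have j: "chord \<theta> \<psi> \<le> 2 ^ j * t" unfolding j_def by (rule LeastI_ex[OF ex])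
  have jD: "2 ^ j * t \<le> A * D"
  proof (cases j)
    case 0 then show ?thesis using \<open>t \<le> A * D\<close> by simp
  next
    case (Suc m)
    then have "\<not> chord \<theta> \<psi> \<le> 2 ^ m * t"
      unfolding j_def by (intro not_less_Least) auto
    then show ?thesis using cD Suc by simp
  qed
  have "0 < D" using D1 r0 by simp
  have "(\<rho>\<^sup>2 - r\<^sup>2) / D\<^sup>2 \<le> 2 * A\<^sup>2 * ((1/2) ^ j * (1 / (2 ^ j * t)))"
  proof -
    have "\<rho>\<^sup>2 - r\<^sup>2 = (\<rho> - r) * (\<rho> + r)" by (simp add: power2_eq_square algebra_simps)
    also have "\<dots> \<le> t * 2" using r0 r \<open>\<rho> < 1\<close> by (intro mult_mono) auto
    finally have 1: "\<rho>\<^sup>2 - r\<^sup>2 \<le> t * 2" .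
    have 2: "(2 ^ j * t)\<^sup>2 \<le> (A * D)\<^sup>2" using jD assms by (intro power_mono) auto
    have "(\<rho>\<^sup>2 - r\<^sup>2) * (2 ^ j * t)\<^sup>2 \<le> (t * 2) * (A * D)\<^sup>2"
      using 1 2 assms by (intro mult_mono) auto
    then have "(\<rho>\<^sup>2 - r\<^sup>2) * (2 ^ j * (2 ^ j * t)) * t \<le> (2 * A\<^sup>2 * D\<^sup>2) * t"
      by (simp add: power2_eq_square algebra_simps)
    then have "(\<rho>\<^sup>2 - r\<^sup>2) * (2 ^ j * (2 ^ j * t)) \<le> 2 * A\<^sup>2 * D\<^sup>2"
      using \<open>0 < t\<close> by (rule mult_right_le_imp_le)
    then have "(\<rho>\<^sup>2 - r\<^sup>2) / D\<^sup>2 \<le> 2 * A\<^sup>2 / (2 ^ j * (2 ^ j * t))"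
      using \<open>0 < D\<close> \<open>0 < t\<close> by (simp add: field_simps)
    then show ?thesis by (simp add: power_one_over)
  qed
  then have "ennreal ((\<rho>\<^sup>2 - r\<^sup>2) / D\<^sup>2) \<le> ennreal (2 * A\<^sup>2 * ((1/2) ^ j * (1 / (2 ^ j * t))))"
    by (rule ennreal_leI)
  also have "\<dots> = ennreal (2 * A\<^sup>2) * (ennreal ((1/2) ^ j) * (ennreal (1 / (2 ^ j * t)) * (if chord \<theta> \<psi> \<le> 2 ^ j * t then 1 else 0)))"
    using j \<open>0 < t\<close> by (subst ennreal_mult, simp, simp, subst ennreal_mult) auto
  also have "\<dots> \<le> ennreal (2 * A\<^sup>2) * (\<Sum>j. ennreal ((1/2) ^ j) * (ennreal (1 / (2 ^ j * t)) * (if chord \<theta> \<psi> \<le> 2 ^ j * t then 1 else 0)))"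
    by (intro mult_left_mono order_trans[OF _ sum_le_suminf[of _ "{j}"]]) auto
  finally show ?thesis by (simp add: D_def A_def)
qed

lemma disc_powr_le_avg:
  assumes f: "f holomorphic_on ball 0 1" and "0 < a"
    and "1 \<le> \<Lambda>" "0 < t" "t \<le> 1" and r: "1 - t \<le> r" and gap: "t / (2 * \<Lambda>) \<le> \<rho> - r" and "\<rho> < 1"
    and chord: "chord \<theta> \<phi> \<le> t" and nz: "\<And>w. cmod w = \<rho> \<Longrightarrow> f w \<noteq> 0"
  shows "disc_powr a f r \<phi> \<le> ennreal (2 * (2 * (6 * \<Lambda> + 1))\<^sup>2) * (\<Sum>j. ennreal ((1/2) ^ j) * circle.avg (2 ^ j * t) (disc_powr a f \<rho>) \<theta>)"
proof -
  note [measurable (raw)] = measurable_disc_powr[OF f]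
  define A where "A = 2 * (2 * (6 * \<Lambda> + 1))\<^sup>2"
  have "A \<ge> 0" by (simp add: A_def)
  have r0: "0 \<le> r" "r < \<rho>" "0 < \<rho>"
    using assms divide_pos_pos[of t "2 * \<Lambda>"] by linarith+
  let ?k = "\<lambda>j \<psi>. ennreal (1 / (2 ^ j * t)) * (if chord \<theta> \<psi> \<le> 2 ^ j * t then 1 else 0)"
  have "disc_powr a f r \<phi> = ennreal (cmod (f (rcis r \<phi>)) powr a)"
    using r0 \<open>\<rho> < 1\<close> by (simp add: disc_powr_eq)
  also have "\<dots> \<le> ennreal (1 / (2 * pi)) *
    (\<integral>\<^sup>+ \<psi>\<in>{0..2 * pi}. ennreal (cmod (f (rcis \<rho> \<psi>)) powr a * ((\<rho>\<^sup>2 - (cmod (rcis r \<phi>))\<^sup>2) / (cmod (rcis \<rho> \<psi> - rcis r \<phi>))\<^sup>2)) \<partial>lborel)"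
    using r0 assms by (intro poisson_submean[OF f]) auto
  also have "\<dots> \<le> 1 * (\<integral>\<^sup>+ \<psi>\<in>{0..2 * pi}. disc_powr a f \<rho> \<psi> * (ennreal A * (\<Sum>j. ennreal ((1/2) ^ j) * ?k j \<psi>)) \<partial>lborel)"
  proof (intro mult_mono nn_integral_mono mult_right_mono)
    show "ennreal (1 / (2 * pi)) \<le> 1" using pi_gt3 by (simp add: ennreal_le_1)
    fix \<psi>
    have "0 \<le> (\<rho>\<^sup>2 - r\<^sup>2) / (cmod (rcis \<rho> \<psi> - rcis r \<phi>))\<^sup>2"
      using r0 by (intro divide_nonneg_nonneg) (auto intro: power_mono)
    then have "ennreal (cmod (f (rcis \<rho> \<psi>)) powr a * ((\<rho>\<^sup>2 - (cmod (rcis r \<phi>))\<^sup>2) / (cmod (rcis \<rho> \<psi> - rcis r \<phi>))\<^sup>2))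
      = disc_powr a f \<rho> \<psi> * ennreal ((\<rho>\<^sup>2 - r\<^sup>2) / (cmod (rcis \<rho> \<psi> - rcis r \<phi>))\<^sup>2)"
      using r0 \<open>\<rho> < 1\<close> by (subst ennreal_mult) (auto simp: disc_powr_eq)
    also have "\<dots> \<le> disc_powr a f \<rho> \<psi> * (ennreal A * (\<Sum>j. ennreal ((1/2) ^ j) * ?k j \<psi>))"
      unfolding A_def using assms by (intro mult_left_mono poisson_kernel_bound) auto
    finally show "ennreal (cmod (f (rcis \<rho> \<psi>)) powr a * ((\<rho>\<^sup>2 - (cmod (rcis r \<phi>))\<^sup>2) / (cmod (rcis \<rho> \<psi> - rcis r \<phi>))\<^sup>2))
      \<le> disc_powr a f \<rho> \<psi> * (ennreal A * (\<Sum>j. ennreal ((1/2) ^ j) * ?k j \<psi>))" .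
  qed auto
  also have "\<dots> = (\<integral>\<^sup>+ \<psi>. disc_powr a f \<rho> \<psi> * (ennreal A * (\<Sum>j. ennreal ((1/2) ^ j) * ?k j \<psi>)) \<partial>arc_measure)"
    by (subst nn_integral_arc_measure) auto
  also have "\<dots> = (\<integral>\<^sup>+ \<psi>. ennreal A * (\<Sum>j. ennreal ((1/2) ^ j) * (ennreal (1 / (2 ^ j * t)) * (if chord \<theta> \<psi> \<le> 2 ^ j * t then disc_powr a f \<rho> \<psi> else 0))) \<partial>arc_measure)"
  proof (intro nn_integral_cong)
    fix \<psi>
    have "disc_powr a f \<rho> \<psi> * (\<Sum>j. ennreal ((1/2) ^ j) * ?k j \<psi>) = (\<Sum>j. disc_powr a f \<rho> \<psi> * (ennreal ((1/2) ^ j) * ?k j \<psi>))"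
      by (rule ennreal_suminf_cmult[symmetric])
    also have "\<dots> = (\<Sum>j. ennreal ((1/2) ^ j) * (ennreal (1 / (2 ^ j * t)) * (if chord \<theta> \<psi> \<le> 2 ^ j * t then disc_powr a f \<rho> \<psi> else 0)))"
      by (intro suminf_cong) (auto simp: mult_ac)
    finally show "disc_powr a f \<rho> \<psi> * (ennreal A * (\<Sum>j. ennreal ((1/2) ^ j) * ?k j \<psi>))
      = ennreal A * (\<Sum>j. ennreal ((1/2) ^ j) * (ennreal (1 / (2 ^ j * t)) * (if chord \<theta> \<psi> \<le> 2 ^ j * t then disc_powr a f \<rho> \<psi> else 0)))"
      by (simp only: mult.left_commute)
  qed
  also have "\<dots> = ennreal A * (\<Sum>j. ennreal ((1/2) ^ j) * (ennreal (1 / (2 ^ j * t)) * (\<integral>\<^sup>+ \<psi>. (if chord \<theta> \<psi> \<le> 2 ^ j * t then disc_powr a f \<rho> \<psi> else 0) \<partial>arc_measure)))"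
    by (subst nn_integral_cmult, measurable, subst nn_integral_suminf, measurable, subst nn_integral_cmult, measurable,
        subst nn_integral_cmult, measurable)
  finally show ?thesis unfolding A_def circle.avg_def .
qed

section \<open>Shells and the transfer inequality\<close>

text \<open>\<open>t k\<close> is the distance of the inner edge from the unit circle.\<close>

definition shell :: "(nat \<Rightarrow> real) \<Rightarrow> nat \<Rightarrow> real set" where
  "shell t k = {1 - t k..<1 - t (Suc k)}"

lemma shell_borel [measurable, simp]: "shell t k \<in> sets borel"
  by (simp add: shell_def)

lemma suminf_shell_le:
  assumes "decseq t"
  shows "(\<Sum>k. indicator (shell t (k + m)) r) \<le> (1::ennreal)"
proof -
  have "(\<Sum>k<n. indicator (shell t (k + m)) r) = (indicator {1 - t m..<1 - t (n + m)} r :: ennreal)" for n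
  proof (induction n)
    case (Suc n)
    have "t (n + m) \<le> t m" "t (Suc (n + m)) \<le> t (n + m)"
      using assms by (auto simp: decseq_def)
    then show ?case using Suc by (auto simp: shell_def split: split_indicator)
  qed simp
  then have "(\<Sum>k<n. indicator (shell t (k + m)) r) \<le> (1::ennreal)" for n by (simp add: indicator_def)
  then show ?thesis by (simp add: suminf_eq_SUP SUP_le_iff)
qed

lemma exists_shell:
  assumes "t \<longlonglongrightarrow> 0" "t 0 = 1" "0 \<le> r" "r < 1"
  obtains k where "r \<in> shell t k"
proof -
  have "\<forall>\<^sub>F n in sequentially. t n < 1 - r"
    using assms by (intro order_tendstoD(2)[OF assms(1)]) auto
  then have ex: "\<exists>n. r < 1 - t n" by (auto simp: eventually_sequentially algebra_simps)
  define n where "n = (LEAST n. r < 1 - t n)"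
  have n: "r < 1 - t n" unfolding n_def by (rule LeastI_ex[OF ex])
  then obtain k where k: "n = Suc k" using assms by (cases n) auto
  have "\<not> r < 1 - t k" using k unfolding n_def by (intro not_less_Least) auto
  then have "r \<in> shell t k" using n k by (auto simp: shell_def)
  then show thesis by (rule that)
qed


lemma suminf_swap_ennreal:
  fixes f :: "nat \<Rightarrow> nat \<Rightarrow> ennreal"
  shows "(\<Sum>i. \<Sum>j. f i j) = (\<Sum>j. \<Sum>i. f i j)"
proof -
  have "(\<Sum>i. \<Sum>j. f i j) = (\<integral>\<^sup>+ i. (\<Sum>j. f i j) \<partial>count_space UNIV)"
    by (simp add: nn_integral_count_space_nat)
  also have "\<dots> = (\<Sum>j. \<integral>\<^sup>+ i. f i j \<partial>count_space UNIV)"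
    by (intro nn_integral_suminf) auto
  finally show ?thesis by (simp add: nn_integral_count_space_nat)
qed

text \<open>
  The weight \<open>w\<close> may vanish on most of each shell, so \<open>f\<close> is estimated on the \<open>k\<close>-th shell by its
  values on every single circle \<open>cmod z = \<rho>\<close> of the shell \<open>k + 2\<close>, using the Poisson kernel, and
  the estimate is then averaged over \<open>\<rho>\<close> with respect to \<open>w\<close>. Subharmonicity is used for the power
  \<open>p / avg_exponent s\<close> in order to make \<open>vector_avg_powr_bound_suminf\<close> applicable.
\<close>
lemma shell_transfer:
  fixes t :: "nat \<Rightarrow> real" and w w' :: "real \<Rightarrow> ennreal"
  assumes "0 < p" "0 < s" "0 \<le> B" "0 \<le> E" "1 \<le> \<Lambda>"
    and t: "t 0 = 1" "\<And>k. 0 < t k" "\<And>k. t (Suc k) \<le> t k / 2" "\<And>k. t k \<le> \<Lambda> * t (Suc k)"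
    and w[measurable]: "w \<in> borel_measurable borel" and w'[measurable]: "w' \<in> borel_measurable borel"
    and w'0: "\<And>r. r \<notin> {0..<1} \<Longrightarrow> w' r = 0"
    and mass: "\<And>k. (\<integral>\<^sup>+ r. w' r * indicator (shell t k) r \<partial>lborel) \<le> ennreal B * (\<integral>\<^sup>+ r. w r * indicator (shell t (k + 2)) r \<partial>lborel)"
    and fin: "\<And>k. (\<integral>\<^sup>+ r. w r * indicator (shell t (k + 2)) r \<partial>lborel) < top"
  obtains C where "0 \<le> C" "\<And>f g U. f holomorphic_on ball 0 1 \<Longrightarrow>
    (\<lambda>(r, x). g r x) \<in> borel_measurable (lborel \<Otimes>\<^sub>M arc_measure) \<Longrightarrow> (\<And>x. (\<lambda>r. U r x) \<in> borel_measurable borel) \<Longrightarrow>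
    (\<And>\<rho> T x. 0 \<le> \<rho> \<Longrightarrow> \<rho> < 1 \<Longrightarrow> 1 - \<rho> \<le> T \<Longrightarrow>
      circle.avg T (disc_powr (p / avg_exponent s) f \<rho>) x \<le> ennreal E * circle.avg (2 * T) (g \<rho>) x) \<Longrightarrow>
    (\<And>r x X. 0 \<le> r \<Longrightarrow> r < 1 \<Longrightarrow> (\<And>y. chord x y \<le> 1 - r \<Longrightarrow> disc_powr p f r y \<le> X) \<Longrightarrow> U r x \<le> ennreal E * X) \<Longrightarrow>
    (\<integral>\<^sup>+ x. enn_powr (\<integral>\<^sup>+ r. U r x * w' r \<partial>lborel) s \<partial>arc_measure)
      \<le> ennreal C * (\<integral>\<^sup>+ x. enn_powr (\<integral>\<^sup>+ r. enn_powr (g r x) (avg_exponent s) * w r \<partial>lborel) s \<partial>arc_measure)"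
proof -
  define b where "b = avg_exponent s"
  have b: "1 \<le> b" using \<open>0 < s\<close> by (simp add: b_def avg_exponent_ge_1)
  define A where "A = 2 * (2 * (6 * \<Lambda> + 1))\<^sup>2"
  have "0 \<le> A" by (simp add: A_def)
  \<comment> \<open>Each use of \<open>enn_powr_suminf_le\<close> costs a square root of the ratio:
    \<open>1/2 = l^2\<close>, then \<open>l powr b = l2^2\<close> after the power \<open>b\<close>,
    then \<open>\<sigma>\<close> after the power \<open>s\<close>.\<close>
  define l where "l = sqrt (1 / 2)"
  have l: "0 < l" "l < 1" "l\<^sup>2 = 1 / 2" by (auto simp: l_def)
  define l2 where "l2 = l powr (b / 2)"
  have l2: "0 < l2" "l2 < 1" "l2\<^sup>2 = l powr b"
    using l b powr_less_mono2[of "b / 2" l 1] by (auto simp: l2_def powr_powr power2_eq_square powr_add[symmetric])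
  define \<sigma> where "\<sigma> = l2 powr s"
  have \<sigma>: "0 < \<sigma>" "\<sigma> < 1" using l2 \<open>0 < s\<close> powr_less_mono2[of s l2 1] by (auto simp: \<sigma>_def)
  define K where "K = E * ((A * E) powr b * (1 / (1 - l)) powr b)"
  have "0 \<le> K" using \<open>0 \<le> E\<close> by (simp add: K_def)
  have dec: "decseq t" using t(2,3) by (intro decseq_SucI) (smt (verit) field_sum_of_halves)
  have tn: "t n \<le> (1/2) ^ n" for n
  proof (induction n)
    case (Suc n) then show ?case using t(3)[of n] by simp
  qed (simp add: t)
  have "(\<lambda>n. (1/2) ^ n :: real) \<longlonglongrightarrow> 0" by (rule LIMSEQ_power_zero) simp
  then have t_lim: "t \<longlonglongrightarrow> 0"
    by (rule tendsto_sandwich[OF _ _ tendsto_const, rotated 2]) (auto intro!: always_eventually tn less_imp_le t(2))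
  have t1: "t k \<le> 1" for k using dec t(1) by (metis decseqD le0)
  obtain D where D: "0 \<le> D" "\<And>t w g. decseq t \<Longrightarrow> (\<And>n. 0 < t n) \<Longrightarrow>
    (\<And>n. w n \<in> borel_measurable lborel) \<Longrightarrow> (\<lambda>(r, y). g r y) \<in> borel_measurable (lborel \<Otimes>\<^sub>M arc_measure) \<Longrightarrow>
    (\<integral>\<^sup>+ x. enn_powr (\<Sum>n. \<integral>\<^sup>+ r. enn_powr (circle.avg (t n) (g r) x) b * w n r \<partial>(lborel :: real measure)) s \<partial>arc_measure)
      \<le> ennreal D * (\<integral>\<^sup>+ x. enn_powr (\<Sum>n. \<integral>\<^sup>+ r. enn_powr (g r x) b * w n r \<partial>lborel) s \<partial>arc_measure)"
    unfolding b_def using circle.vector_avg_powr_bound_suminf[OF \<open>0 < s\<close> lborel.sigma_finite_measure_axioms] by blast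
  define G where "G = 1 / (1 - \<sigma>)"
  have "0 \<le> G" using \<sigma> by (simp add: G_def)
  define C where "C = (K * B) powr s * ((1 / (1 - l2)) powr s * (G * D))"
  show thesis
  proof (rule that)
    show "0 \<le> C" using \<open>0 \<le> D\<close> \<open>0 \<le> G\<close> by (simp add: C_def)
    fix f :: "complex \<Rightarrow> complex" and g U :: "real \<Rightarrow> real \<Rightarrow> ennreal"
    assume f: "f holomorphic_on ball 0 1"
      and g[measurable]: "(\<lambda>(r, x). g r x) \<in> borel_measurable (lborel \<Otimes>\<^sub>M arc_measure)"
      and U[measurable]: "\<And>x. (\<lambda>r. U r x) \<in> borel_measurable borel"
      and gE: "\<And>\<rho> T x. 0 \<le> \<rho> \<Longrightarrow> \<rho> < 1 \<Longrightarrow> 1 - \<rho> \<le> T \<Longrightarrow>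
        circle.avg T (disc_powr (p / avg_exponent s) f \<rho>) x \<le> ennreal E * circle.avg (2 * T) (g \<rho>) x"
      and UE: "\<And>r x X. 0 \<le> r \<Longrightarrow> r < 1 \<Longrightarrow> (\<And>y. chord x y \<le> 1 - r \<Longrightarrow> disc_powr p f r y \<le> X) \<Longrightarrow> U r x \<le> ennreal E * X"
    have g'[measurable]: "(\<lambda>(x, r). g r x) \<in> borel_measurable (arc_measure \<Otimes>\<^sub>M lborel)"
      by (simp add: measurable_split_conv) measurable
    show "(\<integral>\<^sup>+ x. enn_powr (\<integral>\<^sup>+ r. U r x * w' r \<partial>lborel) s \<partial>arc_measure)
      \<le> ennreal C * (\<integral>\<^sup>+ x. enn_powr (\<integral>\<^sup>+ r. enn_powr (g r x) (avg_exponent s) * w r \<partial>lborel) s \<partial>arc_measure)"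
    proof (cases "\<exists>z\<in>ball 0 1. f z \<noteq> 0")
      case False
      \<comment> \<open>For \<open>f = 0\<close> the circles without zeros used below do not exist;
        the bound on \<open>U\<close> with \<open>X = 0\<close> settles this case.\<close>
      then have "disc_powr p f r y = 0" for r y using \<open>0 < p\<close> by (auto simp: disc_powr_def)
      then have zero: "U r x * w' r = 0" for r x
        using UE[of r x 0] w'0[of r] by (cases "r \<in> {0..<1}") auto
      show ?thesis by (simp only: zero nn_integral_const mult_zero_left enn_powr_0 zero_le)
    next
      case True
      define S where "S k \<rho> x = (\<Sum>j. ennreal ((l powr b) ^ j) * enn_powr (circle.avg (2 * (2 ^ j * t k)) (g \<rho>) x) b)" for k \<rho> x
      define v where "v k \<rho> = w \<rho> * indicator (shell t (k + 2)) \<rho>" for k \<rho>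
      have [measurable]: "v k \<in> borel_measurable borel" for k unfolding v_def by measurable
      have [measurable]: "(\<lambda>\<rho>. S k \<rho> x) \<in> borel_measurable borel" for k x unfolding S_def by measurable
      have pointwise: "AE \<rho> in lborel. U r x * v k \<rho> \<le> ennreal K * (S k \<rho> x * v k \<rho>)"
        if r: "r \<in> shell t k" for r x k
        using AE_no_zeros_on_sphere[OF f True]
      proof eventually_elim
        case (elim \<rho>)
        show ?case
        proof (cases "\<rho> \<in> shell t (k + 2)")
          case \<rho>: True
          have r0: "1 - t k \<le> r" "r < 1 - t (Suc k)" "0 \<le> r" "r < 1"
            using r t1[of k] t(2)[of "Suc k"] by (auto simp: shell_def)
          have \<rho>0: "1 - t (k + 2) \<le> \<rho>" "\<rho> < 1" "0 \<le> \<rho>"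
            using \<rho> t1[of "k + 2"] t(2)[of "Suc (k + 2)"] by (auto simp: shell_def)
          \<comment> \<open>Shell \<open>k + 1\<close> separates the circles:
            \<open>\<rho> - r >= t (k + 1) - t (k + 2) >= t (k + 1) / 2\<close>.\<close>
          have gap: "t k / (2 * \<Lambda>) \<le> \<rho> - r"
          proof -
            have "t k / (2 * \<Lambda>) \<le> t (Suc k) / 2" using t(4)[of k] \<open>1 \<le> \<Lambda>\<close> by (simp add: field_simps)
            also have "\<dots> \<le> \<rho> - r" using t(3)[of "Suc k"] r0 \<rho>0 by (simp add: numeral_2_eq_2)
            finally show ?thesis .
          qed
          have "t (k + 2) \<le> t k" using dec by (simp add: decseq_def)
          have Y: "disc_powr p f r y \<le> ennreal ((A * E) powr b * (1 / (1 - l)) powr b) * S k \<rho> x" if y: "chord x y \<le> 1 - r" for y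
          proof -
            have "disc_powr (p / b) f r y \<le> ennreal A * (\<Sum>j. ennreal ((1/2) ^ j) * circle.avg (2 ^ j * t k) (disc_powr (p / b) f \<rho>) x)"
              unfolding A_def
            proof (rule disc_powr_le_avg[OF f _ \<open>1 \<le> \<Lambda>\<close> t(2) t1 r0(1) gap \<rho>0(2)])
              show "0 < p / b" using \<open>0 < p\<close> b by simp
              show "chord x y \<le> t k" using y r0 by linarith
              show "f z \<noteq> 0" if "cmod z = \<rho>" for z using elim \<rho>0(2) that by blast
            qed
            also have "\<dots> \<le> ennreal A * (\<Sum>j. ennreal ((1/2) ^ j) * (ennreal E * circle.avg (2 * (2 ^ j * t k)) (g \<rho>) x))"
            proof (intro mult_left_mono suminf_le)
              fix j
              have "t k \<le> 2 ^ j * t k" using t(2)[of k] by simp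
              then have "1 - \<rho> \<le> 2 ^ j * t k" using \<rho>0 \<open>t (k + 2) \<le> t k\<close> by linarith
              then show "circle.avg (2 ^ j * t k) (disc_powr (p / b) f \<rho>) x \<le> ennreal E * circle.avg (2 * (2 ^ j * t k)) (g \<rho>) x"
                unfolding b_def using \<rho>0 \<open>t (k + 2) \<le> t k\<close> by (intro gE) auto
            qed auto
            also have "\<dots> = ennreal (A * E) * (\<Sum>j. ennreal ((l\<^sup>2) ^ j) * circle.avg (2 * (2 ^ j * t k)) (g \<rho>) x)"
              using \<open>0 \<le> A\<close> \<open>0 \<le> E\<close> by (simp only: mult.left_commute[of _ "ennreal E"] ennreal_suminf_cmult ennreal_mult mult.assoc l(3))
            finally have "enn_powr (disc_powr (p / b) f r y) b
              \<le> enn_powr (ennreal (A * E) * (\<Sum>j. ennreal ((l\<^sup>2) ^ j) * circle.avg (2 * (2 ^ j * t k)) (g \<rho>) x)) b"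
              using b by (intro enn_powr_mono) auto
            also have "\<dots> = ennreal ((A * E) powr b) * enn_powr (\<Sum>j. ennreal ((l\<^sup>2) ^ j) * circle.avg (2 * (2 ^ j * t k)) (g \<rho>) x) b"
              using \<open>0 \<le> A\<close> \<open>0 \<le> E\<close> by (simp add: enn_powr_mult)
            also have "\<dots> \<le> ennreal ((A * E) powr b) * (ennreal ((1 / (1 - l)) powr b) * S k \<rho> x)"
              unfolding S_def using l b by (intro mult_left_mono enn_powr_suminf_le) auto
            also have "\<dots> = ennreal ((A * E) powr b * (1 / (1 - l)) powr b) * S k \<rho> x"
              by (simp add: ennreal_mult mult.assoc)
            finally show ?thesis using b by (simp add: enn_powr_disc_powr)
          qed
          have "U r x \<le> ennreal E * (ennreal ((A * E) powr b * (1 / (1 - l)) powr b) * S k \<rho> x)"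
            by (intro UE r0 Y)
          also have "\<dots> = ennreal K * S k \<rho> x"
            unfolding K_def using \<open>0 \<le> E\<close> by (simp add: ennreal_mult mult.assoc)
          finally show ?thesis
            by (simp add: mult_right_mono mult.assoc[symmetric])
        qed (simp add: v_def)
      qed
      define \<beta> where "\<beta> k x = (\<integral>\<^sup>+ \<rho>. S k \<rho> x * v k \<rho> \<partial>lborel)" for k x
      have shell_bound: "(\<integral>\<^sup>+ r. U r x * (w' r * indicator (shell t k) r) \<partial>lborel) \<le> ennreal (K * B) * \<beta> k x" for k x
      proof -
        obtain m where m: "0 \<le> m" "(\<integral>\<^sup>+ \<rho>. v k \<rho> \<partial>lborel) = ennreal m"
          using fin[of k] by (cases "\<integral>\<^sup>+ \<rho>. v k \<rho> \<partial>lborel") (auto simp: v_def)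
        have mass': "(\<integral>\<^sup>+ r. w' r * indicator (shell t k) r \<partial>lborel) \<le> ennreal B * ennreal m"
          using mass[of k] m by (simp add: v_def)
        show ?thesis
        \<comment> \<open>Without mass on shell \<open>k + 2\<close> there is nothing to average
          over; then \<open>w'\<close> vanishes almost everywhere on shell \<open>k\<close> by
          \<open>mass\<close>.\<close>
        proof (cases "m = 0")
          case True
          then have "AE r in lborel. w' r * indicator (shell t k) r = 0"
            using mass' by (subst nn_integral_0_iff_AE[symmetric]) auto
          then have "AE r in lborel. U r x * (w' r * indicator (shell t k) r) = 0"
            by eventually_elim simp
          then have "(\<integral>\<^sup>+ r. U r x * (w' r * indicator (shell t k) r) \<partial>lborel) = 0"
            by (subst nn_integral_0_iff_AE) auto
          then show ?thesis by simp
        next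
          case False
          \<comment> \<open>The bound for \<open>U r x\<close> holds for almost every
            \<open>\<rho>\<close> of shell \<open>k + 2\<close>. Multiplying by \<open>v k\<close>
            and integrating replaces it by its mean, which no longer depends on \<open>r\<close> or
            \<open>\<rho>\<close>.\<close>
          define X where "X = ennreal K * \<beta> k x * ennreal (1 / m)"
          have "U r x \<le> X" if "r \<in> shell t k" for r
          proof -
            have "U r x * ennreal m = (\<integral>\<^sup>+ \<rho>. U r x * v k \<rho> \<partial>lborel)"
              unfolding m(2)[symmetric] by (intro nn_integral_cmult[symmetric]) measurable
            also have "\<dots> \<le> (\<integral>\<^sup>+ \<rho>. ennreal K * (S k \<rho> x * v k \<rho>) \<partial>lborel)"
              by (intro nn_integral_mono_AE pointwise that)
            also have "\<dots> = ennreal K * \<beta> k x"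
              unfolding \<beta>_def by (intro nn_integral_cmult) measurable
            finally have "U r x * ennreal m * ennreal (1 / m) \<le> X"
              unfolding X_def by (intro mult_right_mono) auto
            moreover have "ennreal m * ennreal (1 / m) = 1"
              using m False by (simp add: ennreal_mult[symmetric])
            ultimately show ?thesis by (simp add: mult.assoc)
          qed
          then have "(\<integral>\<^sup>+ r. U r x * (w' r * indicator (shell t k) r) \<partial>lborel) \<le> (\<integral>\<^sup>+ r. X * (w' r * indicator (shell t k) r) \<partial>lborel)"
            by (intro nn_integral_mono) (auto intro!: mult_right_mono split: split_indicator)
          also have "\<dots> = X * (\<integral>\<^sup>+ r. w' r * indicator (shell t k) r \<partial>lborel)"
            by (intro nn_integral_cmult) measurable
          also have "\<dots> \<le> X * (ennreal B * ennreal m)" by (intro mult_left_mono mass') auto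
          also have "\<dots> = ennreal K * ennreal B * \<beta> k x * (ennreal (1 / m) * ennreal m)"
            unfolding X_def by (simp add: mult_ac)
          also have "ennreal (1 / m) * ennreal m = 1" using m False by (simp add: ennreal_mult[symmetric])
          finally show ?thesis using \<open>0 \<le> K\<close> \<open>0 \<le> B\<close> by (simp add: ennreal_mult)
        qed
      qed
      \<comment> \<open>For each \<open>j\<close> all shells are treated at once: the radii
        \<open>2 * (2^j * t k)\<close> decrease in \<open>k\<close>, and the constant of the vector
        inequality is independent of \<open>j\<close>.\<close>
      define V where "V j x = (\<Sum>k. \<integral>\<^sup>+ \<rho>. enn_powr (circle.avg (2 * (2 ^ j * t k)) (g \<rho>) x) b * v k \<rho> \<partial>lborel)" for j x
      have [measurable]: "V j \<in> borel_measurable arc_measure" for j unfolding V_def by measurable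
      have inner: "(\<integral>\<^sup>+ r. U r x * w' r \<partial>lborel) \<le> ennreal (K * B) * (\<Sum>j. ennreal ((l2\<^sup>2) ^ j) * V j x)" for x
      proof -
        have "(\<integral>\<^sup>+ r. U r x * w' r \<partial>lborel) \<le> (\<integral>\<^sup>+ r. (\<Sum>k. U r x * (w' r * indicator (shell t k) r)) \<partial>lborel)"
        proof (intro nn_integral_mono)
          fix r :: real
          show "U r x * w' r \<le> (\<Sum>k. U r x * (w' r * indicator (shell t k) r))"
          proof (cases "r \<in> {0..<1}")
            case True
            then obtain k where "r \<in> shell t k" using exists_shell[OF t_lim t(1), of r] by auto
            then have "U r x * w' r = (\<Sum>k\<in>{k}. U r x * (w' r * indicator (shell t k) r))" by simp
            also have "\<dots> \<le> (\<Sum>k. U r x * (w' r * indicator (shell t k) r))" by (intro sum_le_suminf) auto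
            finally show ?thesis .
          qed (simp add: w'0)
        qed
        also have "\<dots> = (\<Sum>k. \<integral>\<^sup>+ r. U r x * (w' r * indicator (shell t k) r) \<partial>lborel)"
          by (intro nn_integral_suminf) measurable
        also have "\<dots> \<le> (\<Sum>k. ennreal (K * B) * \<beta> k x)"
          by (intro suminf_le shell_bound) auto
        also have "\<dots> = ennreal (K * B) * (\<Sum>k. \<beta> k x)" by (rule ennreal_suminf_cmult)
        also have "(\<Sum>k. \<beta> k x) = (\<Sum>k. \<Sum>j. ennreal ((l powr b) ^ j) * (\<integral>\<^sup>+ \<rho>. enn_powr (circle.avg (2 * (2 ^ j * t k)) (g \<rho>) x) b * v k \<rho> \<partial>lborel))"
        proof (intro suminf_cong)
          fix k
          have "\<beta> k x = (\<integral>\<^sup>+ \<rho>. (\<Sum>j. ennreal ((l powr b) ^ j) * (enn_powr (circle.avg (2 * (2 ^ j * t k)) (g \<rho>) x) b * v k \<rho>)) \<partial>lborel)"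
            unfolding \<beta>_def S_def by (simp add: ennreal_suminf_multc[symmetric] mult.assoc)
          also have "\<dots> = (\<Sum>j. \<integral>\<^sup>+ \<rho>. ennreal ((l powr b) ^ j) * (enn_powr (circle.avg (2 * (2 ^ j * t k)) (g \<rho>) x) b * v k \<rho>) \<partial>lborel)"
            by (intro nn_integral_suminf) measurable
          also have "\<dots> = (\<Sum>j. ennreal ((l powr b) ^ j) * (\<integral>\<^sup>+ \<rho>. enn_powr (circle.avg (2 * (2 ^ j * t k)) (g \<rho>) x) b * v k \<rho> \<partial>lborel))"
            by (intro suminf_cong nn_integral_cmult) measurable
          finally show "\<beta> k x = (\<Sum>j. ennreal ((l powr b) ^ j) * (\<integral>\<^sup>+ \<rho>. enn_powr (circle.avg (2 * (2 ^ j * t k)) (g \<rho>) x) b * v k \<rho> \<partial>lborel))" .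
        qed
        also have "\<dots> = (\<Sum>j. ennreal ((l2\<^sup>2) ^ j) * V j x)"
          unfolding V_def l2(3) by (subst suminf_swap_ennreal) (simp add: ennreal_suminf_cmult)
        finally show ?thesis .
      qed
      have V_bound: "(\<integral>\<^sup>+ x. enn_powr (V j x) s \<partial>arc_measure)
        \<le> ennreal D * (\<integral>\<^sup>+ x. enn_powr (\<integral>\<^sup>+ r. enn_powr (g r x) b * w r \<partial>lborel) s \<partial>arc_measure)" for j
      proof -
        have "(\<integral>\<^sup>+ x. enn_powr (V j x) s \<partial>arc_measure)
          \<le> ennreal D * (\<integral>\<^sup>+ x. enn_powr (\<Sum>k. \<integral>\<^sup>+ r. enn_powr (g r x) b * v k r \<partial>lborel) s \<partial>arc_measure)"
          unfolding V_def
          by (intro D(2) g decseq_SucI) (use t(2) dec in \<open>auto simp: decseq_def intro!: mult_left_mono\<close>)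
        also have "\<dots> \<le> ennreal D * (\<integral>\<^sup>+ x. enn_powr (\<integral>\<^sup>+ r. enn_powr (g r x) b * w r \<partial>lborel) s \<partial>arc_measure)"
        proof (intro mult_left_mono nn_integral_mono enn_powr_mono)
          fix x
          have "(\<Sum>k. \<integral>\<^sup>+ r. enn_powr (g r x) b * v k r \<partial>lborel) = (\<integral>\<^sup>+ r. (\<Sum>k. enn_powr (g r x) b * v k r) \<partial>lborel)"
            by (intro nn_integral_suminf[symmetric]) measurable
          also have "\<dots> \<le> (\<integral>\<^sup>+ r. enn_powr (g r x) b * w r \<partial>lborel)"
          proof (intro nn_integral_mono)
            fix r
            have "(\<Sum>k. enn_powr (g r x) b * v k r) = enn_powr (g r x) b * w r * (\<Sum>k. indicator (shell t (k + 2)) r)"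
              unfolding v_def by (simp only: ennreal_suminf_cmult mult.assoc)
            also have "\<dots> \<le> enn_powr (g r x) b * w r * 1"
              by (intro mult_left_mono suminf_shell_le dec) auto
            finally show "(\<Sum>k. enn_powr (g r x) b * v k r) \<le> enn_powr (g r x) b * w r" by simp
          qed
          finally show "(\<Sum>k. \<integral>\<^sup>+ r. enn_powr (g r x) b * v k r \<partial>lborel) \<le> (\<integral>\<^sup>+ r. enn_powr (g r x) b * w r \<partial>lborel)" .
        qed (use \<open>0 < s\<close> in auto)
        finally show ?thesis .
      qed
      let ?R = "\<integral>\<^sup>+ x. enn_powr (\<integral>\<^sup>+ r. enn_powr (g r x) b * w r \<partial>lborel) s \<partial>arc_measure"
      have "(\<integral>\<^sup>+ x. enn_powr (\<integral>\<^sup>+ r. U r x * w' r \<partial>lborel) s \<partial>arc_measure)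
        \<le> (\<integral>\<^sup>+ x. ennreal ((K * B) powr s * (1 / (1 - l2)) powr s) * (\<Sum>j. ennreal (\<sigma> ^ j) * enn_powr (V j x) s) \<partial>arc_measure)"
      proof (intro nn_integral_mono)
        fix x
        have "enn_powr (\<integral>\<^sup>+ r. U r x * w' r \<partial>lborel) s \<le> enn_powr (ennreal (K * B) * (\<Sum>j. ennreal ((l2\<^sup>2) ^ j) * V j x)) s"
          using \<open>0 < s\<close> by (intro enn_powr_mono inner) auto
        also have "\<dots> = ennreal ((K * B) powr s) * enn_powr (\<Sum>j. ennreal ((l2\<^sup>2) ^ j) * V j x) s"
          using \<open>0 \<le> K\<close> \<open>0 \<le> B\<close> by (simp add: enn_powr_mult)
        also have "\<dots> \<le> ennreal ((K * B) powr s) * (ennreal ((1 / (1 - l2)) powr s) * (\<Sum>j. ennreal (\<sigma> ^ j) * enn_powr (V j x) s))"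
          unfolding \<sigma>_def using l2 \<open>0 < s\<close> by (intro mult_left_mono enn_powr_suminf_le) auto
        finally show "enn_powr (\<integral>\<^sup>+ r. U r x * w' r \<partial>lborel) s
          \<le> ennreal ((K * B) powr s * (1 / (1 - l2)) powr s) * (\<Sum>j. ennreal (\<sigma> ^ j) * enn_powr (V j x) s)"
          by (simp add: ennreal_mult mult.assoc)
      qed
      also have "\<dots> = ennreal ((K * B) powr s * (1 / (1 - l2)) powr s) * (\<Sum>j. ennreal (\<sigma> ^ j) * (\<integral>\<^sup>+ x. enn_powr (V j x) s \<partial>arc_measure))"
        by (subst nn_integral_cmult, measurable, subst nn_integral_suminf, measurable, subst nn_integral_cmult, measurable)
      also have "\<dots> \<le> ennreal ((K * B) powr s * (1 / (1 - l2)) powr s) * (\<Sum>j. ennreal (\<sigma> ^ j) * (ennreal D * ?R))"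
        by (intro mult_left_mono suminf_le V_bound) auto
      also have "(\<Sum>j. ennreal (\<sigma> ^ j) * (ennreal D * ?R)) = (\<Sum>j. ennreal (\<sigma> ^ j)) * (ennreal D * ?R)"
        by (rule ennreal_suminf_multc)
      also have "(\<Sum>j. ennreal (\<sigma> ^ j)) = ennreal G"
        unfolding G_def using \<sigma> by (subst suminf_ennreal_eq[OF _ geometric_sums]) auto
      also have "ennreal ((K * B) powr s * (1 / (1 - l2)) powr s) * (ennreal G * (ennreal D * ?R)) = ennreal C * ?R"
        using \<open>0 \<le> D\<close> \<open>0 \<le> G\<close> by (simp add: C_def ennreal_mult mult.assoc)
      finally show ?thesis by (simp add: b_def)
    qed
  qed
qed

section \<open>From the class D to the norm equivalences\<close>

text \<open>The flag allows one argument to serve all four pairs of quasinorms.\<close>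

definition mixed_norm :: "bool \<Rightarrow> real \<Rightarrow> real \<Rightarrow> (complex \<Rightarrow> ennreal) \<Rightarrow> (complex \<Rightarrow> complex) \<Rightarrow> ennreal" where
  "mixed_norm tent = (if tent then T_norm else L_norm)"

text \<open>In the tent case the radii \<open>1 - r\<close> here and \<open>(1 - r) / 4\<close> in
  \<open>lower_density\<close> are those of the chordal regions enclosing and enclosed in
  \<open>Gamma_region\<close>, up to the origin.\<close>

definition upper_density :: "bool \<Rightarrow> real \<Rightarrow> (complex \<Rightarrow> complex) \<Rightarrow> real \<Rightarrow> real \<Rightarrow> ennreal" where
  "upper_density tent p f r x = (if tent then circle.avg (1 - r) (disc_powr p f r) x else disc_powr p f r x)"

definition lower_density :: "bool \<Rightarrow> real \<Rightarrow> (complex \<Rightarrow> complex) \<Rightarrow> real \<Rightarrow> real \<Rightarrow> ennreal" where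
  "lower_density tent p f r x = (if tent then circle.avg ((1 - r) / 4) (disc_powr p f r) x else disc_powr p f r x)"

lemma
  assumes f: "f holomorphic_on ball 0 1" and [measurable]: "g \<in> borel_measurable N" "h \<in> borel_measurable N"
  shows measurable_upper_density: "(\<lambda>y. upper_density tent p f (g y) (h y)) \<in> borel_measurable N"
    and measurable_lower_density: "(\<lambda>y. lower_density tent p f (g y) (h y)) \<in> borel_measurable N"
proof -
  note [measurable (raw)] = measurable_disc_powr[OF f]
  show "(\<lambda>y. upper_density tent p f (g y) (h y)) \<in> borel_measurable N"
    "(\<lambda>y. lower_density tent p f (g y) (h y)) \<in> borel_measurable N"
    unfolding upper_density_def lower_density_def by measurable
qed

lemma mixed_norm_le:
  assumes "0 < p" "0 < q"
  obtains c where "0 < c" "\<And>\<nu> N f. radial_rep \<nu> N \<Longrightarrow> f holomorphic_on ball 0 1 \<Longrightarrow>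
    mixed_norm tent q p \<nu> f \<le> enn_powr (ennreal c *
      (\<integral>\<^sup>+ x. enn_powr (\<integral>\<^sup>+ r. upper_density tent p f r x * polar_weight N r \<partial>lborel) (q / p) \<partial>arc_measure)) (1 / q)"
proof (cases tent)
  case False
  show thesis
    by (rule that[of "1 / (2 * pi)"]) (auto simp: False mixed_norm_def upper_density_def L_norm_rep)
next
  case True
  show thesis
  proof (rule that[of "(1 / pi) powr (q / p)"])
    fix \<nu> N f assume rep: "radial_rep \<nu> N" and f: "f holomorphic_on ball 0 1"
    note [measurable (raw)] = measurable_disc_powr[OF f]
    have [measurable]: "N \<in> borel_measurable borel" using rep unfolding radial_rep_def by blast
    have "T_norm q p \<nu> f \<le> enn_powr (\<integral>\<^sup>+ x. enn_powr (ennreal (1 / pi) *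
      (\<integral>\<^sup>+ r. circle.avg (1 - r) (disc_powr p f r) x * polar_weight N r \<partial>lborel)) (q / p) \<partial>arc_measure) (1 / q)"
      by (rule T_norm_le[OF rep f assms])
    also have "(\<integral>\<^sup>+ x. enn_powr (ennreal (1 / pi) *
      (\<integral>\<^sup>+ r. circle.avg (1 - r) (disc_powr p f r) x * polar_weight N r \<partial>lborel)) (q / p) \<partial>arc_measure)
      = ennreal ((1 / pi) powr (q / p)) * (\<integral>\<^sup>+ x. enn_powr
      (\<integral>\<^sup>+ r. circle.avg (1 - r) (disc_powr p f r) x * polar_weight N r \<partial>lborel) (q / p) \<partial>arc_measure)"
      by (subst nn_integral_cmult[symmetric]) (auto simp: enn_powr_mult intro!: nn_integral_cong)
    finally show "mixed_norm tent q p \<nu> f \<le> enn_powr (ennreal ((1 / pi) powr (q / p)) *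
      (\<integral>\<^sup>+ x. enn_powr (\<integral>\<^sup>+ r. upper_density tent p f r x * polar_weight N r \<partial>lborel) (q / p) \<partial>arc_measure)) (1 / q)"
      by (simp add: True mixed_norm_def upper_density_def)
  qed simp
qed

lemma mixed_norm_ge:
  assumes "0 < p" "0 < q"
  obtains c where "0 < c" "\<And>\<nu> N f. radial_rep \<nu> N \<Longrightarrow> f holomorphic_on ball 0 1 \<Longrightarrow>
    enn_powr (ennreal c *
      (\<integral>\<^sup>+ x. enn_powr (\<integral>\<^sup>+ r. lower_density tent p f r x * polar_weight N r \<partial>lborel) (q / p) \<partial>arc_measure)) (1 / q)
    \<le> mixed_norm tent q p \<nu> f"
proof (cases tent)
  case False
  show thesis
    by (rule that[of "1 / (2 * pi)"]) (auto simp: False mixed_norm_def lower_density_def L_norm_rep)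
next
  case True
  show thesis
  proof (rule that[of "(1 / (4 * pi)) powr (q / p)"])
    fix \<nu> N f assume rep: "radial_rep \<nu> N" and f: "f holomorphic_on ball 0 1"
    note [measurable (raw)] = measurable_disc_powr[OF f]
    have [measurable]: "N \<in> borel_measurable borel" using rep unfolding radial_rep_def by blast
    have "ennreal ((1 / (4 * pi)) powr (q / p)) * (\<integral>\<^sup>+ x. enn_powr
      (\<integral>\<^sup>+ r. circle.avg ((1 - r) / 4) (disc_powr p f r) x * polar_weight N r \<partial>lborel) (q / p) \<partial>arc_measure)
      = (\<integral>\<^sup>+ x. enn_powr (ennreal (1 / (4 * pi)) *
      (\<integral>\<^sup>+ r. circle.avg ((1 - r) / 4) (disc_powr p f r) x * polar_weight N r \<partial>lborel)) (q / p) \<partial>arc_measure)"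
      by (subst nn_integral_cmult[symmetric]) (auto simp: enn_powr_mult intro!: nn_integral_cong)
    also have "enn_powr \<dots> (1 / q) \<le> T_norm q p \<nu> f"
      by (rule T_norm_ge[OF rep f assms])
    finally show "enn_powr (ennreal ((1 / (4 * pi)) powr (q / p)) *
      (\<integral>\<^sup>+ x. enn_powr (\<integral>\<^sup>+ r. lower_density tent p f r x * polar_weight N r \<partial>lborel) (q / p) \<partial>arc_measure)) (1 / q)
      \<le> mixed_norm tent q p \<nu> f"
      by (simp add: True mixed_norm_def lower_density_def)
  qed simp
qed

text \<open>Supplies the condition on \<open>U\<close> in \<open>shell_transfer\<close>; 12 is the
  growth constant of arc length.\<close>

lemma upper_density_le:
  assumes "r < 1" and X: "\<And>y. chord x y \<le> 1 - r \<Longrightarrow> disc_powr p f r y \<le> X"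
  shows "upper_density tent p f r x \<le> 12 * X"
proof (cases tent)
  case True
  have "circle.avg (1 - r) (disc_powr p f r) x \<le> circle.avg (1 - r) (\<lambda>_. X) x"
    by (intro circle.avg_mono X) auto
  also have "\<dots> \<le> ennreal 12 * X" using assms by (intro circle.avg_const_le) auto
  finally show ?thesis by (simp add: upper_density_def True)
next
  case False
  have "disc_powr p f r x \<le> X" using assms by (intro X) (simp add: chord_def)
  also have "1 * X \<le> 12 * X" by (intro mult_right_mono) auto
  finally show ?thesis by (simp add: upper_density_def False)
qed

text \<open>Supplies the condition on \<open>g\<close> in \<open>shell_transfer\<close>. In the tent
  case small averages at scale \<open>(1 - \<rho>) / 4\<close> are inserted, and Jensen's inequality
  replaces the power \<open>p / b\<close> under them by the power \<open>1 / b\<close> outside. The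
  constant is a sum so as to cover both cases.\<close>

lemma avg_disc_powr_le_lower_density:
  assumes f: "f holomorphic_on ball 0 1" and "1 \<le> b" "0 \<le> \<rho>" "\<rho> < 1" "1 - \<rho> \<le> T"
  shows "circle.avg T (disc_powr (p / b) f \<rho>) x
    \<le> ennreal (2 + 2 * (2 powr b * 12 powr (b - 1)) powr (1 / b)) * circle.avg (2 * T) (\<lambda>y. enn_powr (lower_density tent p f \<rho> y) (1 / b)) x"
proof -
  note [measurable (raw)] = measurable_disc_powr[OF f]
  have "0 < T" using assms by simp
  show ?thesis
  proof (cases tent)
    case False
    have "circle.avg T (disc_powr (p / b) f \<rho>) x \<le> 2 * circle.avg (2 * T) (disc_powr (p / b) f \<rho>) x"
      using \<open>0 < T\<close> by (intro circle.avg_double) (auto simp: chord_def)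
    also have "\<dots> \<le> ennreal (2 + 2 * (2 powr b * 12 powr (b - 1)) powr (1 / b)) * circle.avg (2 * T) (disc_powr (p / b) f \<rho>) x"
      by (intro mult_right_mono ennreal_leI[of 2, simplified]) auto
    finally show ?thesis by (simp add: lower_density_def False enn_powr_disc_powr)
  next
    case True
    define \<tau> where "\<tau> = (1 - \<rho>) / 4"
    have \<tau>: "0 < \<tau>" "\<tau> \<le> T" "\<tau> \<le> 2" using assms by (auto simp: \<tau>_def)
    define K where "K = (2 powr b * 12 powr (b - 1)) powr (1 / b)"
    have K: "0 \<le> K" by (simp add: K_def)
    have step: "circle.avg \<tau> (disc_powr (p / b) f \<rho>) y \<le> ennreal K * enn_powr (circle.avg \<tau> (disc_powr p f \<rho>) y) (1 / b)" for y
    proof -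
      have "enn_powr (circle.avg \<tau> (disc_powr (p / b) f \<rho>) y) b
        \<le> ennreal (2 powr b * 12 powr (b - 1)) * circle.avg \<tau> (\<lambda>y. enn_powr (disc_powr (p / b) f \<rho> y) b) y"
        using assms \<tau> by (intro circle.avg_powr_le) auto
      also have "(\<lambda>y. enn_powr (disc_powr (p / b) f \<rho> y) b) = disc_powr p f \<rho>"
        using \<open>1 \<le> b\<close> by (simp add: enn_powr_disc_powr)
      finally have "enn_powr (enn_powr (circle.avg \<tau> (disc_powr (p / b) f \<rho>) y) b) (1 / b)
        \<le> enn_powr (ennreal (2 powr b * 12 powr (b - 1)) * circle.avg \<tau> (disc_powr p f \<rho>) y) (1 / b)"
        using \<open>1 \<le> b\<close> by (intro enn_powr_mono) auto
      then show ?thesis using \<open>1 \<le> b\<close> by (simp add: enn_powr_powr enn_powr_mult K_def)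
    qed
    have "circle.avg T (disc_powr (p / b) f \<rho>) x \<le> ennreal (2 / 1) * circle.avg (2 * T) (circle.avg \<tau> (disc_powr (p / b) f \<rho>)) x"
      using \<tau> chord_growth_lower by (intro circle.avg_le_avg_avg) auto
    also have "\<dots> \<le> ennreal (2 / 1) * circle.avg (2 * T) (\<lambda>y. ennreal K * enn_powr (circle.avg \<tau> (disc_powr p f \<rho>) y) (1 / b)) x"
      by (intro mult_left_mono circle.avg_mono step) auto
    also have "\<dots> = ennreal (2 * K) * circle.avg (2 * T) (\<lambda>y. enn_powr (circle.avg \<tau> (disc_powr p f \<rho>) y) (1 / b)) x"
      using K by (subst circle.avg_cmult) (auto simp: ennreal_mult mult.assoc)
    also have "\<dots> \<le> ennreal (2 + 2 * K) * circle.avg (2 * T) (\<lambda>y. enn_powr (circle.avg \<tau> (disc_powr p f \<rho>) y) (1 / b)) x"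
      by (intro mult_right_mono ennreal_leI) auto
    finally show ?thesis by (simp add: lower_density_def True \<tau>_def K_def)
  qed
qed

lemma mixed_norm_transfer:
  fixes t :: "nat \<Rightarrow> real"
  assumes pq: "0 < p" "0 < q" and "0 \<le> B" "1 \<le> \<Lambda>"
    and t: "t 0 = 1" "\<And>k. 0 < t k" "\<And>k. t (Suc k) \<le> t k / 2" "\<And>k. t k \<le> \<Lambda> * t (Suc k)"
    and rep: "radial_rep \<nu> N" "radial_rep \<nu>' N'"
    and mass: "\<And>k. (\<integral>\<^sup>+ r. polar_weight N' r * indicator (shell t k) r \<partial>lborel)
      \<le> ennreal B * (\<integral>\<^sup>+ r. polar_weight N r * indicator (shell t (k + 2)) r \<partial>lborel)"
    and fin: "\<And>k. (\<integral>\<^sup>+ r. polar_weight N r * indicator (shell t (k + 2)) r \<partial>lborel) < top"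
  obtains C where "0 < C" "\<And>f. f holomorphic_on ball 0 1 \<Longrightarrow>
    mixed_norm tent' q p \<nu>' f \<le> ennreal C * mixed_norm tent q p \<nu> f"
proof -
  define s where "s = q / p"
  have "0 < s" using pq by (simp add: s_def)
  define b where "b = avg_exponent s"
  have b: "1 \<le> b" using \<open>0 < s\<close> by (simp add: b_def avg_exponent_ge_1)
  define E where "E = 12 + (2 + 2 * (2 powr b * 12 powr (b - 1)) powr (1 / b))"
  have E: "12 \<le> E" "2 + 2 * (2 powr b * 12 powr (b - 1)) powr (1 / b) \<le> E" by (auto simp: E_def)
  have [measurable]: "N \<in> borel_measurable borel" "N' \<in> borel_measurable borel"
    using rep unfolding radial_rep_def by blast+
  have "0 \<le> E" using E(1) by simp
  have mw: "polar_weight N \<in> borel_measurable borel" and mw': "polar_weight N' \<in> borel_measurable borel"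
    by measurable
  have w0: "polar_weight N' r = 0" if "r \<notin> {0..<1}" for r
    using that by (simp add: polar_weight_def)
  obtain C where C: "0 \<le> C" "\<And>f g U. f holomorphic_on ball 0 1 \<Longrightarrow>
    (\<lambda>(r, x). g r x) \<in> borel_measurable (lborel \<Otimes>\<^sub>M arc_measure) \<Longrightarrow> (\<And>x. (\<lambda>r. U r x) \<in> borel_measurable borel) \<Longrightarrow>
    (\<And>\<rho> T x. 0 \<le> \<rho> \<Longrightarrow> \<rho> < 1 \<Longrightarrow> 1 - \<rho> \<le> T \<Longrightarrow>
      circle.avg T (disc_powr (p / b) f \<rho>) x \<le> ennreal E * circle.avg (2 * T) (g \<rho>) x) \<Longrightarrow>
    (\<And>r x X. 0 \<le> r \<Longrightarrow> r < 1 \<Longrightarrow> (\<And>y. chord x y \<le> 1 - r \<Longrightarrow> disc_powr p f r y \<le> X) \<Longrightarrow> U r x \<le> ennreal E * X) \<Longrightarrow>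
    (\<integral>\<^sup>+ x. enn_powr (\<integral>\<^sup>+ r. U r x * polar_weight N' r \<partial>lborel) s \<partial>arc_measure)
      \<le> ennreal C * (\<integral>\<^sup>+ x. enn_powr (\<integral>\<^sup>+ r. enn_powr (g r x) b * polar_weight N r \<partial>lborel) s \<partial>arc_measure)"
    unfolding b_def
    by (rule shell_transfer[OF pq(1) \<open>0 < s\<close> \<open>0 \<le> B\<close> \<open>0 \<le> E\<close> \<open>1 \<le> \<Lambda>\<close> t mw mw' w0 mass fin]) blast+
  obtain c' where c': "0 < c'" "\<And>\<nu> N f. radial_rep \<nu> N \<Longrightarrow> f holomorphic_on ball 0 1 \<Longrightarrow>
    mixed_norm tent' q p \<nu> f \<le> enn_powr (ennreal c' *
      (\<integral>\<^sup>+ x. enn_powr (\<integral>\<^sup>+ r. upper_density tent' p f r x * polar_weight N r \<partial>lborel) (q / p) \<partial>arc_measure)) (1 / q)"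
    using mixed_norm_le[OF pq] by blast
  obtain c where c: "0 < c" "\<And>\<nu> N f. radial_rep \<nu> N \<Longrightarrow> f holomorphic_on ball 0 1 \<Longrightarrow>
    enn_powr (ennreal c *
      (\<integral>\<^sup>+ x. enn_powr (\<integral>\<^sup>+ r. lower_density tent p f r x * polar_weight N r \<partial>lborel) (q / p) \<partial>arc_measure)) (1 / q)
    \<le> mixed_norm tent q p \<nu> f"
    using mixed_norm_ge[OF pq] by blast
  \<comment> \<open>\<open>C + 1\<close> replaces \<open>C\<close>, which may be 0, so that the
    constant is positive.\<close>
  define C' where "C' = (c' * (C + 1) / c) powr (1 / q)"
  show thesis
  proof (rule that)
    show "0 < C'" using c(1) c'(1) C(1) by (simp add: C'_def)
    fix f assume f: "f holomorphic_on ball 0 1"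
    note [measurable (raw)] = measurable_upper_density[OF f] measurable_lower_density[OF f]
    let ?Y = "\<integral>\<^sup>+ x. enn_powr (\<integral>\<^sup>+ r. lower_density tent p f r x * polar_weight N r \<partial>lborel) (q / p) \<partial>arc_measure"
    have "(\<integral>\<^sup>+ x. enn_powr (\<integral>\<^sup>+ r. upper_density tent' p f r x * polar_weight N' r \<partial>lborel) s \<partial>arc_measure)
      \<le> ennreal C * (\<integral>\<^sup>+ x. enn_powr (\<integral>\<^sup>+ r. enn_powr (enn_powr (lower_density tent p f r x) (1 / b)) b * polar_weight N r \<partial>lborel) s \<partial>arc_measure)"
    proof (rule C(2)[OF f])
      fix \<rho> T x :: real assume \<rho>: "0 \<le> \<rho>" "\<rho> < 1" "1 - \<rho> \<le> T"
      have "circle.avg T (disc_powr (p / b) f \<rho>) x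
        \<le> ennreal (2 + 2 * (2 powr b * 12 powr (b - 1)) powr (1 / b)) * circle.avg (2 * T) (\<lambda>y. enn_powr (lower_density tent p f \<rho> y) (1 / b)) x"
        by (rule avg_disc_powr_le_lower_density[OF f b \<rho>])
      also have "\<dots> \<le> ennreal E * circle.avg (2 * T) (\<lambda>y. enn_powr (lower_density tent p f \<rho> y) (1 / b)) x"
        by (intro mult_right_mono ennreal_leI E) auto
      finally show "circle.avg T (disc_powr (p / b) f \<rho>) x \<le> ennreal E * circle.avg (2 * T) (\<lambda>y. enn_powr (lower_density tent p f \<rho> y) (1 / b)) x" .
    next
      fix r x X assume "0 \<le> r" "r < 1" "\<And>y. chord x y \<le> 1 - r \<Longrightarrow> disc_powr p f r y \<le> X"
      then have "upper_density tent' p f r x \<le> 12 * X" by (intro upper_density_le) auto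
      also have "12 * X \<le> ennreal E * X"
        using E(1) ennreal_leI[of 12 E] by (intro mult_right_mono) auto
      finally show "upper_density tent' p f r x \<le> ennreal E * X" .
    qed measurable
    also have "\<dots> = ennreal C * ?Y"
      using b by (simp add: enn_powr_powr s_def)
    also have "\<dots> \<le> ennreal (C + 1) * ?Y"
      by (intro mult_right_mono ennreal_leI) auto
    finally have *: "(\<integral>\<^sup>+ x. enn_powr (\<integral>\<^sup>+ r. upper_density tent' p f r x * polar_weight N' r \<partial>lborel) (q / p) \<partial>arc_measure)
      \<le> ennreal (C + 1) * ?Y" by (simp add: s_def)
    have "mixed_norm tent' q p \<nu>' f \<le> enn_powr (ennreal c' * (ennreal (C + 1) * ?Y)) (1 / q)"
      using pq by (intro order_trans[OF c'(2)[OF rep(2) f]] enn_powr_mono mult_left_mono *) auto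
    also have "ennreal c' * (ennreal (C + 1) * ?Y) = ennreal (c' * (C + 1) / c) * (ennreal c * ?Y)"
      using c(1) c'(1) C(1) by (simp add: mult.assoc[symmetric] ennreal_mult[symmetric] del: ennreal_plus)
    also have "enn_powr \<dots> (1 / q) = ennreal C' * enn_powr (ennreal c * ?Y) (1 / q)"
      using c(1) c'(1) C(1) by (simp add: enn_powr_mult C'_def)
    also have "\<dots> \<le> ennreal C' * mixed_norm tent q p \<nu> f"
      by (intro mult_left_mono c(2) rep f) auto
    finally show "mixed_norm tent' q p \<nu>' f \<le> ennreal C' * mixed_norm tent q p \<nu> f" .
  qed
qed

section \<open>Tails and Borel profiles of radial weights\<close>

definition radial_tail :: "(real \<Rightarrow> ennreal) \<Rightarrow> real \<Rightarrow> ennreal" where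
  "radial_tail N r = (\<integral>\<^sup>+ s. (if r \<le> s \<and> s < 1 then N s else 0) \<partial>lborel)"

lemma measurable_radial_tail [measurable]:
  assumes [measurable]: "N \<in> borel_measurable borel"
  shows "radial_tail N \<in> borel_measurable borel"
  unfolding radial_tail_def by measurable

lemma radial_tail_antimono: "r \<le> r' \<Longrightarrow> radial_tail N r' \<le> radial_tail N r"
  unfolding radial_tail_def by (intro nn_integral_mono) auto

text \<open>By polar coordinates a Borel version of \<open>\<omega>\<close> agrees with it almost
  everywhere on almost every ray. One such ray, of angle \<open>x\<close>, carries a Borel profile,
  and radial symmetry does the rest.\<close>

lemma radial_weight_rep:
  assumes "radial_weight \<omega>"
  obtains N where "radial_rep (\<lambda>z. ennreal (\<omega> z)) N" "(\<integral>\<^sup>+ r. polar_weight N r \<partial>lborel) < top"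
proof -
  have nonneg: "\<And>z. z \<in> ball 0 1 \<Longrightarrow> 0 \<le> \<omega> z" and rad: "\<And>z. z \<in> ball 0 1 \<Longrightarrow> \<omega> z = \<omega> (of_real (cmod z))"
    and int: "integrable lebesgue (\<lambda>z. indicator (ball 0 1) z *\<^sub>R \<omega> z)"
    using assms unfolding radial_weight_def set_integrable_def by blast+
  have "(\<lambda>z. indicator (ball 0 1) z *\<^sub>R \<omega> z) \<in> borel_measurable (completion lborel)"
    using int by (rule borel_measurable_integrable)
  then obtain g where g[measurable]: "g \<in> borel_measurable lborel"
    and g_eq: "AE z in lborel. indicator (ball 0 1) z *\<^sub>R \<omega> z = g z"
    using completion_ex_borel_measurable_real by blast
  obtain Z where Z: "{z \<in> space lborel. \<not> indicator (ball 0 1) z *\<^sub>R \<omega> z = g z} \<subseteq> Z" "emeasure lborel Z = 0" "Z \<in> sets lborel"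
    using g_eq by (rule AE_E)
  have [measurable]: "Z \<in> sets borel" using Z by simp
  have "(\<integral>\<^sup>+ x. \<integral>\<^sup>+ r. indicator Z (rcis r x) * ennreal r \<partial>lborel \<partial>arc_measure) = (\<integral>\<^sup>+ z. indicator Z z \<partial>lborel)"
    by (intro nn_integral_polar[symmetric]) measurable
  also have "\<dots> = 0" using Z by simp
  finally have "AE x in arc_measure. (\<integral>\<^sup>+ r. indicator Z (rcis r x) * ennreal r \<partial>lborel) = 0"
    by (subst (asm) nn_integral_0_iff_AE) auto
  moreover have "\<not> (AE x in arc_measure. False)"
  proof
    assume "AE x in arc_measure. False"
    then have "emeasure arc_measure (space arc_measure) = 0"
      by (subst (asm) AE_iff_measurable[OF _ refl]) auto
    then show False by (simp add: emeasure_arc_measure)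
  qed
  ultimately obtain x where x: "(\<integral>\<^sup>+ r. indicator Z (rcis r x) * ennreal r \<partial>lborel) = 0"
    by (metis (mono_tags, lifting) eventually_mono)
  have ae: "AE r in lborel. 0 < r \<longrightarrow> rcis r x \<notin> Z"
    using x by (subst (asm) nn_integral_0_iff_AE) (auto elim!: eventually_mono split: split_indicator_asm)
  define N where "N r = ennreal (g (rcis r x))" for r
  have [measurable]: "N \<in> borel_measurable borel" unfolding N_def by measurable
  have rep: "radial_rep (\<lambda>z. ennreal (\<omega> z)) N"
    unfolding radial_rep_def
  proof (intro conjI ballI)
    show "AE r in lborel. 0 < r \<and> r < 1 \<longrightarrow> ennreal (\<omega> (of_real r)) = N r"
      using ae
    proof eventually_elim
      case (elim r)
      show ?case
      proof
        assume r: "0 < r \<and> r < 1"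
        then have "rcis r x \<notin> Z" using elim by blast
        then have "indicator (ball 0 1) (rcis r x) *\<^sub>R \<omega> (rcis r x) = g (rcis r x)" using Z(1) by auto
        moreover have b: "rcis r x \<in> ball 0 1" using r by simp
        ultimately have "\<omega> (rcis r x) = g (rcis r x)" by simp
        moreover have "\<omega> (rcis r x) = \<omega> (of_real r)" using rad[OF b] r by simp
        ultimately show "ennreal (\<omega> (of_real r)) = N r" by (simp add: N_def)
      qed
    qed
    show "ennreal (\<omega> z) = ennreal (\<omega> (of_real (cmod z)))" if "z \<in> ball 0 1" for z
      using rad[OF that] by (rule arg_cong)
  qed measurable
  have "(\<integral>\<^sup>+ r. polar_weight N r \<partial>lborel) < top"
  proof -
    have "(\<integral>\<^sup>+ z. (if cmod z < 1 then N (cmod z) else 0) \<partial>lborel) = (\<integral>\<^sup>+ z. ennreal (norm (indicator (ball 0 1) z *\<^sub>R \<omega> z)) \<partial>lborel)"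
    proof (intro nn_integral_cong_AE, use radial_rep_AE[OF rep] in eventually_elim)
      case (elim z)
      then show ?case using nonneg[of z] by (auto simp: indicator_def)
    qed
    also have "\<dots> = (\<integral>\<^sup>+ z. ennreal (norm (indicator (ball 0 1) z *\<^sub>R \<omega> z)) \<partial>lebesgue)"
      by (simp add: nn_integral_completion)
    also have "\<dots> < top"
      using int by (simp add: integrable_iff_bounded)
    finally have "(\<integral>\<^sup>+ x. \<integral>\<^sup>+ r. (if cmod (rcis r x) < 1 then N (cmod (rcis r x)) else 0) * ennreal r \<partial>lborel \<partial>arc_measure) < top"
      by (subst (asm) nn_integral_polar) auto
    also have "(\<integral>\<^sup>+ x. \<integral>\<^sup>+ r. (if cmod (rcis r x) < 1 then N (cmod (rcis r x)) else 0) * ennreal r \<partial>lborel \<partial>arc_measure)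
      = (\<integral>\<^sup>+ x. (\<integral>\<^sup>+ r. polar_weight N r \<partial>lborel) \<partial>arc_measure)"
      by (intro nn_integral_cong) (auto simp: polar_weight_def ennreal_neg abs_if split: split_indicator)
    finally have "(\<integral>\<^sup>+ r. polar_weight N r \<partial>lborel) * emeasure arc_measure (space arc_measure) < top" by simp
    moreover have "emeasure arc_measure (space arc_measure) = ennreal (2 * pi)" by (simp add: emeasure_arc_measure)
    ultimately show ?thesis
      by (auto simp: ennreal_mult_less_top)
  qed
  then show thesis using rep that by blast
qed

lemma tail_eq_radial_tail:
  assumes "radial_rep (\<lambda>z. ennreal (\<omega> z)) N" "0 \<le> r"
  shows "tail \<omega> (of_real r) = radial_tail N r"
proof -
  have "AE s in lborel. 0 < s \<and> s < 1 \<longrightarrow> ennreal (\<omega> (of_real s)) = N s"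
    using assms unfolding radial_rep_def by blast
  moreover have "AE s in lborel. s \<noteq> (0::real)" by (rule AE_lborel_singleton)
  ultimately have "AE s in lborel. ennreal (\<omega> (of_real s)) * indicator {r..<1} s = (if r \<le> s \<and> s < 1 then N s else 0)"
    by eventually_elim (use assms(2) in \<open>auto simp: indicator_def\<close>)
  then show ?thesis
    using assms(2) unfolding tail_def radial_tail_def nn_integral_completion by (simp cong: nn_integral_cong_AE)
qed

lemma regularized_rep:
  assumes rep: "radial_rep (\<lambda>z. ennreal (\<omega> z)) N"
  shows "radial_rep (regularized \<omega>) (\<lambda>r. radial_tail N r / ennreal (1 - r))"
  unfolding radial_rep_def
proof (intro conjI ballI)
  have [measurable]: "N \<in> borel_measurable borel" using rep unfolding radial_rep_def by blast
  show "(\<lambda>r. radial_tail N r / ennreal (1 - r)) \<in> borel_measurable borel" by measurable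
  show "AE r in lborel. 0 < r \<and> r < 1 \<longrightarrow> regularized \<omega> (of_real r) = radial_tail N r / ennreal (1 - r)"
    by (intro AE_I2) (auto simp: regularized_def tail_eq_radial_tail[OF rep])
  show "regularized \<omega> z = regularized \<omega> (of_real (cmod z))" for z
    by (simp add: regularized_def tail_def)
qed


text \<open>\<open>r > 0\<close> matters: integrability of \<open>N s * s\<close> does not bound the
  tail from 0.\<close>

lemma radial_tail_finite:
  assumes [measurable]: "N \<in> borel_measurable borel" and fin: "(\<integral>\<^sup>+ r. polar_weight N r \<partial>lborel) < top" and "0 < r"
  shows "radial_tail N r < top"
proof -
  have "radial_tail N r \<le> (\<integral>\<^sup>+ s. ennreal (1 / r) * polar_weight N s \<partial>lborel)"
    unfolding radial_tail_def
  proof (intro nn_integral_mono)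
    fix s
    show "(if r \<le> s \<and> s < 1 then N s else 0) \<le> ennreal (1 / r) * polar_weight N s"
    proof (cases "r \<le> s \<and> s < 1")
      case True
      then have "1 \<le> ennreal (1 / r) * ennreal s"
        using \<open>0 < r\<close> by (simp add: ennreal_mult[symmetric] field_simps)
      then have "N s * 1 \<le> N s * (ennreal (1 / r) * ennreal s)" by (intro mult_left_mono) auto
      then show ?thesis using True \<open>0 < r\<close> by (simp add: polar_weight_def mult_ac)
    qed auto
  qed
  also have "\<dots> = ennreal (1 / r) * (\<integral>\<^sup>+ s. polar_weight N s \<partial>lborel)"
    by (intro nn_integral_cmult) measurable
  also have "\<dots> < top" using fin by (simp add: ennreal_mult_less_top)
  finally show ?thesis .
qed

lemma radial_tail_split:
  assumes [measurable]: "N \<in> borel_measurable borel" and "a \<le> a'" "a' \<le> 1"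
  shows "radial_tail N a = (\<integral>\<^sup>+ s. N s * indicator {a..<a'} s \<partial>lborel) + radial_tail N a'"
  unfolding radial_tail_def
  by (subst nn_integral_add[symmetric]) (use assms in \<open>auto intro!: nn_integral_cong simp: indicator_def\<close>)

section \<open>Shells adapted to a weight in the class D\<close>

lemma D_hat_iterate:
  assumes "\<And>r. r1 < r \<Longrightarrow> r < 1 \<Longrightarrow> T r \<le> ennreal C * T ((1 + r) / 2)" "0 \<le> C" "r1 < r" "r < (1::real)"
  shows "T r \<le> ennreal (C ^ m) * T (1 - (1 - r) / 2 ^ m)"
proof (induction m)
  case (Suc m)
  define \<rho> where "\<rho> = 1 - (1 - r) / 2 ^ m"
  have "(1 - r) / 2 ^ m \<le> (1 - r) / 1" using assms by (intro divide_left_mono) auto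
  moreover have "0 < (1 - r) / 2 ^ m" using assms by simp
  ultimately have \<rho>: "r1 < \<rho>" "\<rho> < 1" using assms(3) unfolding \<rho>_def div_by_1 by simp_all
  have "T r \<le> ennreal (C ^ m) * T \<rho>" using Suc by (simp add: \<rho>_def)
  also have "\<dots> \<le> ennreal (C ^ m) * (ennreal C * T ((1 + \<rho>) / 2))"
    by (intro mult_left_mono assms \<rho>) auto
  also have "(1 + \<rho>) / 2 = 1 - (1 - r) / 2 ^ Suc m" by (simp add: \<rho>_def field_simps)
  also have "ennreal (C ^ m) * (ennreal C * T (1 - (1 - r) / 2 ^ Suc m)) = ennreal (C ^ Suc m) * T (1 - (1 - r) / 2 ^ Suc m)"
    using \<open>0 \<le> C\<close> by (simp add: mult.assoc[symmetric] ennreal_mult[symmetric] mult.commute)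
  finally show ?case .
qed simp

text \<open>The first shell, \<open>[0, 1 - \<tau>)\<close>, swallows the radii where the eventual
  conditions are not yet available, as well as the origin, where the tail may be infinite; the
  estimates are therefore stated for \<open>k >= 1\<close>.\<close>

lemma D_class_shells:
  assumes D: "\<omega> \<in> D_class" and rep: "radial_rep (\<lambda>z. ennreal (\<omega> z)) N"
    and fin: "(\<integral>\<^sup>+ r. polar_weight N r \<partial>lborel) < top"
  obtains t :: "nat \<Rightarrow> real" and \<Lambda> B where "t 0 = 1" "\<And>k. 0 < t k" "\<And>k. t (Suc k) \<le> t k / 2" "\<And>k. t k \<le> \<Lambda> * t (Suc k)" "1 \<le> \<Lambda>"
    "0 \<le> B" "\<And>k. 1 \<le> k \<Longrightarrow> radial_tail N (1 - t k) \<le> ennreal B * radial_tail N (1 - t (Suc k))"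
    "\<And>k. 1 \<le> k \<Longrightarrow> radial_tail N (1 - t k) \<le> ennreal B * (\<integral>\<^sup>+ r. N r * indicator (shell t k) r \<partial>lborel)"
proof -
  have [measurable]: "N \<in> borel_measurable borel" using rep unfolding radial_rep_def by blast
  let ?T = "radial_tail N"
  obtain C1 where C1: "C1 > 0" "\<forall>\<^sub>F r::real in at_left 1. tail \<omega> (of_real r) \<le> ennreal C1 * tail \<omega> (of_real ((1 + r) / 2))"
    using D unfolding D_class_def D_hat_def by auto
  obtain K C2 where KC: "K > 1" "C2 > 1" "\<forall>\<^sub>F r::real in at_left 1. tail \<omega> (of_real r) \<ge> ennreal C2 * tail \<omega> (of_real (1 - (1 - r) / K))"
    using D unfolding D_class_def D_check_def by auto
  obtain r0 where r0: "r0 < 1" "\<And>r. r0 < r \<Longrightarrow> r < 1 \<Longrightarrow> tail \<omega> (of_real r) \<le> ennreal C1 * tail \<omega> (of_real ((1 + r) / 2))"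
    "\<And>r. r0 < r \<Longrightarrow> r < 1 \<Longrightarrow> tail \<omega> (of_real r) \<ge> ennreal C2 * tail \<omega> (of_real (1 - (1 - r) / K))"
    using eventually_conj[OF C1(2) KC(3)] by (auto simp: eventually_at_left_field)
  define r1 where "r1 = max r0 (1/2)"
  have r1: "1/2 \<le> r1" "r1 < 1" "r0 \<le> r1" using r0(1) by (auto simp: r1_def)
  have hat: "?T r \<le> ennreal C1 * ?T ((1 + r) / 2)" if "r1 < r" "r < 1" for r
    using r0(2)[of r] that r1 by (simp add: tail_eq_radial_tail[OF rep] del: of_real_divide of_real_add)
  \<comment> \<open>Enlarging \<open>K\<close> only decreases the outer tail, so the reverse
    condition survives; a ratio of at least 2 is what \<open>t (Suc k) <= t k / 2\<close> asks
    for.\<close>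
  define L where "L = max K 2"
  have L: "K \<le> L" "2 \<le> L" by (auto simp: L_def)
  have check: "ennreal C2 * ?T (1 - (1 - r) / L) \<le> ?T r" if r: "r1 < r" "r < 1" for r
  proof -
    have "(1 - r) / L \<le> (1 - r) / K" using r KC L by (intro divide_left_mono) auto
    then have "?T (1 - (1 - r) / L) \<le> ?T (1 - (1 - r) / K)" by (intro radial_tail_antimono) simp
    then have "ennreal C2 * ?T (1 - (1 - r) / L) \<le> ennreal C2 * ?T (1 - (1 - r) / K)" by (intro mult_left_mono) auto
    also have "(1 - r) / K \<le> (1 - r) / 1" using r KC by (intro divide_left_mono) auto
    then have "ennreal C2 * ?T (1 - (1 - r) / K) \<le> ?T r"
      using r0(3)[of r] r r1 tail_eq_radial_tail[OF rep, of r] tail_eq_radial_tail[OF rep, of "1 - (1 - r) / K"] by simp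
    finally show ?thesis .
  qed
  \<comment> \<open>\<open>m\<close> halvings of the distance to the circle reach beyond one step of
    ratio \<open>L\<close>, so the iterated doubling condition compares consecutive shells.\<close>
  obtain m where "L < 2 ^ m" using real_arch_pow[of 2 L] by auto
  define \<tau> where "\<tau> = (1 - r1) / 2"
  have \<tau>: "0 < \<tau>" "\<tau> \<le> 1/2" "r1 < 1 - \<tau>" using r1 by (auto simp: \<tau>_def field_simps)
  define t where "t n = (case n of 0 \<Rightarrow> 1 | Suc k \<Rightarrow> \<tau> / L ^ k)" for n
  have t0: "t 0 = 1" and tS: "t (Suc k) = \<tau> / L ^ k" for k by (auto simp: t_def)
  have t_Suc: "t (Suc k) = t k / L" if "1 \<le> k" for k using that by (cases k) (auto simp: tS)
  have tpos: "0 < t k" for k using \<tau> L by (cases k) (auto simp: t0 tS)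
  have t_le: "t k \<le> \<tau>" if k: "1 \<le> k" for k
  proof -
    obtain j where "k = Suc j" using k by (cases k) auto
    moreover have "1 \<le> L ^ j" using L by (intro one_le_power) auto
    ultimately show ?thesis using \<tau> L by (simp add: tS field_simps)
  qed
  have a: "r1 < 1 - t k" "1 - t k < 1" if "1 \<le> k" for k using t_le[OF that] \<tau> tpos[of k] by auto
  define \<Lambda> where "\<Lambda> = max L (1 / \<tau>)"
  \<comment> \<open>\<open>C2 / (C2 - 1)\<close>: if a tail consists of \<open>z\<close> on the
    shell and \<open>y\<close> beyond it, and \<open>C2 * y\<close> is at most the whole, then the
    shell carries at least the fraction \<open>(C2 - 1) / C2\<close>.\<close>
  define B where "B = max (C1 ^ m) (C2 / (C2 - 1))"
  show thesis
  proof (rule that)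
    show "t 0 = 1" "\<And>k. 0 < t k" by (fact t0 tpos)+
    show "t (Suc k) \<le> t k / 2" for k
    proof (cases "k = 0")
      case True then show ?thesis using \<tau> by (simp add: t0 tS)
    next
      case False
      then have "t (Suc k) = t k / L" by (intro t_Suc) simp
      also have "\<dots> \<le> t k / 2" using tpos[of k] L by (intro divide_left_mono) auto
      finally show ?thesis .
    qed
    show "t k \<le> \<Lambda> * t (Suc k)" for k
    proof (cases "k = 0")
      case True
      have "1 / \<tau> * \<tau> \<le> \<Lambda> * \<tau>" unfolding \<Lambda>_def using \<tau> by (intro mult_right_mono) auto
      then show ?thesis using \<tau> True by (simp add: t0 tS)
    next
      case False
      have "L * t (Suc k) \<le> \<Lambda> * t (Suc k)" unfolding \<Lambda>_def using tpos[of "Suc k"] by (intro mult_right_mono) auto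
      then show ?thesis using t_Suc[of k] False L by simp
    qed
    show "1 \<le> \<Lambda>" "0 \<le> B" using L C1 KC by (auto simp: \<Lambda>_def B_def le_max_iff_disj)
    fix k :: nat assume k: "1 \<le> k"
    have "?T (1 - t k) \<le> ennreal (C1 ^ m) * ?T (1 - (1 - (1 - t k)) / 2 ^ m)"
      using C1 a[OF k] by (intro D_hat_iterate[of r1] hat) auto
    also have "\<dots> \<le> ennreal B * ?T (1 - t (Suc k))"
    proof (intro mult_mono ennreal_leI radial_tail_antimono)
      have "t k / 2 ^ m \<le> t k / L" using \<open>L < 2 ^ m\<close> L tpos[of k] by (intro divide_left_mono) auto
      then show "1 - t (Suc k) \<le> 1 - (1 - (1 - t k)) / 2 ^ m" using t_Suc[OF k] by simp
    qed (auto simp: B_def)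
    finally show "?T (1 - t k) \<le> ennreal B * ?T (1 - t (Suc k))" .
    have "t k / L \<le> t k / 1" using tpos[of k] L by (intro divide_left_mono) auto
    then have "t (Suc k) \<le> t k" using t_Suc[OF k] by simp
    then have split: "?T (1 - t k) = (\<integral>\<^sup>+ r. N r * indicator (shell t k) r \<partial>lborel) + ?T (1 - t (Suc k))"
      unfolding shell_def using tpos[of "Suc k"] by (intro radial_tail_split) auto
    have chk: "ennreal C2 * ?T (1 - t (Suc k)) \<le> ?T (1 - t k)"
      using check[OF a[OF k]] t_Suc[OF k] by simp
    have "?T (1 - t k) < top" using a[OF k] r1 by (intro radial_tail_finite fin) auto
    then obtain x where x: "?T (1 - t k) = ennreal x" "0 \<le> x" by (cases "?T (1 - t k)") auto
    obtain y where y: "?T (1 - t (Suc k)) = ennreal y" "0 \<le> y"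
      using split x by (cases "?T (1 - t (Suc k))") auto
    obtain z where z: "(\<integral>\<^sup>+ r. N r * indicator (shell t k) r \<partial>lborel) = ennreal z" "0 \<le> z"
      using split x by (cases "\<integral>\<^sup>+ r. N r * indicator (shell t k) r \<partial>lborel") auto
    have "x = z + y" using split[unfolded x(1) y(1) z(1)] x(2) y(2) z(2) by (simp flip: ennreal_plus)
    moreover have "C2 * y \<le> x" using chk[unfolded x(1) y(1)] x(2) y(2) KC by (simp flip: ennreal_mult)
    ultimately have "(C2 - 1) * x \<le> C2 * z" using KC by (simp add: algebra_simps)
    then have "x \<le> C2 / (C2 - 1) * z" using KC by (simp add: field_simps)
    also have "\<dots> \<le> B * z" using z(2) by (intro mult_right_mono) (auto simp: B_def)
    finally have "ennreal x \<le> ennreal (B * z)" by (rule ennreal_leI)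
    then show "?T (1 - t k) \<le> ennreal B * (\<integral>\<^sup>+ r. N r * indicator (shell t k) r \<partial>lborel)"
      unfolding x(1) z(1) using z(2) by (simp add: ennreal_mult'')
  qed
qed


section \<open>Masses on shells\<close>

definition shell_mass :: "(nat \<Rightarrow> real) \<Rightarrow> (real \<Rightarrow> ennreal) \<Rightarrow> nat \<Rightarrow> ennreal" where
  "shell_mass t N k = (\<integral>\<^sup>+ r. polar_weight N r * indicator (shell t k) r \<partial>lborel)"

text \<open>\<open>T\<close> is the common yardstick: the mass of \<open>N'\<close> on shell
  \<open>k\<close> is at most \<open>U' * T k\<close>, two steps outwards cost \<open>B^2\<close>,
  and \<open>T (k + 2)\<close> is at most \<open>L\<close> times the mass of \<open>N\<close>
  there.\<close>

lemma mixed_norm_le_of_shell_mass: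
  assumes pq: "0 < p" "0 < q"
    and t: "t 0 = 1" "\<And>k. 0 < t k" "\<And>k. t (Suc k) \<le> t k / 2" "\<And>k. t k \<le> \<Lambda> * t (Suc k)" "1 \<le> \<Lambda>"
    and rep: "radial_rep \<nu> N" "radial_rep \<nu>' N'"
    and T: "\<And>k. 1 \<le> k \<Longrightarrow> T k \<le> ennreal B * T (Suc k)" "\<And>k. 1 \<le> k \<Longrightarrow> 0 < T k" "\<And>k. 1 \<le> k \<Longrightarrow> T k < top" "0 \<le> B"
    and up: "\<And>k. 1 \<le> k \<Longrightarrow> shell_mass t N k \<le> ennreal U * T k" "0 \<le> U"
    and up': "shell_mass t N' 0 < top" "\<And>k. 1 \<le> k \<Longrightarrow> shell_mass t N' k \<le> ennreal U' * T k" "0 \<le> U'"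
    and low: "\<And>k. 1 \<le> k \<Longrightarrow> T k \<le> ennreal L * shell_mass t N k" "0 \<le> L"
  shows "\<exists>C>0. \<forall>f. f holomorphic_on ball 0 1 \<longrightarrow> mixed_norm tent' q p \<nu>' f \<le> ennreal C * mixed_norm tent q p \<nu> f"
proof -
  have fin: "shell_mass t N (k + 2) < top" for k
    using up(1)[of "k + 2"] T(3)[of "k + 2"] by (auto simp: ennreal_mult_less_top intro: le_less_trans)
  obtain x where x: "shell_mass t N' 0 = ennreal x" "0 \<le> x" using up'(1) by (cases "shell_mass t N' 0") auto
  obtain y where y: "shell_mass t N 2 = ennreal y" "0 \<le> y" using fin[of 0] by (cases "shell_mass t N 2") (auto simp: numeral_2_eq_2)
  have "y \<noteq> 0" using low(1)[of 2] T(2)[of 2] y by auto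
  \<comment> \<open>Shell 0 has no estimate by \<open>T\<close>; its finite mass \<open>x\<close> is
    compared with the positive mass \<open>y\<close> on shell 2.\<close>
  define D where "D = max (U' * (B * (B * L))) (x / y)"
  have "0 \<le> D" using y x by (simp add: D_def le_max_iff_disj)
  have mass: "shell_mass t N' k \<le> ennreal D * shell_mass t N (k + 2)" for k
  proof (cases "k = 0")
    case True
    have "x \<le> D * y" using y \<open>y \<noteq> 0\<close> mult_right_mono[of "x / y" D y] by (simp add: D_def)
    then have "ennreal x \<le> ennreal (D * y)" by (rule ennreal_leI)
    then show ?thesis using True x y by (simp add: ennreal_mult'' numeral_2_eq_2)
  next
    case False
    then have k: "1 \<le> k" "1 \<le> Suc k" "1 \<le> k + 2" by auto
    have "shell_mass t N' k \<le> ennreal U' * T k" by (rule up'(2)[OF k(1)])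
    also have "\<dots> \<le> ennreal U' * (ennreal B * (ennreal B * (ennreal L * shell_mass t N (k + 2))))"
    proof (intro mult_left_mono)
      have "T k \<le> ennreal B * T (Suc k)" by (rule T(1)[OF k(1)])
      also have "\<dots> \<le> ennreal B * (ennreal B * T (k + 2))"
        using T(1)[OF k(2)] by (intro mult_left_mono) auto
      also have "\<dots> \<le> ennreal B * (ennreal B * (ennreal L * shell_mass t N (k + 2)))"
        using low(1)[OF k(3)] by (intro mult_left_mono) auto
      finally show "T k \<le> ennreal B * (ennreal B * (ennreal L * shell_mass t N (k + 2)))" .
    qed auto
    also have "\<dots> = ennreal (U' * (B * (B * L))) * shell_mass t N (k + 2)"
      using up'(3) T(4) low(2) by (simp add: ennreal_mult mult.assoc)
    also have "\<dots> \<le> ennreal D * shell_mass t N (k + 2)"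
      by (intro mult_right_mono ennreal_leI) (auto simp: D_def)
    finally show ?thesis .
  qed
  obtain C where "0 < C" "\<And>f. f holomorphic_on ball 0 1 \<Longrightarrow> mixed_norm tent' q p \<nu>' f \<le> ennreal C * mixed_norm tent q p \<nu> f"
    by (rule mixed_norm_transfer[OF pq \<open>0 \<le> D\<close> t(5) t(1,2,3,4) rep, of tent' tent])
      (use mass fin in \<open>auto simp: shell_mass_def\<close>)
  then show ?thesis by blast
qed

lemma D_class_mixed_norm_le:
  assumes pq: "0 < p" "0 < q" and \<omega>: "radial_weight \<omega>" and pos: "\<And>z. z \<in> ball 0 1 \<Longrightarrow> tail \<omega> z > 0"
    and D: "\<omega> \<in> D_class" and \<nu>: "\<nu> \<in> {\<lambda>z. ennreal (\<omega> z), regularized \<omega>}" "\<nu>' \<in> {\<lambda>z. ennreal (\<omega> z), regularized \<omega>}"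
  shows "\<exists>C>0. \<forall>f. f holomorphic_on ball 0 1 \<longrightarrow> mixed_norm tent' q p \<nu>' f \<le> ennreal C * mixed_norm tent q p \<nu> f"
proof -
  obtain N where rep: "radial_rep (\<lambda>z. ennreal (\<omega> z)) N" and fin: "(\<integral>\<^sup>+ r. polar_weight N r \<partial>lborel) < top"
    using radial_weight_rep[OF \<omega>] by blast
  have [measurable]: "N \<in> borel_measurable borel" using rep unfolding radial_rep_def by blast
  obtain t \<Lambda> B where t: "t 0 = 1" "\<And>k. 0 < t k" "\<And>k. t (Suc k) \<le> t k / 2" "\<And>k. t k \<le> \<Lambda> * t (Suc k)" "1 \<le> (\<Lambda>::real)"
    and B: "0 \<le> B" "\<And>k. 1 \<le> k \<Longrightarrow> radial_tail N (1 - t k) \<le> ennreal B * radial_tail N (1 - t (Suc k))"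
    "\<And>k. 1 \<le> k \<Longrightarrow> radial_tail N (1 - t k) \<le> ennreal B * (\<integral>\<^sup>+ r. N r * indicator (shell t k) r \<partial>lborel)"
    using D_class_shells[OF D rep fin] by blast
  define T where "T k = radial_tail N (1 - t k)" for k
  have th: "t k \<le> 1/2" if "1 \<le> k" for k
    using that
  proof (induction k rule: dec_induct)
    case base then show ?case using t(3)[of 0] t(1) by simp
  next
    case (step n) then show ?case using t(3)[of n] t(2)[of n] by simp
  qed
  have Tpos: "0 < T k" if "1 \<le> k" for k
    using pos[of "of_real (1 - t k)"] th[OF that] t(2)[of k] tail_eq_radial_tail[OF rep, of "1 - t k"]
    by (simp add: T_def del: of_real_diff)
  have Tfin: "T k < top" if "1 \<le> k" for k
    unfolding T_def using th[OF that] by (intro radial_tail_finite fin) auto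
  define M where "M r = radial_tail N r / ennreal (1 - r)" for r
  have [measurable]: "M \<in> borel_measurable borel" unfolding M_def by measurable
  \<comment> \<open>Comparability of shell masses with tails holds for the weight and for its
    regularization, so any two of them may be combined.\<close>
  define good where "good \<nu> P \<longleftrightarrow> radial_rep \<nu> P \<and> shell_mass t P 0 < top \<and>
    (\<exists>U\<ge>0. \<forall>k\<ge>1. shell_mass t P k \<le> ennreal U * T k) \<and> (\<exists>L\<ge>0. \<forall>k\<ge>1. T k \<le> ennreal L * shell_mass t P k)" for \<nu> P
  have goodI: "good \<nu> P" if "radial_rep \<nu> P" "shell_mass t P 0 < top"
      "\<And>k. 1 \<le> k \<Longrightarrow> shell_mass t P k \<le> ennreal U * T k" "0 \<le> U"
      "\<And>k. 1 \<le> k \<Longrightarrow> T k \<le> ennreal L * shell_mass t P k" "0 \<le> L" for \<nu> P U L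
    unfolding good_def using that by blast
  have good1: "good (\<lambda>z. ennreal (\<omega> z)) N"
  \<comment> \<open>The 2 comes from the factor \<open>r >= 1/2\<close> in polar
    coordinates.\<close>
  proof (rule goodI[where U=1 and L="2 * B", OF rep])
    have "shell_mass t N 0 \<le> (\<integral>\<^sup>+ r. polar_weight N r \<partial>lborel)"
      unfolding shell_mass_def by (intro nn_integral_mono) (auto simp: indicator_def)
    then show "shell_mass t N 0 < top" using fin by (rule le_less_trans)
    fix k :: nat assume k: "1 \<le> k"
    show "shell_mass t N k \<le> ennreal 1 * T k"
      unfolding shell_mass_def T_def radial_tail_def
    proof (simp, intro nn_integral_mono)
      fix r
      show "polar_weight N r * indicator (shell t k) r \<le> (if 1 - t k \<le> r \<and> r < 1 then N r else 0)"
      proof (cases "1 - t k \<le> r \<and> r < 1")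
        case True
        then have "N r * ennreal r \<le> N r * 1" by (intro mult_left_mono) (auto simp: ennreal_le_1)
        then show ?thesis using True by (auto simp: polar_weight_def indicator_def)
      next
        case False
        then have "r \<notin> shell t k \<or> r \<notin> {0..<1}" by (auto simp: shell_def)
        then show ?thesis by (auto simp: polar_weight_def)
      qed
    qed
    have "(\<integral>\<^sup>+ r. N r * indicator (shell t k) r \<partial>lborel) \<le> (\<integral>\<^sup>+ r. ennreal 2 * (polar_weight N r * indicator (shell t k) r) \<partial>lborel)"
    proof (intro nn_integral_mono)
      fix r
      show "N r * indicator (shell t k) r \<le> ennreal 2 * (polar_weight N r * indicator (shell t k) r)"
      proof (cases "r \<in> shell t k")
        case True
        then have r: "1/2 \<le> r" "r < 1" using th[OF k] t(2)[of "Suc k"] by (auto simp: shell_def)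
        then have "1 \<le> ennreal 2 * ennreal r" by (simp add: ennreal_mult[symmetric] del: ennreal_numeral)
        then have "N r * 1 \<le> N r * (ennreal 2 * ennreal r)" by (rule mult_left_mono) simp
        then show ?thesis using True r by (simp add: polar_weight_def mult_ac)
      qed simp
    qed
    also have "\<dots> = ennreal 2 * shell_mass t N k"
      unfolding shell_mass_def by (intro nn_integral_cmult) measurable
    finally have "ennreal B * (\<integral>\<^sup>+ r. N r * indicator (shell t k) r \<partial>lborel) \<le> ennreal B * (ennreal 2 * shell_mass t N k)"
      by (rule mult_left_mono) simp
    then show "T k \<le> ennreal (2 * B) * shell_mass t N k"
      using B(3)[OF k] B(1) by (simp add: T_def ennreal_mult mult_ac)
  qed (use B in auto)
  have good2: "good (regularized \<omega>) M"
  \<comment> \<open>\<open>\<Lambda>\<close> bounds the length of the shell divided by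
    \<open>1 - r\<close>. In \<open>4 * B\<close> one factor 2 comes from \<open>r >= 1/2\<close>,
    another from the length of at least \<open>t k / 2\<close>, and \<open>B\<close> leads back from
    \<open>T (Suc k)\<close> to \<open>T k\<close>.\<close>
  proof (rule goodI[where U=\<Lambda> and L="4 * B"])
    show "radial_rep (regularized \<omega>) M" unfolding M_def by (rule regularized_rep[OF rep])
    have shell_len: "emeasure lborel (shell t k) = ennreal (t k - t (Suc k))" for k
      unfolding shell_def using t(3)[of k] t(2)[of k] by simp
    have "shell_mass t M 0 \<le> (\<integral>\<^sup>+ r. ennreal (1 / t 1) * (\<integral>\<^sup>+ s. polar_weight N s \<partial>lborel) * indicator (shell t 0) r \<partial>lborel)"
      unfolding shell_mass_def
    proof (intro nn_integral_mono)
      fix r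
      show "polar_weight M r * indicator (shell t 0) r \<le> ennreal (1 / t 1) * (\<integral>\<^sup>+ s. polar_weight N s \<partial>lborel) * indicator (shell t 0) r"
      proof (cases "r \<in> shell t 0")
        case True
        then have r: "0 \<le> r" "r < 1 - t 1" "r < 1" using t(1) t(2)[of 1] by (auto simp: shell_def)
        \<comment> \<open>The tail may be unbounded near the origin; the factor \<open>r\<close>, at
          most \<open>s\<close> in the tail integral, keeps the product below the total
          mass.\<close>
        have "radial_tail N r * ennreal r = (\<integral>\<^sup>+ s. (if r \<le> s \<and> s < 1 then N s else 0) * ennreal r \<partial>lborel)"
          unfolding radial_tail_def by (intro nn_integral_multc[symmetric]) measurable
        also have "\<dots> \<le> (\<integral>\<^sup>+ s. polar_weight N s \<partial>lborel)"
          using r by (intro nn_integral_mono) (auto simp: polar_weight_def intro!: mult_left_mono ennreal_leI)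
        finally have "radial_tail N r * ennreal r * ennreal (1 / t 1) \<le> (\<integral>\<^sup>+ s. polar_weight N s \<partial>lborel) * ennreal (1 / t 1)"
          by (rule mult_right_mono) simp
        moreover have "inverse (ennreal (1 - r)) \<le> ennreal (1 / t 1)"
          using r t(2)[of 1] by (simp add: inverse_ennreal divide_inverse)
        then have "radial_tail N r * ennreal r * inverse (ennreal (1 - r)) \<le> radial_tail N r * ennreal r * ennreal (1 / t 1)"
          by (rule mult_left_mono) simp
        ultimately have "radial_tail N r * ennreal r * inverse (ennreal (1 - r)) \<le> (\<integral>\<^sup>+ s. polar_weight N s \<partial>lborel) * ennreal (1 / t 1)"
          by (rule order_trans[rotated])
        then show ?thesis using True r by (simp add: polar_weight_def M_def divide_ennreal_def mult_ac)
      qed simp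
    qed
    also have "\<dots> = ennreal (1 / t 1) * (\<integral>\<^sup>+ s. polar_weight N s \<partial>lborel) * emeasure lborel (shell t 0)"
      by (intro nn_integral_cmult_indicator) simp
    also have "\<dots> < top" using fin by (simp add: shell_len ennreal_mult_less_top)
    finally show "shell_mass t M 0 < top" .
    fix k :: nat assume k: "1 \<le> k"
    have r: "1/2 \<le> r" "r < 1" "t (Suc k) \<le> 1 - r" "1 - r \<le> t k" "1 - t k \<le> r" "r \<le> 1 - t (Suc k)" if "r \<in> shell t k" for r
      using that th[OF k] t(2)[of "Suc k"] by (auto simp: shell_def)
    have pw: "polar_weight M r * indicator (shell t k) r = radial_tail N r * ennreal (r / (1 - r)) * indicator (shell t k) r" for r
    proof (cases "r \<in> shell t k")
      case True
      have "ennreal (r / (1 - r)) = ennreal r * inverse (ennreal (1 - r))"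
      proof -
        have "0 < 1 - r" "0 \<le> r" using r[OF True] by auto
        then show ?thesis
          unfolding inverse_ennreal[OF \<open>0 < 1 - r\<close>] divide_inverse by (intro ennreal_mult) auto
      qed
      moreover have "polar_weight M r = radial_tail N r * (ennreal r * inverse (ennreal (1 - r)))"
        using r(1,2)[OF True] by (simp add: polar_weight_def M_def divide_ennreal_def mult_ac)
      ultimately show ?thesis by simp
    qed simp
    have "shell_mass t M k \<le> (\<integral>\<^sup>+ r. T k * ennreal (1 / t (Suc k)) * indicator (shell t k) r \<partial>lborel)"
      unfolding shell_mass_def pw
    proof (intro nn_integral_mono)
      fix r
      show "radial_tail N r * ennreal (r / (1 - r)) * indicator (shell t k) r \<le> T k * ennreal (1 / t (Suc k)) * indicator (shell t k) r"
      proof (cases "r \<in> shell t k")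
        case True
        have "r / (1 - r) \<le> 1 / t (Suc k)" using r[OF True] t(2)[of "Suc k"] by (intro frac_le) auto
        then have "radial_tail N r * ennreal (r / (1 - r)) \<le> T k * ennreal (1 / t (Suc k))"
          unfolding T_def using r(5)[OF True] by (intro mult_mono radial_tail_antimono ennreal_leI) auto
        then show ?thesis by (rule mult_right_mono) simp
      qed simp
    qed
    also have "\<dots> = T k * ennreal (1 / t (Suc k)) * emeasure lborel (shell t k)"
      by (intro nn_integral_cmult_indicator) simp
    also have "\<dots> = T k * (ennreal (1 / t (Suc k)) * ennreal (t k - t (Suc k)))" by (simp add: shell_len mult.assoc)
    also have "\<dots> \<le> T k * ennreal \<Lambda>"
    proof (intro mult_left_mono)
      have "1 / t (Suc k) * (t k - t (Suc k)) \<le> \<Lambda>" using t(4)[of k] t(2)[of "Suc k"] by (simp add: field_simps)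
      then show "ennreal (1 / t (Suc k)) * ennreal (t k - t (Suc k)) \<le> ennreal \<Lambda>"
        using t(2)[of "Suc k"] t(3)[of k] t(2)[of k] by (subst ennreal_mult[symmetric]) (auto intro: ennreal_leI)
    qed simp
    finally show "shell_mass t M k \<le> ennreal \<Lambda> * T k" by (simp add: mult.commute)
    have "T (Suc k) = T (Suc k) * ennreal (4 * (1 / (2 * t k)) * (t k / 2))"
      using t(2)[of k] by simp
    also have "\<dots> \<le> T (Suc k) * ennreal (4 * (1 / (2 * t k)) * (t k - t (Suc k)))"
      using t(2)[of k] t(3)[of k] by (intro mult_left_mono ennreal_leI mult_left_mono) auto
    also have "\<dots> = 4 * (T (Suc k) * ennreal (1 / (2 * t k)) * emeasure lborel (shell t k))"
      unfolding shell_len using t(2)[of k] t(3)[of k]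
      by (subst ennreal_mult, simp, simp, subst ennreal_mult) (auto simp: mult_ac)
    also have "T (Suc k) * ennreal (1 / (2 * t k)) * emeasure lborel (shell t k)
        = (\<integral>\<^sup>+ r. T (Suc k) * ennreal (1 / (2 * t k)) * indicator (shell t k) r \<partial>lborel)"
      by (intro nn_integral_cmult_indicator[symmetric]) simp
    also have "\<dots> \<le> shell_mass t M k"
      unfolding shell_mass_def pw
    proof (intro nn_integral_mono)
      fix r
      show "T (Suc k) * ennreal (1 / (2 * t k)) * indicator (shell t k) r \<le> radial_tail N r * ennreal (r / (1 - r)) * indicator (shell t k) r"
      proof (cases "r \<in> shell t k")
        case True
        have "(1/2) / t k \<le> r / (1 - r)" using r[OF True] t(2)[of k] by (intro frac_le) auto
        then have "T (Suc k) * ennreal (1 / (2 * t k)) \<le> radial_tail N r * ennreal (r / (1 - r))"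
          unfolding T_def using r(6)[OF True] by (intro mult_mono radial_tail_antimono ennreal_leI) auto
        then show ?thesis by (rule mult_right_mono) simp
      qed simp
    qed
    finally have "T (Suc k) \<le> 4 * shell_mass t M k" by (simp add: mult_left_mono)
    then have "ennreal B * T (Suc k) \<le> ennreal B * (4 * shell_mass t M k)" by (rule mult_left_mono) simp
    then show "T k \<le> ennreal (4 * B) * shell_mass t M k"
      using B(2)[OF k] B(1) by (simp add: T_def ennreal_mult mult_ac)
  qed (use B t(5) in auto)
  obtain P P' where P: "good \<nu> P" "good \<nu>' P'"
    using good1 good2 \<nu> by blast
  from P obtain U U' L where "0 \<le> U" "\<And>k. 1 \<le> k \<Longrightarrow> shell_mass t P k \<le> ennreal U * T k"
    "0 \<le> U'" "\<And>k. 1 \<le> k \<Longrightarrow> shell_mass t P' k \<le> ennreal U' * T k" "0 \<le> L" "\<And>k. 1 \<le> k \<Longrightarrow> T k \<le> ennreal L * shell_mass t P k"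
    unfolding good_def by blast
  moreover have "radial_rep \<nu> P" "radial_rep \<nu>' P'" "shell_mass t P' 0 < top"
    using P unfolding good_def by blast+
  ultimately show ?thesis
    using B(1,2) by (intro mixed_norm_le_of_shell_mass[OF pq t, of _ P _ P' T B U U' L] Tpos Tfin) (auto simp: T_def)
qed

section \<open>From the norm equivalences to the class D\<close>

text \<open>\<open>m\<close> and \<open>\<phi>\<close> stand for the moments of the weight and of
  its regularization, \<open>\<tau> x\<close> for the tail at \<open>1 - 1/x\<close>. The two
  comparability assumptions concern multiples of \<open>p\<close>, the exponents produced by
  monomials; the remaining ones are general estimates for radial weights.\<close>

locale moment_comparison =
  fixes m \<phi> \<tau> :: "real \<Rightarrow> real" and p C :: real
  assumes p: "0 < p" and C: "1 \<le> C"
    and phi_antimono: "\<And>x y. 0 \<le> x \<Longrightarrow> x \<le> y \<Longrightarrow> \<phi> y \<le> \<phi> x"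
    and tau_antimono: "\<And>x y. 2 \<le> x \<Longrightarrow> x \<le> y \<Longrightarrow> \<tau> y \<le> \<tau> x"
    and tau_nonneg: "\<And>x. 2 \<le> x \<Longrightarrow> 0 \<le> \<tau> x"
    and m_le: "\<And>n::nat. m (n * p) \<le> C * \<phi> (n * p)"
    and phi_le: "\<And>n::nat. \<phi> (n * p) \<le> C * m (n * p)"
    and phi_diff: "\<And>x y. 0 \<le> x \<Longrightarrow> x + 1 \<le> y \<Longrightarrow> \<phi> x \<le> \<phi> y + (y - x) / (x + 1) * m x"
    and m_split: "\<And>x y L. 2 \<le> x \<Longrightarrow> 1 \<le> L \<Longrightarrow> L * x \<le> y \<Longrightarrow> m y \<le> exp (- (L - 1)) * m x + \<tau> x"
    and m_ge: "\<And>x. 2 \<le> x \<Longrightarrow> exp (- 3) * \<tau> x \<le> m x"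
    and phi_ge: "\<And>x j. 2 \<le> x \<Longrightarrow> exp (- 3) * (real j / 2) * \<tau> (2 ^ j * x) \<le> \<phi> x"
begin

text \<open>Chosen with \<open>C * \<eta> = 1/2\<close>, so that an error
  \<open>\<eta> * m x <= \<eta> * C * \<phi> x\<close> can be absorbed.\<close>

definition "\<eta> = 1 / (2 * C)"

text \<open>Smaller than \<open>1 + \<eta>\<close>, which leaves room for rounding to a multiple of
  \<open>p\<close>.\<close>

definition "\<kappa> = 1 + \<eta> / 2"

lemma eta: "0 < \<eta>" "\<eta> \<le> 1/2" "C * \<eta> = 1/2"
  using C by (auto simp: \<eta>_def)

lemma kappa: "1 < \<kappa>" using eta by (simp add: \<kappa>_def)

lemma below:
  assumes "0 \<le> x"
  obtains n :: nat where "n * p \<le> x" "x < n * p + p"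
proof (rule that)
  have "of_int \<lfloor>x / p\<rfloor> \<le> x / p" "x / p < of_int \<lfloor>x / p\<rfloor> + 1" by linarith+
  then have "of_int \<lfloor>x / p\<rfloor> * p \<le> x" "x < (of_int \<lfloor>x / p\<rfloor> + 1) * p"
    using p by (simp_all only: pos_le_divide_eq pos_divide_less_eq)
  moreover have "0 \<le> \<lfloor>x / p\<rfloor>" using assms p by simp
  ultimately show "real (nat \<lfloor>x / p\<rfloor>) * p \<le> x" "x < real (nat \<lfloor>x / p\<rfloor>) * p + p"
    by (simp_all add: algebra_simps)
qed

lemma above:
  assumes "0 \<le> x"
  obtains n :: nat where "x \<le> n * p" "n * p \<le> x + p"
proof -
  obtain n :: nat where "n * p \<le> x" "x < n * p + p" using below[OF assms] by blast
  then show thesis using that[of "Suc n"] by (simp add: algebra_simps)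
qed

text \<open>Going from \<open>x\<close> to \<open>(1 + \<eta>) * x\<close> lowers
  \<open>\<phi>\<close> by at most \<open>\<eta> * C * \<phi> x\<close>, half of its value. The
  first bound on \<open>u\<close> gives \<open>\<eta> * x >= 1\<close>, as \<open>phi_diff\<close>
  requires; the second pays for replacing \<open>u\<close> by the multiple \<open>x\<close> of
  \<open>p\<close> below it.\<close>

lemma phi_step:
  assumes u: "1 / \<eta> + p \<le> u" "2 * (1 + \<eta>) * p / \<eta> \<le> u"
  shows "\<phi> u \<le> 2 * \<phi> (\<kappa> * u)"
proof -
  have "0 < 1 / \<eta>" using eta by simp
  then have "0 \<le> u" using u p by linarith
  then obtain n :: nat where n: "n * p \<le> u" "u < n * p + p" using below by blast
  define x where "x = n * p"
  have x: "0 \<le> x" "1 / \<eta> \<le> x" "x \<le> u" "u - p \<le> x" using n u p by (auto simp: x_def)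
  have "1 \<le> \<eta> * x" using x eta by (simp add: field_simps)
  then have "\<phi> x \<le> \<phi> ((1 + \<eta>) * x) + ((1 + \<eta>) * x - x) / (x + 1) * m x"
    using x by (intro phi_diff) (auto simp: algebra_simps)
  also have "((1 + \<eta>) * x - x) / (x + 1) * m x \<le> \<eta> * (C * \<phi> x)"
  proof -
    have m0: "0 \<le> C * \<phi> x"
    proof -
      have "\<phi> (x + 2) \<le> \<phi> x" using x by (intro phi_antimono) auto
      moreover have "0 \<le> \<phi> (x + 2)" using phi_ge[of "x + 2" 0] x by simp
      ultimately show ?thesis using C by simp
    qed
    have "((1 + \<eta>) * x - x) / (x + 1) = \<eta> * (x / (x + 1))" by (simp add: algebra_simps)
    also have "\<dots> \<le> \<eta> * 1" using x eta by (intro mult_left_mono) auto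
    finally have a: "((1 + \<eta>) * x - x) / (x + 1) \<le> \<eta>" by simp
    have b: "0 \<le> ((1 + \<eta>) * x - x) / (x + 1)" using x eta by (simp add: algebra_simps)
    have "((1 + \<eta>) * x - x) / (x + 1) * m x \<le> ((1 + \<eta>) * x - x) / (x + 1) * (C * \<phi> x)"
      using b m_le[of n] by (intro mult_left_mono) (auto simp: x_def)
    also have "\<dots> \<le> \<eta> * (C * \<phi> x)" using a m0 by (rule mult_right_mono)
    finally show ?thesis .
  qed
  also have "\<eta> * (C * \<phi> x) = C * \<eta> * \<phi> x" by simp
  also have "\<dots> = 1 / 2 * \<phi> x" by (simp only: eta(3))
  finally have "\<phi> x \<le> 2 * \<phi> ((1 + \<eta>) * x)" by simp
  also have "\<phi> ((1 + \<eta>) * x) \<le> \<phi> (\<kappa> * u)"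
  proof (intro phi_antimono)
    have "(1 + \<eta>) * (u - p) \<le> (1 + \<eta>) * x" using x eta by (intro mult_left_mono) auto
    moreover have "(1 + \<eta>) * p \<le> \<eta> / 2 * u" using u(2) eta by (simp add: field_simps)
    ultimately show "\<kappa> * u \<le> (1 + \<eta>) * x" by (simp add: \<kappa>_def algebra_simps)
    show "0 \<le> \<kappa> * u" using kappa \<open>0 \<le> u\<close> by simp
  qed
  finally have "\<phi> x \<le> 2 * \<phi> (\<kappa> * u)" by simp
  moreover have "\<phi> u \<le> \<phi> x" using x by (intro phi_antimono) auto
  ultimately show ?thesis by simp
qed

definition "X0 = max 2 (max (1 / \<eta> + p) (2 * (1 + \<eta>) * p / \<eta>))"

lemma phi_iterate:
  assumes "X0 \<le> u"
  shows "\<phi> u \<le> 2 ^ i * \<phi> (\<kappa> ^ i * u)"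
proof (induction i)
  case (Suc i)
  have "2 \<le> u" using assms by (simp add: X0_def)
  have "1 \<le> \<kappa> ^ i" using kappa by (intro one_le_power) simp
  then have "1 * u \<le> \<kappa> ^ i * u" using \<open>2 \<le> u\<close> by (intro mult_right_mono) auto
  moreover have "1 / \<eta> + p \<le> u" "2 * (1 + \<eta>) * p / \<eta> \<le> u"
    using assms by (auto simp: X0_def)
  ultimately have "\<phi> (\<kappa> ^ i * u) \<le> 2 * \<phi> (\<kappa> * (\<kappa> ^ i * u))"
    by (intro phi_step) linarith+
  then have "2 ^ i * \<phi> (\<kappa> ^ i * u) \<le> 2 ^ i * (2 * \<phi> (\<kappa> * (\<kappa> ^ i * u)))"
    by (intro mult_left_mono) auto
  with Suc have "\<phi> u \<le> 2 ^ i * (2 * \<phi> (\<kappa> * (\<kappa> ^ i * u)))" by (rule order_trans)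
  then show ?case by (simp add: mult_ac)
qed simp

lemma phi_le_scaled:
  assumes "X0 \<le> u" "c \<le> \<kappa> ^ i" "0 \<le> c"
  shows "\<phi> u \<le> 2 ^ i * \<phi> (c * u)"
proof -
  have "2 \<le> u" using assms by (simp add: X0_def)
  have "\<phi> u \<le> 2 ^ i * \<phi> (\<kappa> ^ i * u)" by (rule phi_iterate) fact
  also have "\<dots> \<le> 2 ^ i * \<phi> (c * u)"
    using assms \<open>2 \<le> u\<close> by (intro mult_left_mono phi_antimono mult_right_mono) auto
  finally show ?thesis .
qed

text \<open>
  The doubling of \<open>\<phi>\<close> makes \<open>m\<close> decay at most polynomially along \<open>y = L x\<close>, which the factor
  \<open>exp (- (L - 1))\<close> in \<open>m_split\<close> beats for large \<open>L\<close>; hence the tail carries the moment.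
\<close>
lemma m_le_tau:
  obtains D X where "0 < D" "\<And>n::nat. X \<le> n * p \<Longrightarrow> m (n * p) \<le> D * \<tau> (n * p)"
proof -
  \<comment> \<open>\<open>\<kappa>^i1 > 2\<close> turns the loss \<open>2^i\<close> of
    \<open>i\<close> doubling steps into the power \<open>L^i1\<close> of the ratio
    \<open>L = \<kappa>^i\<close>.\<close>
  obtain i1 where i1: "2 < \<kappa> ^ i1" using real_arch_pow[OF kappa] by blast
  have "((\<lambda>z::real. z ^ i1 / exp z) \<longlongrightarrow> 0) at_top" by (rule tendsto_power_div_exp_0)
  moreover have "filterlim (\<lambda>i. \<kappa> ^ i) at_top sequentially"
  proof (rule filterlim_at_infinity_imp_filterlim_at_top)
    show "filterlim (\<lambda>i. \<kappa> ^ i) at_infinity sequentially"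
      using kappa by (intro filterlim_realpow_sequentially_gt1) auto
    show "\<forall>\<^sub>F i in sequentially. 0 < \<kappa> ^ i" using kappa by (intro always_eventually) auto
  qed
  ultimately have "(\<lambda>i. (\<kappa> ^ i) ^ i1 / exp (\<kappa> ^ i)) \<longlonglongrightarrow> 0" by (rule filterlim_compose)
  moreover have "0 < 1 / (2 * C\<^sup>2 * 2 ^ i1 * exp 1)" using C by simp
  ultimately have "\<forall>\<^sub>F i in sequentially. (\<kappa> ^ i) ^ i1 / exp (\<kappa> ^ i) < 1 / (2 * C\<^sup>2 * 2 ^ i1 * exp 1)"
    by (rule order_tendstoD(2))
  then obtain i where i: "(\<kappa> ^ i) ^ i1 / exp (\<kappa> ^ i) < 1 / (2 * C\<^sup>2 * 2 ^ i1 * exp 1)"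
    by (auto simp: eventually_sequentially)
  define L where "L = \<kappa> ^ i"
  have L: "1 \<le> L" unfolding L_def using kappa by (intro one_le_power) simp
  \<comment> \<open>The extra \<open>2^i1\<close> allows the ratio \<open>2 * L\<close>, the room
    for rounding \<open>L * x\<close> up to a multiple of \<open>p\<close>.\<close>
  define A where "A = C\<^sup>2 * 2 ^ (i + i1)"
  have "A > 0" using C by (simp add: A_def)
  have AL: "A * exp (- (L - 1)) \<le> 1/2"
  proof -
    have "(2::real) ^ i \<le> (\<kappa> ^ i1) ^ i" using i1 by (intro power_mono) auto
    also have "\<dots> = L ^ i1" by (simp add: L_def power_mult[symmetric] mult.commute)
    finally have "2 ^ i \<le> L ^ i1" .
    then have "2 ^ i / exp L \<le> L ^ i1 / exp L" by (intro divide_right_mono) auto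
    also have "\<dots> \<le> 1 / (2 * C\<^sup>2 * 2 ^ i1 * exp 1)" using i by (simp add: L_def)
    finally have "2 ^ i * (2 * C\<^sup>2 * 2 ^ i1 * exp 1) \<le> exp L" using C by (simp add: field_simps)
    then show ?thesis by (simp add: A_def exp_diff exp_minus power_add field_simps)
  qed
  show thesis
  proof (rule that)
    show "0 < 2 * A" using \<open>A > 0\<close> by simp
    fix n :: nat assume n: "max X0 p \<le> n * p"
    define x where "x = n * p"
    have x: "X0 \<le> x" "p \<le> x" "2 \<le> x" using n by (auto simp: x_def X0_def)
    have "0 \<le> L * x" using L x by simp
    then obtain k :: nat where k: "L * x \<le> k * p" "k * p \<le> L * x + p" using above by blast
    define y where "y = k * p"
    have "x \<le> L * x" using L x mult_right_mono[of 1 L x] by simp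
    then have y: "L * x \<le> y" "y \<le> (2 * L) * x"
      using k x unfolding y_def mult.assoc by linarith+
    have "m x \<le> C * \<phi> x" using m_le[of n] by (simp add: x_def)
    also have "\<phi> x \<le> 2 ^ (i + i1) * \<phi> ((2 * L) * x)"
    proof (rule phi_le_scaled[OF x(1)])
      have "L * 2 \<le> \<kappa> ^ i * \<kappa> ^ i1" unfolding L_def using kappa i1 by (intro mult_left_mono) auto
      then show "2 * L \<le> \<kappa> ^ (i + i1)" by (simp add: power_add)
    qed (use L in simp)
    also have "\<phi> ((2 * L) * x) \<le> \<phi> y" using y L x by (intro phi_antimono) (auto intro: order_trans[OF \<open>0 \<le> L * x\<close>])
    also have "\<phi> y \<le> C * m y" using phi_le[of k] by (simp add: y_def)
    finally have "m x \<le> A * m y" using C by (simp add: A_def power2_eq_square mult_left_mono mult_ac)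
    also have "\<dots> \<le> A * (exp (- (L - 1)) * m x + \<tau> x)"
      using \<open>A > 0\<close> x L y by (intro mult_left_mono m_split) auto
    also have "\<dots> = (A * exp (- (L - 1))) * m x + A * \<tau> x" by (simp add: algebra_simps)
    also have "\<dots> \<le> 1/2 * m x + A * \<tau> x"
    proof -
      have "0 \<le> m x" using m_ge[of x] tau_nonneg[of x] x by (smt (verit) exp_ge_zero mult_nonneg_nonneg)
      then show ?thesis using AL by (intro add_right_mono mult_right_mono)
    qed
    finally show "m (n * p) \<le> 2 * A * \<tau> (n * p)" by (simp add: x_def)
  qed
qed

text \<open>The doubling condition for the tail, \<open>2 * x\<close> corresponding to the midpoint
  \<open>(1 + r) / 2\<close>. The comparison passes through \<open>\<phi>\<close>, whose doubling is
  known; both roundings keep the final exponent below \<open>6 * u\<close>.\<close>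

lemma tau_doubling:
  obtains D X where "0 < D" "\<And>x. X \<le> x \<Longrightarrow> \<tau> x \<le> D * \<tau> (2 * x)"
proof -
  obtain D X where D: "0 < D" "\<And>n::nat. X \<le> n * p \<Longrightarrow> m (n * p) \<le> D * \<tau> (n * p)" using m_le_tau by blast
  obtain i where i: "6 < \<kappa> ^ i" using real_arch_pow[OF kappa] by blast
  show thesis
  proof (rule that)
    show "0 < exp 3 * (C * (2 ^ i * (C * D)))" using C D by simp
    fix x assume "max (max (2 * X0) (2 * p)) X \<le> x"
    moreover have "2 \<le> X0" by (simp add: X0_def)
    ultimately have x: "2 * X0 \<le> x" "2 * p \<le> x" "X \<le> x" "4 \<le> x" by auto
    obtain n :: nat where n: "n * p \<le> x" "x < n * p + p" using below[of x] x by auto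
    define u where "u = n * p"
    have u: "u \<le> x" "x \<le> 2 * u" "X0 \<le> u" "2 \<le> u" using n x by (auto simp: u_def)
    obtain k :: nat where k: "2 * x \<le> k * p" "k * p \<le> 2 * x + p" using above[of "2 * x"] x by auto
    define y where "y = k * p"
    have y: "2 * x \<le> y" "y \<le> 6 * u" "X \<le> y" using k x u by (auto simp: y_def)
    have "\<tau> x \<le> \<tau> u" using u by (intro tau_antimono)
    also have "\<tau> u \<le> exp 3 * m u"
      using m_ge[of u] u by (simp add: exp_minus field_simps)
    also have "m u \<le> C * \<phi> u" using m_le[of n] by (simp add: u_def)
    also have "\<phi> u \<le> 2 ^ i * \<phi> (6 * u)" using i u by (intro phi_le_scaled) auto
    also have "\<phi> (6 * u) \<le> \<phi> y" using y x by (intro phi_antimono) auto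
    also have "\<phi> y \<le> C * m y" using phi_le[of k] by (simp add: y_def)
    also have "m y \<le> D * \<tau> y" using D(2)[of k] y by (simp add: y_def)
    also have "\<tau> y \<le> \<tau> (2 * x)" using y x by (intro tau_antimono) auto
    finally show "\<tau> x \<le> exp 3 * (C * (2 ^ i * (C * D))) * \<tau> (2 * x)"
      using C D by (simp add: mult_left_mono mult.assoc)
  qed
qed

text \<open>By \<open>phi_ge\<close>, \<open>j\<close> shells beyond \<open>u\<close> each
  contribute a fixed multiple of the tail at the far end, while \<open>\<phi> u\<close> is at most
  \<open>C * D * \<tau> u\<close>; a large \<open>j\<close> forces the tail to halve. The ratio is
  \<open>2 ^ Suc j\<close> because rounding may double the exponent.\<close>

lemma tau_decay:
  obtains K X where "1 < K" "\<And>x. X \<le> x \<Longrightarrow> 2 * \<tau> (K * x) \<le> \<tau> x"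
proof -
  obtain D X where D: "0 < D" "\<And>n::nat. X \<le> n * p \<Longrightarrow> m (n * p) \<le> D * \<tau> (n * p)" using m_le_tau by blast
  obtain j :: nat where j: "4 * exp 3 * (C * D) \<le> real j" using real_arch_simple by blast
  have "0 < 4 * exp 3 * (C * D)" using C D by simp
  then have "0 < real j" using j by linarith
  show thesis
  proof (rule that)
    show "1 < (2::real) ^ Suc j" by (rule one_less_power) auto
    fix x assume "max (max 2 p) X \<le> x"
    then have x: "2 \<le> x" "p \<le> x" "X \<le> x" by auto
    obtain n :: nat where n: "x \<le> n * p" "n * p \<le> x + p" using above[of x] x by auto
    define u where "u = n * p"
    have u: "x \<le> u" "u \<le> 2 * x" "2 \<le> u" using n x by (auto simp: u_def)
    have "exp (- 3) * (real j / 2) * \<tau> (2 ^ Suc j * x) \<le> exp (- 3) * (real j / 2) * \<tau> (2 ^ j * u)"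
    proof (intro mult_left_mono tau_antimono)
      show "2 ^ j * u \<le> 2 ^ Suc j * x" using u by simp
      have "1 * u \<le> 2 ^ j * u" using u by (intro mult_right_mono) auto
      then show "2 \<le> 2 ^ j * u" using u by linarith
    qed auto
    also have "\<dots> \<le> \<phi> u" using u by (intro phi_ge) auto
    also have "\<dots> \<le> C * m u" using phi_le[of n] by (simp add: u_def)
    also have "m u \<le> D * \<tau> u" using D(2)[of n] n x by (simp add: u_def)
    also have "\<tau> u \<le> \<tau> x" using u x by (intro tau_antimono)
    finally have "exp (- 3) * (real j / 2) * \<tau> (2 ^ Suc j * x) \<le> C * D * \<tau> x"
      using C D by (simp add: mult_left_mono mult.assoc)
    then have "real j * \<tau> (2 ^ Suc j * x) \<le> 2 * exp 3 * (C * D) * \<tau> x"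
      by (simp add: exp_minus field_simps)
    also have "\<dots> \<le> real j / 2 * \<tau> x"
      using j tau_nonneg[of x] x by (intro mult_right_mono) auto
    finally show "2 * \<tau> (2 ^ Suc j * x) \<le> \<tau> x"
      using \<open>0 < real j\<close> by (simp add: field_simps)
  qed
qed

end

section \<open>Moments and monomials\<close>

definition moment :: "(real \<Rightarrow> ennreal) \<Rightarrow> real \<Rightarrow> ennreal" where
  "moment N x = (\<integral>\<^sup>+ r. ennreal (r powr x) * polar_weight N r \<partial>lborel)"

lemma moment_antimono:
  assumes "x \<le> y" shows "moment N y \<le> moment N x"
  unfolding moment_def
proof (intro nn_integral_mono)
  fix r
  show "ennreal (r powr y) * polar_weight N r \<le> ennreal (r powr x) * polar_weight N r"
  proof (cases "0 < r \<and> r < 1")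
    case True
    then show ?thesis using assms by (intro mult_right_mono ennreal_leI powr_mono') auto
  next
    case False
    then have "polar_weight N r = 0" by (auto simp: polar_weight_def indicator_def ennreal_neg)
    then show ?thesis by simp
  qed
qed

lemma moment_le: "0 \<le> x \<Longrightarrow> moment N x \<le> (\<integral>\<^sup>+ r. polar_weight N r \<partial>lborel)"
proof -
  assume "0 \<le> x"
  then have "moment N x \<le> moment N 0" by (rule moment_antimono)
  also have "\<dots> \<le> (\<integral>\<^sup>+ r. polar_weight N r \<partial>lborel)"
    unfolding moment_def by (intro nn_integral_mono) (auto simp: powr_def)
  finally show ?thesis .
qed

lemma disc_powr_monomial:
  assumes "0 < r" "r < 1"
  shows "disc_powr p (\<lambda>z. z ^ n) r x = ennreal (r powr (n * p))"
proof -
  have "cmod (rcis r x ^ n) = r powr n"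
    using assms by (simp add: norm_power powr_realpow)
  then show ?thesis using assms by (simp add: disc_powr_eq powr_powr)
qed

text \<open>The modulus of a monomial is constant on circles, so an arc average only adds the
  normalized measure of an arc, which lies between 1 and 12.\<close>

lemma density_monomial_times_weight:
  shows "upper_density tent p (\<lambda>z. z ^ n) r x * polar_weight N r \<le> 12 * (ennreal (r powr (n * p)) * polar_weight N r)"
    and "ennreal (r powr (n * p)) * polar_weight N r \<le> lower_density tent p (\<lambda>z. z ^ n) r x * polar_weight N r"
proof -
  have zero: "polar_weight N r = 0" if "\<not> (0 < r \<and> r < 1)"
    using that by (auto simp: polar_weight_def indicator_def ennreal_neg)
  show "upper_density tent p (\<lambda>z. z ^ n) r x * polar_weight N r \<le> 12 * (ennreal (r powr (n * p)) * polar_weight N r)"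
  proof (cases "0 < r \<and> r < 1")
    case True
    then have "upper_density tent p (\<lambda>z. z ^ n) r x \<le> 12 * ennreal (r powr (n * p))"
      by (intro upper_density_le) (auto simp: disc_powr_monomial)
    then show ?thesis by (simp add: mult.assoc[symmetric] mult_right_mono)
  qed (simp add: zero)
  show "ennreal (r powr (n * p)) * polar_weight N r \<le> lower_density tent p (\<lambda>z. z ^ n) r x * polar_weight N r"
  proof (cases "0 < r \<and> r < 1")
    case True
    have "ennreal (r powr (n * p)) \<le> lower_density tent p (\<lambda>z. z ^ n) r x"
    proof (cases tent)
      case tent: True
      define s where "s = (1 - r) / 4"
      define v where "v = ennreal (r powr (n * p))"
      have s: "0 < s" "s \<le> 2" using True by (auto simp: s_def)
      have [measurable]: "{y. chord x y \<le> s} \<in> sets borel"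
        unfolding chord_def by measurable
      have "v = v * (ennreal (1 / s) * ennreal s)" using s by (simp add: ennreal_mult[symmetric])
      also have "\<dots> \<le> v * (ennreal (1 / s) * emeasure arc_measure {y. chord x y \<le> s})"
        using s by (intro mult_left_mono chord_growth_lower) auto
      also have "\<dots> = ennreal (1 / s) * (\<integral>\<^sup>+ y. v * indicator {y. chord x y \<le> s} y \<partial>arc_measure)"
        by (subst nn_integral_cmult_indicator) (auto simp: mult_ac)
      also have "\<dots> = lower_density tent p (\<lambda>z. z ^ n) r x"
        unfolding lower_density_def circle.avg_def s_def[symmetric] using tent True
        by (auto intro!: arg_cong[where f="(*) _"] nn_integral_cong simp: disc_powr_monomial v_def)
      finally show ?thesis by (simp add: v_def)
    next
      case False
      then show ?thesis using True by (simp add: lower_density_def disc_powr_monomial)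
    qed
    then show ?thesis by (rule mult_right_mono) simp
  qed (simp add: zero)
qed

text \<open>The bounds for the densities are independent of the angle, so the outer integral
  contributes only the length \<open>2 * pi\<close>. The constants serve all \<open>n\<close> and
  all radial \<open>\<nu>\<close> at once.\<close>

lemma mixed_norm_monomial:
  assumes pq: "0 < p" "0 < q"
  obtains c c' where "0 < c" "0 < c'" "\<And>\<nu> N n. radial_rep \<nu> N \<Longrightarrow>
    mixed_norm tent q p \<nu> (\<lambda>z. z ^ n) \<le> ennreal c * enn_powr (moment N (n * p)) (1 / p) \<and>
    ennreal c' * enn_powr (moment N (n * p)) (1 / p) \<le> mixed_norm tent q p \<nu> (\<lambda>z. z ^ n)"
proof -
  obtain a where a: "0 < a" "\<And>\<nu> N f. radial_rep \<nu> N \<Longrightarrow> f holomorphic_on ball 0 1 \<Longrightarrow>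
    mixed_norm tent q p \<nu> f \<le> enn_powr (ennreal a *
      (\<integral>\<^sup>+ x. enn_powr (\<integral>\<^sup>+ r. upper_density tent p f r x * polar_weight N r \<partial>lborel) (q / p) \<partial>arc_measure)) (1 / q)"
    using mixed_norm_le[OF pq] by blast
  obtain a' where a': "0 < a'" "\<And>\<nu> N f. radial_rep \<nu> N \<Longrightarrow> f holomorphic_on ball 0 1 \<Longrightarrow>
    enn_powr (ennreal a' *
      (\<integral>\<^sup>+ x. enn_powr (\<integral>\<^sup>+ r. lower_density tent p f r x * polar_weight N r \<partial>lborel) (q / p) \<partial>arc_measure)) (1 / q)
    \<le> mixed_norm tent q p \<nu> f"
    using mixed_norm_ge[OF pq] by blast
  have total: "emeasure arc_measure (space arc_measure) = ennreal (2 * pi)" by (simp add: emeasure_arc_measure)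
  have hol: "(\<lambda>z. z ^ n) holomorphic_on ball 0 1" for n :: nat by (intro holomorphic_intros)
  show thesis
  proof (rule that)
    show "0 < (a * (12 powr (q / p) * (2 * pi))) powr (1 / q)" "0 < (a' * (2 * pi)) powr (1 / q)"
      using a a' by simp_all
    fix \<nu> N and n :: nat assume rep: "radial_rep \<nu> N"
    have [measurable]: "N \<in> borel_measurable borel" using rep unfolding radial_rep_def by blast
    let ?m = "moment N (n * p)"
    have "mixed_norm tent q p \<nu> (\<lambda>z. z ^ n) \<le> enn_powr (ennreal a *
      (\<integral>\<^sup>+ x. enn_powr (\<integral>\<^sup>+ r. upper_density tent p (\<lambda>z. z ^ n) r x * polar_weight N r \<partial>lborel) (q / p) \<partial>arc_measure)) (1 / q)"
      by (rule a(2)[OF rep hol])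
    also have "\<dots> \<le> enn_powr (ennreal a * (\<integral>\<^sup>+ x. enn_powr (12 * ?m) (q / p) \<partial>arc_measure)) (1 / q)"
    proof (intro enn_powr_mono mult_left_mono nn_integral_mono)
      fix x
      have "(\<integral>\<^sup>+ r. upper_density tent p (\<lambda>z. z ^ n) r x * polar_weight N r \<partial>lborel)
        \<le> (\<integral>\<^sup>+ r. 12 * (ennreal (r powr (n * p)) * polar_weight N r) \<partial>lborel)"
        by (intro nn_integral_mono density_monomial_times_weight)
      also have "\<dots> = 12 * ?m" unfolding moment_def by (intro nn_integral_cmult) measurable
      finally show "(\<integral>\<^sup>+ r. upper_density tent p (\<lambda>z. z ^ n) r x * polar_weight N r \<partial>lborel) \<le> 12 * ?m" .
    qed (use pq in auto)
    also have "\<dots> = enn_powr (ennreal (a * (12 powr (q / p) * (2 * pi))) * enn_powr ?m (q / p)) (1 / q)"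
      using a enn_powr_ennreal[of 12 "q / p"]
      by (simp add: total[simplified] enn_powr_mult ennreal_mult mult_ac)
    also have "\<dots> = ennreal ((a * (12 powr (q / p) * (2 * pi))) powr (1 / q)) * enn_powr ?m (1 / p)"
      using a pq by (simp add: enn_powr_mult enn_powr_powr)
    finally have 1: "mixed_norm tent q p \<nu> (\<lambda>z. z ^ n) \<le> \<dots>" .
    have "ennreal ((a' * (2 * pi)) powr (1 / q)) * enn_powr ?m (1 / p)
      = enn_powr (ennreal (a' * (2 * pi)) * enn_powr ?m (q / p)) (1 / q)"
      using a' pq by (simp add: enn_powr_mult enn_powr_powr)
    also have "\<dots> = enn_powr (ennreal a' * (\<integral>\<^sup>+ x. enn_powr ?m (q / p) \<partial>arc_measure)) (1 / q)"
      using a' by (simp add: total[simplified] ennreal_mult mult_ac)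
    also have "\<dots> \<le> enn_powr (ennreal a' *
      (\<integral>\<^sup>+ x. enn_powr (\<integral>\<^sup>+ r. lower_density tent p (\<lambda>z. z ^ n) r x * polar_weight N r \<partial>lborel) (q / p) \<partial>arc_measure)) (1 / q)"
      unfolding moment_def
      by (intro enn_powr_mono mult_left_mono nn_integral_mono density_monomial_times_weight) (use pq in auto)
    also have "\<dots> \<le> mixed_norm tent q p \<nu> (\<lambda>z. z ^ n)" by (rule a'(2)[OF rep hol])
    finally have 2: "ennreal ((a' * (2 * pi)) powr (1 / q)) * enn_powr ?m (1 / p) \<le> mixed_norm tent q p \<nu> (\<lambda>z. z ^ n)" .
    show "mixed_norm tent q p \<nu> (\<lambda>z. z ^ n) \<le> ennreal ((a * (12 powr (q / p) * (2 * pi))) powr (1 / q)) * enn_powr ?m (1 / p) \<and>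
      ennreal ((a' * (2 * pi)) powr (1 / q)) * enn_powr ?m (1 / p) \<le> mixed_norm tent q p \<nu> (\<lambda>z. z ^ n)"
      using 1 2 by blast
  qed
qed

section \<open>Moments against tails\<close>

lemma powr_le_exp:
  fixes r x a :: real
  assumes "0 < r" "r \<le> 1 - 1 / x" "0 < x" "0 \<le> a"
  shows "r powr (a * x) \<le> exp (- a)"
proof -
  have "ln r \<le> r - 1" using ln_le_minus_one[of r] assms by simp
  also have "\<dots> \<le> - 1 / x" using assms by simp
  finally have "a * x * ln r \<le> a * x * (- 1 / x)" using assms by (intro mult_left_mono) auto
  then show ?thesis using assms by (simp add: powr_def)
qed

text \<open>The extra factor \<open>r\<close> comes from polar coordinates and makes the exponent
  \<open>x + 1\<close>. The number 3 is the worst case, \<open>x = 2\<close>, of the lower bound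
  used for the logarithm.\<close>

lemma exp_le_powr_mult:
  fixes x r :: real
  assumes "2 \<le> x" "1 - 1 / x \<le> r" "r < 1"
  shows "exp (- 3) \<le> r powr x * r"
proof -
  have x: "0 \<le> 1 / x" "1 / x \<le> 1/2" using assms by (auto simp: field_simps)
  have "0 < r" using x assms by linarith
  have "- (1 / x) - 2 * (1 / x)\<^sup>2 \<le> ln (1 - 1 / x)" using x by (intro ln_one_minus_pos_lower_bound) auto
  also have "\<dots> \<le> ln r" using assms x \<open>0 < r\<close> by (subst ln_le_cancel_iff) auto
  finally have "(x + 1) * (- (1 / x) - 2 * (1 / x)\<^sup>2) \<le> (x + 1) * ln r"
    using assms by (intro mult_left_mono) auto
  moreover have "- 3 \<le> (x + 1) * (- (1 / x) - 2 * (1 / x)\<^sup>2)"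
  proof -
    have "(x + 1) * (- (1 / x) - 2 * (1 / x)\<^sup>2) = - ((1 + 1 / x) * (1 + 2 * (1 / x)))"
      using assms by (simp add: field_simps power2_eq_square)
    moreover have "(1 + 1 / x) * (1 + 2 * (1 / x)) \<le> (3/2) * 2" using x by (intro mult_mono) auto
    ultimately show ?thesis by simp
  qed
  ultimately have "exp (- 3) \<le> exp ((x + 1) * ln r)" by simp
  also have "\<dots> = r powr x * r"
    using \<open>0 < r\<close> by (simp add: powr_def algebra_simps exp_add)
  finally show ?thesis .
qed

text \<open>Radii below \<open>1 - 1/x\<close> satisfy
  \<open>r powr ((L - 1) * x) <= exp (-(L - 1))\<close>; above, the power is bounded by 1 and the
  tail remains.\<close>

lemma moment_split:
  assumes [measurable]: "N \<in> borel_measurable borel" and "2 \<le> x" "1 \<le> L" "L * x \<le> y"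
  shows "moment N y \<le> ennreal (exp (- (L - 1))) * moment N x + radial_tail N (1 - 1 / x)"
proof -
  have "moment N y \<le> (\<integral>\<^sup>+ r. ennreal (exp (- (L - 1))) * (ennreal (r powr x) * polar_weight N r)
      + (if 1 - 1 / x \<le> r \<and> r < 1 then N r else 0) \<partial>lborel)"
    unfolding moment_def
  proof (intro nn_integral_mono)
    fix r
    show "ennreal (r powr y) * polar_weight N r \<le> ennreal (exp (- (L - 1))) * (ennreal (r powr x) * polar_weight N r)
      + (if 1 - 1 / x \<le> r \<and> r < 1 then N r else 0)"
    proof (cases "0 < r \<and> r < 1")
      case False
      then have "polar_weight N r = 0" by (auto simp: polar_weight_def indicator_def ennreal_neg)
      then show ?thesis by simp
    next
      case r: True
      show ?thesis
      proof (cases "1 - 1 / x \<le> r")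
        case True
        have "0 \<le> L * x" using assms by simp
        then have "0 \<le> y" using assms by linarith
        then have "r powr y * r \<le> 1" using r assms by (intro mult_le_one powr_le1) auto
        then have "N r * ennreal (r powr y * r) \<le> N r * 1" by (intro mult_left_mono) (auto simp: ennreal_le_1)
        then have "ennreal (r powr y) * polar_weight N r \<le> N r"
          using r by (simp add: polar_weight_def ennreal_mult mult_ac)
        then show ?thesis using True r by (simp add: add_increasing)
      next
        case False
        have "r powr y \<le> r powr ((L - 1) * x + x)"
          using r assms by (intro powr_mono') (auto simp: algebra_simps)
        also have "\<dots> = r powr ((L - 1) * x) * r powr x" by (rule powr_add)
        also have "\<dots> \<le> exp (- (L - 1)) * r powr x"
          using r assms False by (intro mult_right_mono powr_le_exp) auto
        finally have "ennreal (r powr y) \<le> ennreal (exp (- (L - 1))) * ennreal (r powr x)"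
          by (subst ennreal_mult[symmetric]) (auto intro: ennreal_leI)
        then have "ennreal (r powr y) * polar_weight N r \<le> ennreal (exp (- (L - 1))) * ennreal (r powr x) * polar_weight N r"
          by (rule mult_right_mono) simp
        then show ?thesis using False by (simp add: mult.assoc)
      qed
    qed
  qed
  also have "\<dots> = ennreal (exp (- (L - 1))) * moment N x + radial_tail N (1 - 1 / x)"
    unfolding moment_def radial_tail_def
    by (subst nn_integral_add, measurable, subst nn_integral_cmult, measurable)
  finally show ?thesis .
qed

lemma moment_ge_tail:
  assumes [measurable]: "N \<in> borel_measurable borel" and "2 \<le> x"
  shows "ennreal (exp (- 3)) * radial_tail N (1 - 1 / x) \<le> moment N x"
proof -
  have "ennreal (exp (- 3)) * radial_tail N (1 - 1 / x)
      = (\<integral>\<^sup>+ r. ennreal (exp (- 3)) * (if 1 - 1 / x \<le> r \<and> r < 1 then N r else 0) \<partial>lborel)"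
    unfolding radial_tail_def by (intro nn_integral_cmult[symmetric]) measurable
  also have "\<dots> \<le> moment N x"
    unfolding moment_def
  proof (intro nn_integral_mono)
    fix r
    show "ennreal (exp (- 3)) * (if 1 - 1 / x \<le> r \<and> r < 1 then N r else 0) \<le> ennreal (r powr x) * polar_weight N r"
    proof (cases "1 - 1 / x \<le> r \<and> r < 1")
      case True
      have "1 / x \<le> 1/2" using assms by (simp add: field_simps)
      then have "0 < r" using True by linarith
      have "ennreal (exp (- 3)) * N r \<le> ennreal (r powr x * r) * N r"
        using True assms by (intro mult_right_mono ennreal_leI exp_le_powr_mult) auto
      then show ?thesis using True \<open>0 < r\<close> by (simp add: polar_weight_def ennreal_mult mult_ac)
    qed auto
  qed
  finally show ?thesis .
qed

abbreviation "tail_quotient N \<equiv> (\<lambda>r. radial_tail N r / ennreal (1 - r))"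

lemma polar_weight_tail_quotient:
  assumes "0 < r" "r < 1"
  shows "polar_weight (tail_quotient N) r = radial_tail N r * ennreal (r / (1 - r))"
proof -
  have "0 < 1 - r" "0 \<le> r" using assms by auto
  then have "ennreal (r / (1 - r)) = ennreal r * inverse (ennreal (1 - r))"
    unfolding inverse_ennreal[OF \<open>0 < 1 - r\<close>] divide_inverse by (intro ennreal_mult) auto
  then show ?thesis using assms by (simp add: polar_weight_def divide_ennreal_def mult_ac)
qed

text \<open>Each of the \<open>j\<close> dyadic shells between \<open>1 - 1 / x\<close> and \<open>1 - 1 / (2 ^ j * x)\<close> contributes equally.\<close>
lemma moment_tail_quotient_ge:
  assumes [measurable]: "N \<in> borel_measurable borel" and x: "2 \<le> x"
  shows "ennreal (exp (- 3) * (real j / 2)) * radial_tail N (1 - 1 / (2 ^ j * x)) \<le> moment (tail_quotient N) x"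
proof -
  define t where "t i = 1 / (2 ^ i * x)" for i :: nat
  have t: "0 < t i" "t (Suc i) = t i / 2" for i using x by (auto simp: t_def)
  have "t (Suc i) \<le> t i" for i using t[of i] by simp
  then have dec: "decseq t" by (rule decseq_SucI)
  have t1: "t i \<le> 1 / x" for i using dec decseqD[of t 0 i] by (simp add: t_def)
  have [measurable]: "tail_quotient N \<in> borel_measurable borel" by measurable
  define T where "T = radial_tail N (1 - t j)"
  define c where "c i = ennreal (exp (- 3) / t i) * T" for i
  have "ennreal (exp (- 3) * (real j / 2)) * T = (\<Sum>i<j. c i * emeasure lborel (shell t i))"
  proof -
    have "c i * emeasure lborel (shell t i) = ennreal (exp (- 3) / 2) * T" for i
    proof -
      have "emeasure lborel (shell t i) = ennreal (t i / 2)"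
        unfolding shell_def using t[of i] by simp
      then have "c i * emeasure lborel (shell t i) = ennreal (exp (- 3) / t i) * ennreal (t i / 2) * T"
        by (simp add: c_def mult_ac)
      also have "ennreal (exp (- 3) / t i) * ennreal (t i / 2) = ennreal (exp (- 3) / 2)"
        using t[of i] by (subst ennreal_mult[symmetric]) auto
      finally show ?thesis .
    qed
    then have "(\<Sum>i<j. c i * emeasure lborel (shell t i)) = of_nat j * (ennreal (exp (- 3) / 2) * T)" by simp
    also have "\<dots> = ennreal (real j) * ennreal (exp (- 3) / 2) * T" by (simp add: mult.assoc ennreal_of_nat_eq_real_of_nat)
    also have "ennreal (real j) * ennreal (exp (- 3) / 2) = ennreal (exp (- 3) * (real j / 2))"
      by (subst ennreal_mult[symmetric]) auto
    finally show ?thesis by simp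
  qed
  also have "\<dots> = (\<integral>\<^sup>+ r. (\<Sum>i<j. c i * indicator (shell t i) r) \<partial>lborel)"
    by (subst nn_integral_sum) (auto simp: nn_integral_cmult_indicator)
  also have "\<dots> \<le> moment (tail_quotient N) x"
    unfolding moment_def
  proof (intro nn_integral_mono)
    fix r
    let ?P = "ennreal (r powr x) * polar_weight (tail_quotient N) r"
    have "c i * indicator (shell t i) r \<le> ?P * indicator (shell t i) r" if i: "i < j" for i
    proof (cases "r \<in> shell t i")
      case True
      have "t j \<le> t (Suc i)" using i dec by (auto simp: decseq_def)
      then have r: "1 - t i \<le> r" "r \<le> 1 - t j" "r < 1" "1 - 1 / x \<le> r"
        using True t(1)[of "Suc i"] t1[of i] by (auto simp: shell_def)
      have "1 / x \<le> 1/2" using x by (simp add: field_simps)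
      then have "0 < r" using r by linarith
      have "c i \<le> ennreal (r powr x * r / (1 - r)) * radial_tail N r"
        unfolding c_def T_def using r x t(1)[of i] \<open>0 < r\<close>
        by (intro mult_mono ennreal_leI radial_tail_antimono frac_le exp_le_powr_mult) auto
      also have "\<dots> = ennreal (r powr x) * ennreal (r / (1 - r)) * radial_tail N r"
        using \<open>0 < r\<close> r by (subst ennreal_mult[symmetric]) auto
      also have "\<dots> = ?P" using polar_weight_tail_quotient[OF \<open>0 < r\<close> r(3)] by (simp add: mult_ac)
      finally show ?thesis by (rule mult_right_mono) simp
    qed simp
    then have "(\<Sum>i<j. c i * indicator (shell t i) r) \<le> (\<Sum>i<j. ?P * indicator (shell t i) r)"
      by (intro sum_mono) auto
    also have "\<dots> = ?P * (\<Sum>i<j. indicator (shell t i) r)" by (simp add: sum_distrib_left)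
    also have "\<dots> \<le> ?P * 1"
    proof (intro mult_left_mono)
      have "(\<Sum>i<j. indicator (shell t i) r) \<le> (\<Sum>i. indicator (shell t (i + 0)) r :: ennreal)"
        using sum_le_suminf[of "\<lambda>i. indicator (shell t i) r :: ennreal" "{..<j}"] by simp
      also have "\<dots> \<le> 1" by (rule suminf_shell_le[OF dec])
      finally show "(\<Sum>i<j. indicator (shell t i) r) \<le> (1::ennreal)" .
    qed simp
    finally show "(\<Sum>i<j. c i * indicator (shell t i) r) \<le> ?P" by simp
  qed
  finally show ?thesis by (simp add: T_def t_def)
qed

lemma one_minus_powr_le:
  fixes r a :: real
  assumes "0 < r" "r < 1" "1 \<le> a"
  shows "1 - r powr a \<le> a * (1 - r)"
proof -
  have "\<exists>z>r. z < 1 \<and> 1 powr a - r powr a = (1 - r) * (a * z powr (a - 1))"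
    using assms by (intro MVT2) (auto intro!: derivative_eq_intros)
  then obtain z where z: "r < z" "z < 1" "1 - r powr a = (1 - r) * (a * z powr (a - 1))" by auto
  have "z powr (a - 1) \<le> 1" using z assms by (intro powr_le1) auto
  then have "(1 - r) * (a * z powr (a - 1)) \<le> (1 - r) * (a * 1)"
    using assms by (intro mult_left_mono) auto
  then show ?thesis using z(3) by (simp add: mult.commute)
qed

text \<open>By Tonelli the inner integral for fixed \<open>s\<close> is
  \<open>s powr (x + 2) / (x + 2)\<close>; it is weakened to \<open>s powr (x + 1) / (x + 1)\<close>
  to match the moment.\<close>

lemma integral_powr_tail_le:
  assumes [measurable]: "N \<in> borel_measurable borel" and x: "0 \<le> x"
  shows "(\<integral>\<^sup>+ r. (if 0 < r \<and> r < 1 then ennreal (r powr (x + 1)) * radial_tail N r else 0) \<partial>lborel)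
    \<le> ennreal (1 / (x + 1)) * moment N x"
proof -
  have "(\<integral>\<^sup>+ r. (if 0 < r \<and> r < 1 then ennreal (r powr (x + 1)) * radial_tail N r else 0) \<partial>lborel)
    = (\<integral>\<^sup>+ r. \<integral>\<^sup>+ s. (if 0 < r \<and> r < 1 then ennreal (r powr (x + 1)) * (if r \<le> s \<and> s < 1 then N s else 0) else 0) \<partial>lborel \<partial>lborel)"
    unfolding radial_tail_def
    by (intro nn_integral_cong) (auto simp: nn_integral_cmult)
  also have "\<dots> = (\<integral>\<^sup>+ s. \<integral>\<^sup>+ r. (if 0 < r \<and> r < 1 then ennreal (r powr (x + 1)) * (if r \<le> s \<and> s < 1 then N s else 0) else 0) \<partial>lborel \<partial>lborel)"
    by (intro lborel_pair.Fubini') measurable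
  also have "\<dots> \<le> (\<integral>\<^sup>+ s. ennreal (1 / (x + 1)) * (ennreal (s powr x) * polar_weight N s) \<partial>lborel)"
  proof (intro nn_integral_mono)
    fix s
    show "(\<integral>\<^sup>+ r. (if 0 < r \<and> r < 1 then ennreal (r powr (x + 1)) * (if r \<le> s \<and> s < 1 then N s else 0) else 0) \<partial>lborel)
      \<le> ennreal (1 / (x + 1)) * (ennreal (s powr x) * polar_weight N s)"
    proof (cases "0 < s \<and> s < 1")
      case True
      have "(\<integral>\<^sup>+ r. (if 0 < r \<and> r < 1 then ennreal (r powr (x + 1)) * (if r \<le> s \<and> s < 1 then N s else 0) else 0) \<partial>lborel)
        \<le> (\<integral>\<^sup>+ r. ennreal (r powr (x + 1)) * indicator {0..s} r * N s \<partial>lborel)"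
        by (intro nn_integral_mono) (auto simp: indicator_def)
      also have "\<dots> = (\<integral>\<^sup>+ r. ennreal (r powr (x + 1)) * indicator {0..s} r \<partial>lborel) * N s"
        by (intro nn_integral_multc) measurable
      also have "(\<integral>\<^sup>+ r. ennreal (r powr (x + 1)) * indicator {0..s} r \<partial>lborel) = ennreal (s powr (x + 1 + 1) / (x + 1 + 1))"
        using True x has_integral_powr_from_0[of "x + 1" s]
        by (intro nn_integral_has_integral_lebesgue') (auto simp: mult.commute)
      also have "ennreal (s powr (x + 1 + 1) / (x + 1 + 1)) * N s \<le> ennreal (s powr x * s / (x + 1)) * N s"
      proof (intro mult_right_mono ennreal_leI frac_le)
        have "s powr (x + 1 + 1) = s powr x * s * s" using True by (simp add: powr_add power2_eq_square)
        also have "\<dots> \<le> s powr x * s * 1" using True by (intro mult_left_mono) auto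
        finally show "s powr (x + 1 + 1) \<le> s powr x * s" by simp
      qed (use True x in auto)
      also have "ennreal (s powr x * s / (x + 1)) = ennreal (1 / (x + 1)) * (ennreal (s powr x) * ennreal s)"
        using True x by (simp add: ennreal_mult[symmetric])
      finally show ?thesis using True by (simp add: polar_weight_def mult_ac)
    next
      case False
      then have "(\<integral>\<^sup>+ r. (if 0 < r \<and> r < 1 then ennreal (r powr (x + 1)) * (if r \<le> s \<and> s < 1 then N s else 0) else 0) \<partial>lborel)
        = (\<integral>\<^sup>+ (r::real). 0 \<partial>lborel)" by (intro nn_integral_cong) auto
      then show ?thesis by simp
    qed
  qed
  also have "\<dots> = ennreal (1 / (x + 1)) * moment N x"
    unfolding moment_def by (intro nn_integral_cmult) measurable
  finally show ?thesis .
qed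

text \<open>The factor \<open>1 - r\<close> gained from the difference of powers cancels the
  singular denominator of the regularization; what is left is a power integrated against the tail.
  Stating it as a sum avoids subtracting possibly infinite values.\<close>

lemma moment_tail_quotient_diff:
  assumes [measurable]: "N \<in> borel_measurable borel" and x: "0 \<le> x" "x + 1 \<le> y"
  shows "moment (tail_quotient N) x \<le> moment (tail_quotient N) y + ennreal ((y - x) / (x + 1)) * moment N x"
proof -
  have "moment (tail_quotient N) x \<le> (\<integral>\<^sup>+ r. ennreal (r powr y) * polar_weight (tail_quotient N) r
      + ennreal (y - x) * (if 0 < r \<and> r < 1 then ennreal (r powr (x + 1)) * radial_tail N r else 0) \<partial>lborel)"
    unfolding moment_def
  proof (intro nn_integral_mono)
    fix r
    show "ennreal (r powr x) * polar_weight (tail_quotient N) r \<le> ennreal (r powr y) * polar_weight (tail_quotient N) r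
      + ennreal (y - x) * (if 0 < r \<and> r < 1 then ennreal (r powr (x + 1)) * radial_tail N r else 0)"
    proof (cases "0 < r \<and> r < 1")
      case r: True
      have "1 - r powr (y - x) \<le> (y - x) * (1 - r)" using r x by (intro one_minus_powr_le) auto
      then have "r powr x * (r / (1 - r)) * (1 - r powr (y - x)) \<le> r powr x * (r / (1 - r)) * ((y - x) * (1 - r))"
        using r by (intro mult_left_mono) auto
      also have "\<dots> = (y - x) * r powr (x + 1)" using r by (simp add: powr_add)
      finally have "r powr x * (r / (1 - r)) \<le> r powr x * (r / (1 - r)) * r powr (y - x) + (y - x) * r powr (x + 1)"
        unfolding right_diff_distrib[of "r powr x * (r / (1 - r))"] by linarith
      also have "r powr x * (r / (1 - r)) * r powr (y - x) = r powr y * (r / (1 - r))"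
        using powr_add[of r x "y - x"] by simp
      finally have "r powr x * (r / (1 - r)) \<le> r powr y * (r / (1 - r)) + (y - x) * r powr (x + 1)" .
      then have "ennreal (r powr x * (r / (1 - r))) \<le> ennreal (r powr y * (r / (1 - r)) + (y - x) * r powr (x + 1))"
        by (rule ennreal_leI)
      also have "\<dots> = ennreal (r powr y) * ennreal (r / (1 - r)) + ennreal (y - x) * ennreal (r powr (x + 1))"
        using r x by (subst ennreal_plus, simp, simp, subst ennreal_mult, simp, simp, subst ennreal_mult) auto
      finally have "radial_tail N r * ennreal (r powr x * (r / (1 - r)))
        \<le> radial_tail N r * (ennreal (r powr y) * ennreal (r / (1 - r)) + ennreal (y - x) * ennreal (r powr (x + 1)))"
        by (rule mult_left_mono) simp
      moreover have "ennreal (r powr x * (r / (1 - r))) = ennreal (r powr x) * ennreal (r / (1 - r))"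
        using r by (intro ennreal_mult) auto
      ultimately show ?thesis
        using r polar_weight_tail_quotient[of r N] by (simp add: distrib_left mult_ac)
    next
      case False
      then have "polar_weight (tail_quotient N) r = 0" by (auto simp: polar_weight_def indicator_def ennreal_neg)
      then show ?thesis by simp
    qed
  qed
  also have "\<dots> = moment (tail_quotient N) y + ennreal (y - x) *
      (\<integral>\<^sup>+ r. (if 0 < r \<and> r < 1 then ennreal (r powr (x + 1)) * radial_tail N r else 0) \<partial>lborel)"
    unfolding moment_def by (subst nn_integral_add, measurable, subst nn_integral_cmult, measurable)
  also have "\<dots> \<le> moment (tail_quotient N) y + ennreal (y - x) * (ennreal (1 / (x + 1)) * moment N x)"
    using x by (intro add_left_mono mult_left_mono integral_powr_tail_le) auto
  also have "ennreal (y - x) * (ennreal (1 / (x + 1)) * moment N x) = ennreal ((y - x) / (x + 1)) * moment N x"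
    using x by (simp add: mult.assoc[symmetric] ennreal_mult[symmetric])
  finally show ?thesis .
qed


section \<open>From moments to the class D\<close>

lemma D_class_of_moments:
  assumes \<omega>: "radial_weight \<omega>" and rep: "radial_rep (\<lambda>z. ennreal (\<omega> z)) N"
    and fin: "(\<integral>\<^sup>+ r. polar_weight N r \<partial>lborel) < top" and "0 < p" "1 \<le> C"
    and le: "\<And>n::nat. moment N (n * p) \<le> ennreal C * moment (tail_quotient N) (n * p)"
    and ge: "\<And>n::nat. moment (tail_quotient N) (n * p) \<le> ennreal C * moment N (n * p)"
  shows "\<omega> \<in> D_class"
proof -
  have N[measurable]: "N \<in> borel_measurable borel" using rep unfolding radial_rep_def by blast
  define m where "m x = enn2real (moment N x)" for x
  define \<phi> where "\<phi> x = enn2real (moment (tail_quotient N) x)" for x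
  define \<tau> where "\<tau> x = enn2real (radial_tail N (1 - 1 / x))" for x
  have fin1: "moment N x < top" if "0 \<le> x" for x
    using moment_le[OF that] fin by (rule le_less_trans)
  have fin2: "moment (tail_quotient N) x < top" if "0 \<le> x" for x
  proof -
    have "moment (tail_quotient N) x \<le> moment (tail_quotient N) 0" using that by (rule moment_antimono)
    \<comment> \<open>Finiteness of the moments of the regularization is not known in advance; it
      follows from the comparison at \<open>n = 0\<close>.\<close>
    also have "\<dots> \<le> ennreal C * moment N 0" using ge[of 0] by simp
    also have "\<dots> < top" using fin1[of 0] by (simp add: ennreal_mult_less_top)
    finally show ?thesis .
  qed
  have fin3: "radial_tail N (1 - 1 / x) < top" if "2 \<le> x" for x
    using that by (intro radial_tail_finite N fin) (simp add: field_simps)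
  have m: "moment N x = ennreal (m x)" if "0 \<le> x" for x using fin1[OF that] by (simp add: m_def)
  have ph: "moment (tail_quotient N) x = ennreal (\<phi> x)" if "0 \<le> x" for x using fin2[OF that] by (simp add: \<phi>_def)
  have ta: "radial_tail N (1 - 1 / x) = ennreal (\<tau> x)" if "2 \<le> x" for x using fin3[OF that] by (simp add: \<tau>_def)
  have nn: "0 \<le> m x" "0 \<le> \<phi> x" "0 \<le> \<tau> x" for x by (auto simp: m_def \<phi>_def \<tau>_def)
  interpret moment_comparison m \<phi> \<tau> p C
  proof
    show "0 < p" "1 \<le> C" by fact+
    show "\<phi> y \<le> \<phi> x" if "0 \<le> x" "x \<le> y" for x y
      unfolding \<phi>_def using that fin2[of x] by (intro enn2real_mono moment_antimono) auto
    show "\<tau> y \<le> \<tau> x" if "2 \<le> x" "x \<le> y" for x y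
      unfolding \<tau>_def using that fin3[of x] by (intro enn2real_mono radial_tail_antimono) (auto intro: divide_left_mono)
    show "0 \<le> \<tau> x" for x by (rule nn)
    have np: "0 \<le> real n * p" for n using \<open>0 < p\<close> by simp
    show "m (n * p) \<le> C * \<phi> (n * p)" for n :: nat
      using le[of n] nn(2)[of "n * p"] \<open>1 \<le> C\<close> unfolding m[OF np] ph[OF np] by (simp flip: ennreal_mult)
    show "\<phi> (n * p) \<le> C * m (n * p)" for n :: nat
      using ge[of n] nn(1)[of "n * p"] \<open>1 \<le> C\<close> unfolding m[OF np] ph[OF np] by (simp flip: ennreal_mult)
    show "\<phi> x \<le> \<phi> y + (y - x) / (x + 1) * m x" if "0 \<le> x" "x + 1 \<le> y" for x y
    proof -
      have "0 \<le> y" "0 \<le> (y - x) / (x + 1)" using that by auto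
      then have "ennreal (\<phi> y + (y - x) / (x + 1) * m x) = ennreal (\<phi> y) + ennreal ((y - x) / (x + 1)) * ennreal (m x)"
        using nn by (simp only: ennreal_plus ennreal_mult mult_nonneg_nonneg)
      then have "ennreal (\<phi> x) \<le> ennreal (\<phi> y + (y - x) / (x + 1) * m x)"
        using moment_tail_quotient_diff[OF N that]
        by (simp only: m[OF that(1)] ph[OF that(1)] ph[OF \<open>0 \<le> y\<close>])
      moreover have "0 \<le> \<phi> y + (y - x) / (x + 1) * m x"
        using nn \<open>0 \<le> (y - x) / (x + 1)\<close> by (intro add_nonneg_nonneg mult_nonneg_nonneg)
      ultimately show ?thesis by (simp only: ennreal_le_iff)
    qed
    show "m y \<le> exp (- (L - 1)) * m x + \<tau> x" if "2 \<le> x" "1 \<le> L" "L * x \<le> y" for x y L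
    proof -
      have "0 \<le> L * x" using that by simp
      then have "0 \<le> x" "0 \<le> y" using that by linarith+
      then show ?thesis
        using moment_split[OF N that] nn(1)[of x] nn(3)[of x]
        unfolding m[OF \<open>0 \<le> x\<close>] m[OF \<open>0 \<le> y\<close>] ta[OF that(1)]
        by (simp flip: ennreal_mult ennreal_plus)
    qed
    show "exp (- 3) * \<tau> x \<le> m x" if "2 \<le> x" for x
    proof -
      have "0 \<le> x" using that by simp
      show ?thesis
        using moment_ge_tail[OF N that] nn(1)[of x] nn(3)[of x]
        unfolding m[OF \<open>0 \<le> x\<close>] ta[OF that] by (simp flip: ennreal_mult)
    qed
    show "exp (- 3) * (real j / 2) * \<tau> (2 ^ j * x) \<le> \<phi> x" if "2 \<le> x" for x j
    proof -
      have "0 \<le> x" using that by simp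
      have "1 * x \<le> 2 ^ j * x" using that by (intro mult_right_mono) auto
      then have "2 \<le> 2 ^ j * x" using that by linarith
      have "0 \<le> exp (- 3) * (real j / 2)" by simp
      then have "ennreal (exp (- 3) * (real j / 2) * \<tau> (2 ^ j * x)) \<le> ennreal (\<phi> x)"
        using moment_tail_quotient_ge[OF N that, of j]
        unfolding ph[OF \<open>0 \<le> x\<close>] ta[OF \<open>2 \<le> 2 ^ j * x\<close>] by (subst ennreal_mult) (auto simp: nn)
      then show ?thesis by (simp add: nn)
    qed
  qed
  \<comment> \<open>Dictionary between radii and exponents: \<open>x = 1 / (1 - r)\<close>.
    Multiplying \<open>x\<close> by 2 or by \<open>K\<close> divides the distance
    \<open>1 - r\<close> to the circle by the same factor.\<close>
  have x_of: "2 \<le> 1 / (1 - r)" "X \<le> 1 / (1 - r)" "0 < r" "r < 1" "1 - 1 / (1 / (1 - r)) = r"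
    if r: "1 - 1 / max X 2 < r" "r < 1" for r X :: real
  proof -
    have mx: "2 \<le> max X 2" "X \<le> max X 2" by auto
    have "1 - r < 1 / max X 2" using r by simp
    then have "max X 2 * (1 - r) < max X 2 * (1 / max X 2)" using mx by (intro mult_strict_left_mono) auto
    then have "max X 2 * (1 - r) < 1" using mx by simp
    then have "max X 2 < 1 / (1 - r)" using r pos_less_divide_eq[of "1 - r" "max X 2" 1] by linarith
    then show "2 \<le> 1 / (1 - r)" "X \<le> 1 / (1 - r)" using mx by linarith+
    have "1 / max X 2 \<le> 1/2" using mx by (intro frac_le) auto
    then show "0 < r" using r by linarith
    show "r < 1" "1 - 1 / (1 / (1 - r)) = r" using r by auto
  qed
  have ev: "\<forall>\<^sub>F r in at_left 1. 1 - 1 / max X 2 < r \<and> r < 1" for X :: real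
  proof -
    have "1 - 1 / max X 2 < 1" by auto
    then show ?thesis unfolding eventually_at_left_field by blast
  qed
  have "\<omega> \<in> D_hat"
  proof -
    obtain D X where D: "0 < D" "\<And>x. X \<le> x \<Longrightarrow> \<tau> x \<le> D * \<tau> (2 * x)" using tau_doubling by blast
    have "\<forall>\<^sub>F r in at_left 1. tail \<omega> (of_real r) \<le> ennreal D * tail \<omega> (of_real ((1 + r) / 2))"
      using ev[of X]
    proof eventually_elim
      case (elim r)
      note x = x_of[of X r]
      define x where "x = 1 / (1 - r)"
      have x: "2 \<le> x" "X \<le> x" "0 < r" "r < 1" "1 - 1 / x = r" using x elim by (auto simp: x_def)
      have half: "1 - 1 / (2 * x) = (1 + r) / 2" using x by (simp add: x_def field_simps)
      have "2 \<le> 2 * x" using x(1) by simp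
      have e: "radial_tail N r = ennreal (\<tau> x)" "radial_tail N ((1 + r) / 2) = ennreal (\<tau> (2 * x))"
        by (rule ta[OF x(1), unfolded x(5)], rule ta[OF \<open>2 \<le> 2 * x\<close>, unfolded half])
      have "radial_tail N r \<le> ennreal D * radial_tail N ((1 + r) / 2)"
        using D(2)[OF x(2)] D(1) unfolding e by (simp add: nn flip: ennreal_mult)
      then show ?case
        using x tail_eq_radial_tail[OF rep, of r] tail_eq_radial_tail[OF rep, of "(1 + r) / 2"] by simp
    qed
    then show ?thesis using \<omega> D(1) unfolding D_hat_def by blast
  qed
  moreover have "\<omega> \<in> D_check"
  proof -
    obtain K X where K: "1 < K" "\<And>x. X \<le> x \<Longrightarrow> 2 * \<tau> (K * x) \<le> \<tau> x" using tau_decay by blast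
    have "\<forall>\<^sub>F r in at_left 1. tail \<omega> (of_real r) \<ge> ennreal 2 * tail \<omega> (of_real (1 - (1 - r) / K))"
      using ev[of X]
    proof eventually_elim
      case (elim r)
      note x = x_of[of X r]
      define x where "x = 1 / (1 - r)"
      have x: "2 \<le> x" "X \<le> x" "0 < r" "r < 1" "1 - 1 / x = r" using x elim by (auto simp: x_def)
      have Kx: "1 - 1 / (K * x) = 1 - (1 - r) / K" using x K by (simp add: x_def field_simps)
      have "1 * x \<le> K * x" using x K by (intro mult_right_mono) auto
      then have "2 \<le> K * x" using x by linarith
      have "ennreal 2 * radial_tail N (1 - (1 - r) / K) \<le> radial_tail N r"
        using K(2)[OF x(2)] ta[OF x(1)] ta[OF \<open>2 \<le> K * x\<close>] x(5) Kx
        by (simp add: nn ennreal_mult[symmetric] del: ennreal_numeral)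
      moreover have "(1 - r) / K \<le> (1 - r) / 1" using x K by (intro divide_left_mono) auto
      ultimately show ?case
        using x tail_eq_radial_tail[OF rep, of r] tail_eq_radial_tail[OF rep, of "1 - (1 - r) / K"] by simp
    qed
    then show ?thesis using \<omega> K(1) unfolding D_check_def
      by (intro CollectI conjI exI[of _ K] exI[of _ 2]) auto
  qed
  ultimately show ?thesis by (simp add: D_class_def)
qed

section \<open>Spaces of holomorphic functions and the equivalences\<close>

definition holo_space :: "bool \<Rightarrow> real \<Rightarrow> real \<Rightarrow> (complex \<Rightarrow> ennreal) \<Rightarrow> (complex \<Rightarrow> complex) set" where
  "holo_space tent q p \<nu> = {f. f holomorphic_on ball 0 1 \<and> mixed_norm tent q p \<nu> f < \<infinity>}"

lemma holo_space_eq: "AL_space q p \<nu> = holo_space False q p \<nu>" "AT_space q p \<nu> = holo_space True q p \<nu>"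
proof -
  have "f \<in> borel_measurable (lebesgue_on (ball 0 1))" if "f holomorphic_on ball 0 1" for f :: "complex \<Rightarrow> complex"
    using that by (intro continuous_imp_measurable_on_sets_lebesgue holomorphic_on_imp_continuous_on) auto
  then show "AL_space q p \<nu> = holo_space False q p \<nu>" "AT_space q p \<nu> = holo_space True q p \<nu>"
    by (auto simp: AL_space_def L_space_def AT_space_def T_space_def holo_space_def mixed_norm_def)
qed

text \<open>The inequalities hold for all holomorphic functions, infinite values allowed, so each of
  them also gives an inclusion of the spaces.\<close>

lemma same_with_equiv_norms_holo_space:
  assumes "\<exists>C>0. \<forall>f. f holomorphic_on ball 0 1 \<longrightarrow> mixed_norm tent q p \<nu> f \<le> ennreal C * mixed_norm tent' q p \<nu>' f"
    and "\<exists>C>0. \<forall>f. f holomorphic_on ball 0 1 \<longrightarrow> mixed_norm tent' q p \<nu>' f \<le> ennreal C * mixed_norm tent q p \<nu> f"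
  shows "same_with_equiv_norms (holo_space tent q p \<nu>) (mixed_norm tent q p \<nu>) (holo_space tent' q p \<nu>') (mixed_norm tent' q p \<nu>')"
proof -
  obtain C where C: "0 < C" "\<And>f. f holomorphic_on ball 0 1 \<Longrightarrow> mixed_norm tent q p \<nu> f \<le> ennreal C * mixed_norm tent' q p \<nu>' f"
    using assms(1) by blast
  obtain C' where C': "0 < C'" "\<And>f. f holomorphic_on ball 0 1 \<Longrightarrow> mixed_norm tent' q p \<nu>' f \<le> ennreal C' * mixed_norm tent q p \<nu> f"
    using assms(2) by blast
  have le: "ennreal C * x \<le> ennreal (max C C') * x" "ennreal C' * x \<le> ennreal (max C C') * x" for x
    by (auto intro!: mult_right_mono ennreal_leI)
  have "holo_space tent q p \<nu> = holo_space tent' q p \<nu>'"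
  proof (intro equalityI subsetI)
    fix f assume f: "f \<in> holo_space tent q p \<nu>"
    then have "ennreal C' * mixed_norm tent q p \<nu> f < \<infinity>" by (auto simp: holo_space_def ennreal_mult_less_top)
    then show "f \<in> holo_space tent' q p \<nu>'"
      using f C'(2)[of f] by (auto simp: holo_space_def intro: le_less_trans)
  next
    fix f assume f: "f \<in> holo_space tent' q p \<nu>'"
    then have "ennreal C * mixed_norm tent' q p \<nu>' f < \<infinity>" by (auto simp: holo_space_def ennreal_mult_less_top)
    then show "f \<in> holo_space tent q p \<nu>"
      using f C(2)[of f] by (auto simp: holo_space_def intro: le_less_trans)
  qed
  moreover have "mixed_norm tent q p \<nu> f \<le> ennreal (max C C') * mixed_norm tent' q p \<nu>' f \<and>
      mixed_norm tent' q p \<nu>' f \<le> ennreal (max C C') * mixed_norm tent q p \<nu> f" if "f \<in> holo_space tent q p \<nu>" for f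
    using that C(2)[of f] C'(2)[of f] le by (auto simp: holo_space_def intro: order_trans)
  moreover have "0 < max C C'" using C(1) by simp
  ultimately show ?thesis unfolding same_with_equiv_norms_def by blast
qed

lemma D_class_of_same_norms:
  assumes pq: "0 < p" "0 < q" and \<omega>: "radial_weight \<omega>"
    and same: "same_with_equiv_norms (holo_space tent q p (\<lambda>z. ennreal (\<omega> z))) (mixed_norm tent q p (\<lambda>z. ennreal (\<omega> z)))
      (holo_space tent q p (regularized \<omega>)) (mixed_norm tent q p (regularized \<omega>))"
  shows "\<omega> \<in> D_class"
proof -
  let ?\<nu> = "\<lambda>z. ennreal (\<omega> z)"
  obtain N where rep: "radial_rep ?\<nu> N" and fin: "(\<integral>\<^sup>+ r. polar_weight N r \<partial>lborel) < top"
    using radial_weight_rep[OF \<omega>] by blast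
  note rep' = regularized_rep[OF rep]
  obtain c c' where c: "0 < c" "0 < c'" "\<And>\<nu> N n. radial_rep \<nu> N \<Longrightarrow>
    mixed_norm tent q p \<nu> (\<lambda>z. z ^ n) \<le> ennreal c * enn_powr (moment N (n * p)) (1 / p) \<and>
    ennreal c' * enn_powr (moment N (n * p)) (1 / p) \<le> mixed_norm tent q p \<nu> (\<lambda>z. z ^ n)"
    using mixed_norm_monomial[OF pq] by blast
  obtain C where C: "0 < C" "\<And>f. f \<in> holo_space tent q p ?\<nu> \<Longrightarrow>
      mixed_norm tent q p ?\<nu> f \<le> ennreal C * mixed_norm tent q p (regularized \<omega>) f \<and>
      mixed_norm tent q p (regularized \<omega>) f \<le> ennreal C * mixed_norm tent q p ?\<nu> f"
    using same unfolding same_with_equiv_norms_def by blast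
  \<comment> \<open>The equivalence of quasinorms speaks only about members of the space, so the
    monomials have to be placed there.\<close>
  have mono: "(\<lambda>z. z ^ n) \<in> holo_space tent q p ?\<nu>" for n
  proof -
    have "moment N (n * p) < top" using moment_le[of "n * p" N] fin pq by (auto intro: le_less_trans)
    then have "ennreal c * enn_powr (moment N (n * p)) (1 / p) < top" by (simp add: ennreal_mult_less_top)
    then have "mixed_norm tent q p ?\<nu> (\<lambda>z. z ^ n) < top" using c(3)[OF rep, of n] by (auto intro: le_less_trans)
    then show ?thesis unfolding holo_space_def by (auto intro!: holomorphic_intros)
  qed
  define K where "K = C * c / c'"
  have "0 < K" using C c by (simp add: K_def)
  \<comment> \<open>Removing the power \<open>1 / p\<close> turns the constant \<open>K\<close> into
    \<open>K powr p\<close>; the maximum with 1 meets the condition \<open>1 <= C\<close> of the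
    moment criterion.\<close>
  have conv: "x \<le> ennreal (max 1 (K powr p)) * y"
    if "ennreal c' * enn_powr x (1 / p) \<le> ennreal C * (ennreal c * enn_powr y (1 / p))" for x y
  proof -
    have "ennreal (1 / c') * (ennreal c' * enn_powr x (1 / p)) \<le> ennreal (1 / c') * (ennreal C * (ennreal c * enn_powr y (1 / p)))"
      using that by (rule mult_left_mono) simp
    then have "enn_powr x (1 / p) \<le> ennreal K * enn_powr y (1 / p)"
      using C c by (simp add: K_def mult.assoc[symmetric] ennreal_mult[symmetric])
    then have "enn_powr (enn_powr x (1 / p)) p \<le> enn_powr (ennreal K * enn_powr y (1 / p)) p"
      using pq by (intro enn_powr_mono) auto
    then have "x \<le> ennreal (K powr p) * y"
      using pq \<open>0 < K\<close> by (simp add: enn_powr_mult enn_powr_powr)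
    also have "\<dots> \<le> ennreal (max 1 (K powr p)) * y" by (intro mult_right_mono ennreal_leI) auto
    finally show ?thesis .
  qed
  show ?thesis
  proof (rule D_class_of_moments[OF \<omega> rep fin pq(1)])
    show "1 \<le> max 1 (K powr p)" by simp
    fix n :: nat
    let ?f = "\<lambda>z::complex. z ^ n"
    have "ennreal c' * enn_powr (moment N (n * p)) (1 / p) \<le> mixed_norm tent q p ?\<nu> ?f"
      using c(3)[OF rep] by blast
    also have "\<dots> \<le> ennreal C * mixed_norm tent q p (regularized \<omega>) ?f" using C(2)[OF mono] by blast
    also have "\<dots> \<le> ennreal C * (ennreal c * enn_powr (moment (tail_quotient N) (n * p)) (1 / p))"
      using c(3)[OF rep', of n] by (intro mult_left_mono) auto
    finally show "moment N (n * p) \<le> ennreal (max 1 (K powr p)) * moment (tail_quotient N) (n * p)" by (rule conv)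
    have "ennreal c' * enn_powr (moment (tail_quotient N) (n * p)) (1 / p) \<le> mixed_norm tent q p (regularized \<omega>) ?f"
      using c(3)[OF rep'] by blast
    also have "\<dots> \<le> ennreal C * mixed_norm tent q p ?\<nu> ?f" using C(2)[OF mono] by blast
    also have "\<dots> \<le> ennreal C * (ennreal c * enn_powr (moment N (n * p)) (1 / p))"
      using c(3)[OF rep, of n] by (intro mult_left_mono) auto
    finally show "moment (tail_quotient N) (n * p) \<le> ennreal (max 1 (K powr p)) * moment N (n * p)" by (rule conv)
  qed
qed

theorem theorem1p6:
  fixes p q :: real and \<omega> :: "complex \<Rightarrow> real"
  assumes "0 < p" and "0 < q"
    and "radial_weight \<omega>"
    and "\<And>z. z \<in> ball 0 1 \<Longrightarrow> tail \<omega> z > 0"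
  defines "\<nu> \<equiv> (\<lambda>z. ennreal (\<omega> z))"
    and "\<nu>t \<equiv> regularized \<omega>"
  shows "(\<omega> \<in> D_class \<longleftrightarrow>
            same_with_equiv_norms (AL_space q p \<nu>) (L_norm q p \<nu>) (AL_space q p \<nu>t) (L_norm q p \<nu>t)) \<and>
         (\<omega> \<in> D_class \<longleftrightarrow>
            same_with_equiv_norms (AT_space q p \<nu>) (T_norm q p \<nu>) (AT_space q p \<nu>t) (T_norm q p \<nu>t)) \<and>
         (\<omega> \<in> D_class \<longrightarrow>
            same_with_equiv_norms (AL_space q p \<nu>) (L_norm q p \<nu>) (AT_space q p \<nu>) (T_norm q p \<nu>) \<and>
            same_with_equiv_norms (AT_space q p \<nu>) (T_norm q p \<nu>) (AL_space q p \<nu>t) (L_norm q p \<nu>t) \<and>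
            same_with_equiv_norms (AL_space q p \<nu>t) (L_norm q p \<nu>t) (AT_space q p \<nu>t) (T_norm q p \<nu>t))"
proof -
  have norms: "L_norm = mixed_norm False" "T_norm = mixed_norm True"
    by (simp_all add: mixed_norm_def)
  have forward: "same_with_equiv_norms (holo_space tent q p \<mu>) (mixed_norm tent q p \<mu>)
      (holo_space tent' q p \<mu>') (mixed_norm tent' q p \<mu>')"
    if "\<omega> \<in> D_class" "\<mu> \<in> {\<nu>, \<nu>t}" "\<mu>' \<in> {\<nu>, \<nu>t}" for tent tent' \<mu> \<mu>'
    using D_class_mixed_norm_le[OF assms(1-4) that(1), of \<mu> \<mu>' tent' tent]
      D_class_mixed_norm_le[OF assms(1-4) that(1), of \<mu>' \<mu> tent tent'] that(2,3)
    unfolding \<nu>_def \<nu>t_def by (intro same_with_equiv_norms_holo_space) auto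
  have backward: "\<omega> \<in> D_class"
    if "same_with_equiv_norms (holo_space tent q p \<nu>) (mixed_norm tent q p \<nu>) (holo_space tent q p \<nu>t) (mixed_norm tent q p \<nu>t)" for tent
    using that unfolding \<nu>_def \<nu>t_def by (rule D_class_of_same_norms[OF assms(1-3)])
  show ?thesis
    unfolding holo_space_eq norms using forward backward by blast
qed

end
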